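(* Let $F$ be a distribution function with $F(0^-)=0$ such that $F(0)=F(\delta)=p$ for some $\delta>0$ and some $p\in[1/2,1)$, and such that $\int x^\eta\,\mathrm{d}F(x)<\infty$ for some $\eta>4$. Let $(\tau_e)_{e\in\mathbb{E}^2}$ be i.i.d. with distribution function $F$. If $f:[0,\infty)\to[0,\infty)$ with $f(0)=0$ and a sequence of integers $0=r_0<r_1<r_2<\cdots$ satisfy assumptions A1, A2, A3 (stated in the context) for some $k_1>0$, $K_2\in[1,\infty)$, and $k_3:[0,\infty)\to(0,\infty)$, then $$\frac{T_f(0,P(n))-\mathbb{E}T_f(0,P(n))}{\sqrt{\mathrm{Var}\,T_f(0,P(n))}}\Rightarrow N(0,1)\quad\text{as }n\to\infty,$$ where $N(0,1)$ denotes the standard normal distribution and $\Rightarrow$ convergence in distribution.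
   Context: $\mathbb{E}^2$ is the set of nearest-neighbor edges of $\mathbb{Z}^2$. For $f:[0,\infty)\to[0,\infty)$ with $f(0)=0$, the graph $\mathbb{G}_f=(\mathbb{V}_f,\mathbb{E}_f)$ has $\mathbb{V}_f=\{(x_1,x_2)\in\mathbb{Z}^2:x_1\ge0,\ 0\le x_2\le f(x_1)\}$ and $\mathbb{E}_f$ the set of all nearest-neighbor edges between vertices of $\mathbb{V}_f$. For a path $\gamma$ in $\mathbb{G}_f$, $T_f(\gamma)$ is the sum of $\tau_e$ over the edges $e$ of $\gamma$; $T_f(x,y)=\inf_{\gamma:x\to y}T_f(\gamma)$ over paths in $\mathbb{G}_f$; $T_f(x,S)=\inf_{y\in S\cap\mathbb{V}_f}T_f(x,y)$ and $T_f(S,S')=\inf_{x\in S\cap\mathbb{V}_f}T_f(x,S')$. $P(n)=\{(x_1,x_2)\in\mathbb{Z}^2:x_1=n\}$; $0$ is the origin. Let $(t_e)_{e\in\mathbb{E}^2}$ be i.i.d. with $\mathbb{P}(t_e=0)=p=1-\mathbb{P}(t_e=1)$, where $p=F(0)$; $T_f^B$ denotes the passage time defined as $T_f$ but with weights $(t_e)$ in place of $(\tau_e)$. Given integers $0=r_0<r_1<\cdots$, set $R_i=\{(x_1,x_2)\in\mathbb{V}_f:r_i\le x_1\le r_{i+1}\}$. A path with all vertices in $R_i$ is a top-down crossing of $R_i$ if its first vertex is in $\{(x_1,x_2)\in R_i:(x_1,x_2+1)\notin R_i\}$ and its last vertex is in $\{(x_1,x_2)\in R_i:x_2=0\}$;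 it is open if all its edges $e$ have $t_e=0$. Assumptions for $k_1>0$, $K_2\in[1,\infty)$, $k_3:[0,\infty)\to(0,\infty)$: A1. $\liminf_{i\to\infty}\mathbb{P}(\exists\text{ top-down open crossing of }R_i)\ge k_1$. A2. $\limsup_{i\to\infty}\left[\mathbb{E}T_f^B(0,P(r_{i+1}))-\mathbb{E}T_f^B(0,P(r_i))\right]\le K_2$. A3. $\liminf_{i\to\infty}\mathbb{P}(T_f^B(P(r_i),P(r_{i+1}))\ge M)\ge k_3(M)$ for each $M\ge0$. *)

theory Defs
  imports "HOL-Probability.Probability"
begin

type_synonym vertex = "int \<times> int"
type_synonym edge = "vertex set"

definition lattice_edges :: "edge set" where
  "lattice_edges = {{(x1, x2), (y1, y2)} | x1 x2 y1 y2. \<bar>x1 - y1\<bar> + \<bar>x2 - y2\<bar> = 1}"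

definition V :: "(real \<Rightarrow> real) \<Rightarrow> vertex set" where
  "V f = {(x1, x2). 0 \<le> x1 \<and> 0 \<le> x2 \<and> real_of_int x2 \<le> f (real_of_int x1)}"

definition E :: "(real \<Rightarrow> real) \<Rightarrow> edge set" where
  "E f = {e \<in> lattice_edges. e \<subseteq> V f}"

(* A path is a nonempty list of vertices; [x] is the trivial path from x to x, without edges. *)

definition path_edges :: "vertex list \<Rightarrow> edge list" where
  "path_edges \<gamma> = map2 (\<lambda>x y. {x, y}) \<gamma> (tl \<gamma>)"

definition is_path :: "(real \<Rightarrow> real) \<Rightarrow> vertex list \<Rightarrow> bool" where
  "is_path f \<gamma> \<longleftrightarrow> \<gamma> \<noteq> [] \<and> set \<gamma> \<subseteq> V f \<and> set (path_edges \<gamma>) \<subseteq> E f"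

(* Below, w is a realisation of the edge weights. The infima are infima of reals: when f \<ge> 0 on
   [0,\<infinity>), the graph is connected and meets every column n \<ge> 0, so that none of the index sets
   that occur is empty, and for nonnegative w all infima are over sets bounded below by 0. Weights
   are only almost surely nonnegative, so on a null event these infima may be meaningless. *)

definition passage_time :: "(edge \<Rightarrow> real) \<Rightarrow> vertex list \<Rightarrow> real" where
  "passage_time w \<gamma> = sum_list (map w (path_edges \<gamma>))"

definition T_pt_pt :: "(real \<Rightarrow> real) \<Rightarrow> (edge \<Rightarrow> real) \<Rightarrow> vertex \<Rightarrow> vertex \<Rightarrow> real" where
  "T_pt_pt f w x y = (INF \<gamma> \<in> {\<gamma>. is_path f \<gamma> \<and> hd \<gamma> = x \<and> last \<gamma> = y}. passage_time w \<gamma>)"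

definition T_pt_set :: "(real \<Rightarrow> real) \<Rightarrow> (edge \<Rightarrow> real) \<Rightarrow> vertex \<Rightarrow> vertex set \<Rightarrow> real" where
  "T_pt_set f w x S = (INF y \<in> S \<inter> V f. T_pt_pt f w x y)"

definition T_set_set :: "(real \<Rightarrow> real) \<Rightarrow> (edge \<Rightarrow> real) \<Rightarrow> vertex set \<Rightarrow> vertex set \<Rightarrow> real" where
  "T_set_set f w S S' = (INF x \<in> S \<inter> V f. T_pt_set f w x S')"

definition P :: "int \<Rightarrow> vertex set" where
  "P n = {(x1, x2). x1 = n}"

definition R :: "(real \<Rightarrow> real) \<Rightarrow> (nat \<Rightarrow> int) \<Rightarrow> nat \<Rightarrow> vertex set" where
  "R f r i = {(x1, x2) \<in> V f. r i \<le> x1 \<and> x1 \<le> r (Suc i)}"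

definition top_down_crossing ::
  "(real \<Rightarrow> real) \<Rightarrow> (nat \<Rightarrow> int) \<Rightarrow> nat \<Rightarrow> vertex list \<Rightarrow> bool" where
  "top_down_crossing f r i \<gamma> \<longleftrightarrow>
     is_path f \<gamma> \<and> set \<gamma> \<subseteq> R f r i \<and>
     hd \<gamma> \<in> {(x1, x2) \<in> R f r i. (x1, x2 + 1) \<notin> R f r i} \<and>
     last \<gamma> \<in> {(x1, x2) \<in> R f r i. x2 = 0}"

definition open_path :: "(edge \<Rightarrow> real) \<Rightarrow> vertex list \<Rightarrow> bool" where
  "open_path w \<gamma> \<longleftrightarrow> (\<forall>e \<in> set (path_edges \<gamma>). w e = 0)"

(* Weight families are indexed as edge, then sample point. *)

definition A1 :: "'a measure \<Rightarrow> (edge \<Rightarrow> 'a \<Rightarrow> real) \<Rightarrow> (real \<Rightarrow> real) \<Rightarrow> (nat \<Rightarrow> int) \<Rightarrow> real \<Rightarrow> bool" where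
  "A1 M t f r k1 \<longleftrightarrow>
     liminf (\<lambda>i. ereal (measure M
       {\<omega> \<in> space M. \<exists>\<gamma>. top_down_crossing f r i \<gamma> \<and> open_path (\<lambda>e. t e \<omega>) \<gamma>})) \<ge> ereal k1"

definition A2 :: "'a measure \<Rightarrow> (edge \<Rightarrow> 'a \<Rightarrow> real) \<Rightarrow> (real \<Rightarrow> real) \<Rightarrow> (nat \<Rightarrow> int) \<Rightarrow> real \<Rightarrow> bool" where
  "A2 M t f r K2 \<longleftrightarrow>
     limsup (\<lambda>i. ereal (
       prob_space.expectation M (\<lambda>\<omega>. T_pt_set f (\<lambda>e. t e \<omega>) (0, 0) (P (r (Suc i)))) -
       prob_space.expectation M (\<lambda>\<omega>. T_pt_set f (\<lambda>e. t e \<omega>) (0, 0) (P (r i))))) \<le> ereal K2"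

definition A3 ::
  "'a measure \<Rightarrow> (edge \<Rightarrow> 'a \<Rightarrow> real) \<Rightarrow> (real \<Rightarrow> real) \<Rightarrow> (nat \<Rightarrow> int) \<Rightarrow> (real \<Rightarrow> real) \<Rightarrow> bool" where
  "A3 M t f r k3 \<longleftrightarrow>
     (\<forall>m\<ge>0. liminf (\<lambda>i. ereal (measure M
       {\<omega> \<in> space M. T_set_set f (\<lambda>e. t e \<omega>) (P (r i)) (P (r (Suc i))) \<ge> m})) \<ge> ereal (k3 m))"

end

theory Submission
  imports Defs "HOL-Real_Asymp.Real_Asymp"
begin

text \<open>
  Since the weights vanish along an open top-down crossing and, by planarity, every path to the right
  must meet it, the passage time splits additively at open crossings; (A1) provides such crossings
  with geometrically decaying gaps. The Bernoulli passage time across a slab is submultiplicative in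
  the sense that P(N \<open>\<ge>\<close> j + k) \<open>\<le>\<close> P(N \<open>\<ge>\<close> j) P(N \<open>\<ge>\<close> k) for positive integers j, k (explore the ball of radius
  j - 1), so the bound (A2) on the mean gives exponential tails and hence fourth moments of the
  passage times across slabs, uniformly in the slab.

  Let D be the difference between T(0, P(n)) and the sum of the independent passage times across
  consecutive groups of L regions. Modifying one region changes D only if no open crossing separates
  it from the ends of its group, so the Efron--Stein inequality gives Var D = O(N/L + L), where N is
  the number of regions. On the other hand, by (A3) the independent events that a given region is slow have
  covariance with T(0, P(n)) bounded from below, which forces Var T(0, P(n)) to grow linearly in N.
  Thus Lyapunov's theorem for the groups transfers to T(0, P(n)) when n and then L tend to infinity.
\<close>

section \<open>Paths and planarity\<close>

text \<open>A1 to A3 concern Bernoulli weights, the theorem concerns weights of law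
  \<open>F\<close>. Both become functions of one product environment. They have the same open edges,
  hence the same crossings; closed edges weigh at least \<open>\<delta>\<close>, which carries A3
  over; and a path optimal for the Bernoulli weights bounds the moments from above.

  In the Efron-Stein step a region is set to 0 instead of being resampled. This keeps every open
  crossing and can only lower passage times. So both T(0, P(n)) and the time across the group drop
  by an amount between 0 and the time across the window cut out by the nearest crossings, and the
  two drops are equal if the window lies inside the group.

  Fourth moments serve twice: they give the third moments in Lyapunov's condition, and they control
  the second moment of the window time on an event of exponentially small probability.

  The order of the limits matters: boundary effects cost a bounded amount of variance per group, a
  fraction of order 1/L of the total, while the moments of the group times depend on L but not on
  n.\<close>

lemma path_edges_simps [simp]:
  "path_edges [] = []" "path_edges [x] = []"
  "path_edges (x # y # g) = {x, y} # path_edges (y # g)"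
  by (simp_all add: path_edges_def)

lemma path_edges_append:
  "path_edges (xs @ x # ys) = path_edges (xs @ [x]) @ path_edges (x # ys)"
proof (induction xs)
  case (Cons a xs)
  then show ?case by (cases xs) auto
qed simp

lemma path_edges_rev: "set (path_edges (rev g)) = set (path_edges g)"
proof (induction g)
  case (Cons a g)
  show ?case
  proof (cases g)
    case (Cons b g')
    have "path_edges (rev (a # g)) = path_edges (rev g' @ [b]) @ path_edges [b, a]"
      using path_edges_append[of "rev g'" b "[a]"] Cons by simp
    then show ?thesis using Cons.IH Cons by (auto simp: insert_commute)
  qed simp
qed simp

lemma lattice_edges_iff:
  "{u, v} \<in> lattice_edges \<longleftrightarrow> \<bar>fst u - fst v\<bar> + \<bar>snd u - snd v\<bar> = 1"
  unfolding lattice_edges_def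
  by (cases u; cases v) (auto simp: doubleton_eq_iff abs_minus_commute)

lemma E_iff: "{u, v} \<in> E f \<longleftrightarrow> \<bar>fst u - fst v\<bar> + \<bar>snd u - snd v\<bar> = 1 \<and> u \<in> V f \<and> v \<in> V f"
  by (auto simp: E_def lattice_edges_iff)

lemma passage_time_nonneg:
  assumes "\<And>e. e \<in> set (path_edges g) \<Longrightarrow> 0 \<le> w e"
  shows "0 \<le> passage_time w g"
  unfolding passage_time_def using assms by (intro sum_list_nonneg) auto

lemma passage_time_mono:
  assumes "\<And>e. e \<in> set (path_edges g) \<Longrightarrow> w e \<le> w' e"
  shows "passage_time w g \<le> passage_time w' g"
  unfolding passage_time_def using assms by (intro sum_list_mono) auto

lemma passage_time_cong:
  assumes "\<And>e. e \<in> set (path_edges g) \<Longrightarrow> w e = w' e"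
  shows "passage_time w g = passage_time w' g"
  using assms unfolding passage_time_def by (metis map_cong)

lemma passage_time_zero:
  assumes "open_path w g"
  shows "passage_time w g = 0"
proof -
  have "map w (path_edges g) = map (\<lambda>_. 0) (path_edges g)"
    using assms by (simp add: open_path_def)
  then show ?thesis unfolding passage_time_def by (metis sum_list_0)
qed

definition walk :: "(real \<Rightarrow> real) \<Rightarrow> vertex \<Rightarrow> vertex \<Rightarrow> vertex list \<Rightarrow> bool" where
  "walk f x y g \<longleftrightarrow> is_path f g \<and> hd g = x \<and> last g = y"

lemma walkD:
  assumes "walk f x y g"
  shows "g \<noteq> []" "set g \<subseteq> V f" "set (path_edges g) \<subseteq> E f" "x \<in> set g" "y \<in> set g"
    "x \<in> V f" "y \<in> V f"
  using assms hd_in_set[of g] last_in_set[of g] by (auto simp: walk_def is_path_def)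

lemma walk_single: "x \<in> V f \<Longrightarrow> walk f x x [x]"
  by (simp add: walk_def is_path_def)

lemma walk_edge: "{x, y} \<in> E f \<Longrightarrow> walk f x y [x, y]"
  by (auto simp: walk_def is_path_def E_def)

lemma walk_rev:
  assumes "walk f x y g"
  shows "walk f y x (rev g)"
  using assms by (auto simp: walk_def is_path_def path_edges_rev hd_rev last_rev)

lemma walk_join:
  assumes "walk f x y g1" "walk f y z g2"
  obtains g where "walk f x z g" "path_edges g = path_edges g1 @ path_edges g2"
    "set g = set g1 \<union> set g2"
proof -
  obtain g1' where g1: "g1 = g1' @ [y]"
    using assms(1) unfolding walk_def is_path_def by (metis append_butlast_last_id)
  obtain g2' where g2: "g2 = y # g2'"
    using assms(2) unfolding walk_def is_path_def by (metis list.collapse)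
  define g where "g = g1' @ y # g2'"
  have pe: "path_edges g = path_edges g1 @ path_edges g2"
    unfolding g_def g1 g2 by (rule path_edges_append)
  have s: "set g = set g1 \<union> set g2" by (auto simp: g_def g1 g2)
  have "hd g = hd g1" by (cases g1') (auto simp: g_def g1)
  then have "walk f x z g"
    using assms pe s unfolding walk_def is_path_def by (auto simp: g_def g2)
  with pe s show thesis using that by blast
qed

lemma walk_append:
  assumes "walk f x y (g1 @ v # g2)"
  shows "walk f x v (g1 @ [v])" "walk f v y (v # g2)"
    "path_edges (g1 @ v # g2) = path_edges (g1 @ [v]) @ path_edges (v # g2)"
proof -
  show pe: "path_edges (g1 @ v # g2) = path_edges (g1 @ [v]) @ path_edges (v # g2)"
    by (rule path_edges_append)
  show "walk f x v (g1 @ [v])"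
    using assms unfolding walk_def is_path_def pe by (cases g1) auto
  show "walk f v y (v # g2)"
    using assms unfolding walk_def is_path_def pe by auto
qed

lemma passage_time_append:
  "path_edges g = path_edges g1 @ path_edges g2 \<Longrightarrow>
    passage_time w g = passage_time w g1 + passage_time w g2"
  by (simp add: passage_time_def)

lemma walk_split:
  assumes "walk f x y g" "v \<in> set g"
  obtains g1 g2 where "walk f x v g1" "walk f v y g2"
    "path_edges g = path_edges g1 @ path_edges g2"
  using walk_append assms by (metis split_list)

lemma walk_step:
  assumes "walk f x y (g1 @ u # v # g2)"
  shows "{u, v} \<in> E f"
proof -
  have "walk f u y (u # v # g2)" using walk_append(2)[of f x y g1 u "v # g2"] assms by simp
  from walkD(3)[OF this] show ?thesis by simp
qed

text \<open>A step changes the column by at most one, so a walk cannot jump over column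
  \<open>b\<close>: its first vertex not to the left of \<open>b\<close> lies on
  \<open>b\<close>.\<close>

lemma walk_first_column:
  assumes w: "walk f x y g" and "fst x \<le> b" "b \<le> fst y"
  obtains g1 v g2 where "g = g1 @ v # g2" "fst v = b" "\<forall>u\<in>set g1. fst u < b"
proof -
  have "\<exists>u\<in>set g. b \<le> fst u" using assms walkD(5) by blast
  then obtain g1 v g2 where g: "g = g1 @ v # g2" "b \<le> fst v" "\<forall>u\<in>set g1. \<not> b \<le> fst u"
    using split_list_first_prop[of g "\<lambda>u. b \<le> fst u"] by blast
  have "fst v \<le> b"
  proof (cases g1 rule: rev_cases)
    case Nil
    then show ?thesis using w g assms(2) by (simp add: walk_def)
  next
    case (snoc g1' u)
    have "{u, v} \<in> E f" using walk_step[of f x y g1' u v g2] w g snoc by simp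
    moreover have "fst u < b" using g snoc by auto
    ultimately show ?thesis unfolding E_iff by linarith
  qed
  with g show thesis using that by (metis antisym not_le)
qed

lemma walk_last_column:
  assumes w: "walk f x y g" and "fst x \<le> a" "a \<le> fst y"
  obtains g1 v g2 where "g = g1 @ v # g2" "fst v = a" "\<forall>u\<in>set g2. a < fst u"
proof -
  have "\<exists>u\<in>set g. fst u \<le> a" using assms walkD(4) by blast
  then obtain g1 v g2 where g: "g = g1 @ v # g2" "fst v \<le> a" "\<forall>u\<in>set g2. \<not> fst u \<le> a"
    using split_list_last_prop[of g "\<lambda>u. fst u \<le> a"] by blast
  have "a \<le> fst v"
  proof (cases g2)
    case Nil
    then show ?thesis using w g assms(3) by (simp add: walk_def)
  next
    case (Cons u g2')
    have "{v, u} \<in> E f" using walk_step[of f x y g1 v u g2'] w g Cons by simp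
    moreover have "a < fst u" using g Cons by auto
    ultimately show ?thesis unfolding E_iff by linarith
  qed
  with g show thesis using that by (metis antisym not_le)
qed

section \<open>Slabs of edges between two columns\<close>

definition left_end :: "edge \<Rightarrow> int" where
  "left_end e = Min (fst ` e)"

lemma left_end_pair: "left_end {u, v} = min (fst u) (fst v)"
  by (simp add: left_end_def)

text \<open>Half-open on purpose: a vertical edge of column \<open>b\<close> belongs to the slab
  that starts at \<open>b\<close>. Consecutive slabs are therefore disjoint, which makes their
  passage times independent.\<close>

definition slab :: "(real \<Rightarrow> real) \<Rightarrow> int \<Rightarrow> int \<Rightarrow> edge set" where
  "slab f a b = {e \<in> E f. a \<le> left_end e \<and> left_end e < b}"

lemma path_edges_pair:
  assumes "e \<in> set (path_edges g)"
  obtains g1 u v g2 where "g = g1 @ u # v # g2" "e = {u, v}"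
proof -
  have "\<exists>g1 u v g2. g = g1 @ u # v # g2 \<and> e = {u, v}" using assms
  proof (induction g rule: induct_list012)
    case (3 x y g)
    show ?case
    proof (cases "e = {x, y}")
      case True
      then show ?thesis by (metis append_Nil)
    next
      case False
      then have "e \<in> set (path_edges (y # g))" using 3 by simp
      then obtain g1 u v g2 where "y # g = g1 @ u # v # g2 \<and> e = {u, v}" using "3.IH" by blast
      then show ?thesis by (metis append_Cons)
    qed
  qed auto
  with that show thesis by blast
qed

text \<open>Cut at the first visit to column \<open>b\<close>, then at the last earlier visit to
  column \<open>a\<close>. The piece in between stays strictly between the columns except at its
  ends, so it uses no vertical edge of column \<open>b\<close>.\<close>

lemma walk_slab:
  assumes w: "walk f x y g" and "fst x \<le> a" "a \<le> b" "b \<le> fst y"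
  obtains u v g1 h g2 where "fst u = a" "fst v = b" "walk f u v h"
    "set (path_edges h) \<subseteq> slab f a b" "path_edges g = path_edges g1 @ path_edges h @ path_edges g2"
proof -
  have "fst x \<le> b" using assms by linarith
  then obtain g1 v g2 where g: "g = g1 @ v # g2" "fst v = b" "\<forall>u\<in>set g1. fst u < b"
    using walk_first_column[OF w _ assms(4)] by blast
  have w1: "walk f x v (g1 @ [v])" and pe: "path_edges g = path_edges (g1 @ [v]) @ path_edges (v # g2)"
    using walk_append w g by auto
  obtain h1 u h2 where h: "g1 @ [v] = h1 @ u # h2" "fst u = a" "\<forall>u\<in>set h2. a < fst u"
    using walk_last_column[OF w1 assms(2)] assms(3) g(2) by metis
  have w2: "walk f u v (u # h2)" and pe2: "path_edges (g1 @ [v]) = path_edges (h1 @ [u]) @ path_edges (u # h2)"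
    using walk_append w1 h by metis+
  have "set (path_edges (u # h2)) \<subseteq> slab f a b"
  proof
    fix e assume e: "e \<in> set (path_edges (u # h2))"
    then obtain k1 s t k2 where k: "u # h2 = k1 @ s # t # k2" "e = {s, t}"
      by (rule path_edges_pair)
    have "s \<in> set (u # h2)" "t \<in> set (u # h2)" unfolding k by auto
    then have 1: "a \<le> fst s" "a \<le> fst t" using h by auto
    \<comment> \<open>As \<open>s\<close> is followed by \<open>t\<close>, it is not the endpoint
      \<open>v\<close> and lies strictly left of column \<open>b\<close>; this puts the left end of
      the edge below \<open>b\<close>.\<close>
    have "g1 @ [v] = (h1 @ k1 @ [s]) @ (t # k2)" using h k by simp
    then have "s \<in> set g1"
      by (metis append_butlast_last_id append_assoc append_eq_append_conv2 butlast_append butlast_snoc in_set_conv_decomp last_appendR list.distinct(1) append_Cons append_Nil)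
    then have "fst s < b" using g by auto
    then show "e \<in> slab f a b"
      using 1 walkD(3)[OF w2] e unfolding k slab_def by (auto simp: left_end_pair)
  qed
  moreover have "path_edges g = path_edges (h1 @ [u]) @ path_edges (u # h2) @ path_edges (v # g2)"
    using pe pe2 by simp
  ultimately show thesis using that w2 h(2) g(2) by blast
qed


section \<open>Planarity through a discrete crossing number\<close>

lemma not_top_iff:
  assumes "(c, h) \<in> V f" "(c, h + 1) \<notin> V f" "(c, y) \<in> V f"
  shows "y \<le> h"
proof (rule ccontr)
  assume "\<not> y \<le> h"
  then have "real_of_int (h + 1) \<le> real_of_int y" by simp
  then show False using assms unfolding V_def by auto
qed

text \<open>\<open>flux g x y\<close> is the net number of times \<open>g\<close>, extended upwards by a vertical ray from its
  first vertex, crosses the height \<open>y + 1/2\<close> downwards strictly to the left of column \<open>x\<close>. It cannot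
  change along a path avoiding \<open>g\<close>.\<close>

definition flux :: "vertex list \<Rightarrow> int \<Rightarrow> int \<Rightarrow> int" where
  "flux g x y =
     of_bool (fst (hd g) < x \<and> snd (hd g) \<le> y) +
     sum_list (map2 (\<lambda>p q. of_bool (fst p < x) * (of_bool (y < snd p) - of_bool (y < snd q))) g (tl g))"

lemma sum_list_map2_cong:
  assumes "\<And>g1 u v g2. g = g1 @ u # v # g2 \<Longrightarrow> F u v = (G u v :: int)"
  shows "sum_list (map2 F g (tl g)) = sum_list (map2 G g (tl g))"
  using assms
proof (induction g rule: induct_list012)
  case (3 p q g)
  have "F p q = G p q" by (rule 3(3)[of "[]" p q g]) simp
  moreover have "sum_list (map2 F (q # g) (tl (q # g))) = sum_list (map2 G (q # g) (tl (q # g)))"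
  proof (rule 3(2))
    fix g1 u v g2 assume "q # g = g1 @ u # v # g2"
    then show "F u v = G u v" using 3(3)[of "p # g1" u v g2] by simp
  qed
  ultimately show ?case by simp
qed auto

lemma sum_list_map2_telescope:
  "g \<noteq> [] \<Longrightarrow> sum_list (map2 (\<lambda>p q. k p - k q) g (tl g)) = k (hd g) - (k (last g) :: int)"
  by (induction g rule: induct_list012) auto

lemma sum_list_map2_diff:
  "sum_list (map2 (\<lambda>p q. F p q - G p q) g h) =
    sum_list (map2 F g h) - (sum_list (map2 G g h) :: int)"
  by (induction g arbitrary: h) (auto split: list.splits simp: zip_Cons1)

lemma int_step:
  assumes "\<bar>a - c\<bar> + \<bar>b - d\<bar> = (1::int)"
  shows "(a = c \<and> (b = d + 1 \<or> d = b + 1)) \<or> (b = d \<and> (a = c + 1 \<or> c = a + 1))"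
  using assms by presburger

text \<open>Moving one column to the right adds only the steps in column \<open>x\<close> across
  height \<open>y + 1/2\<close>, and such a step has the lower end \<open>(x, y)\<close>. The ray
  cannot be added either: below it \<open>g\<close> starts at the top of its column, so
  \<open>(x, y)\<close> would be this first vertex.\<close>

lemma flux_horizontal:
  assumes g: "walk f (c, h) (d, 0) g" "(c, h + 1) \<notin> V f"
    and v: "(x, y) \<in> V f" "(x, y) \<notin> set g"
  shows "flux g (x + 1) y = flux g x y"
proof -
  have hd: "hd g = (c, h)" "(c, h) \<in> set g" "(c, h) \<in> V f"
    using g walkD[OF g(1)] by (auto simp: walk_def)
  have "of_bool (fst p < x + 1) * (of_bool (y < snd p) - of_bool (y < snd q)) =
     (of_bool (fst p < x) * (of_bool (y < snd p) - of_bool (y < snd q)) :: int)"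
    if "g = g1 @ p # q # g2" for g1 p q g2
  proof -
    have e: "{p, q} \<in> E f" using walk_step g that by metis
    have "p \<noteq> (x, y)" "q \<noteq> (x, y)" using v that by auto
    then show ?thesis using int_step[of "fst p" "fst q" "snd p" "snd q"] e
      unfolding E_iff by (cases p; cases q) auto
  qed
  then have "sum_list (map2 (\<lambda>p q. of_bool (fst p < x + 1) * (of_bool (y < snd p) - of_bool (y < snd q))) g (tl g)) =
    (sum_list (map2 (\<lambda>p q. of_bool (fst p < x) * (of_bool (y < snd p) - of_bool (y < snd q))) g (tl g)) :: int)"
    by (rule sum_list_map2_cong)
  moreover have "\<not> (c = x \<and> h \<le> y)"
    using not_top_iff[OF hd(3) g(2)] v hd by (metis antisym)
  ultimately show ?thesis unfolding flux_def hd by auto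
qed

text \<open>The crossings of two consecutive heights differ by the net number of times
  \<open>g\<close> enters row \<open>y + 1\<close> to the left of column \<open>x\<close>. No
  horizontal step enters or leaves this half-row at column \<open>x\<close>, so the count telescopes
  to the ends of \<open>g\<close>: the first vertex cancels against the ray, and the last one lies
  in row 0, below \<open>y + 1\<close>.\<close>

lemma flux_vertical:
  assumes g: "walk f (c, h) (d, 0) g" "(c, h + 1) \<notin> V f"
    and v: "(x, y) \<in> V f" "(x, y + 1) \<in> V f" "(x, y + 1) \<notin> set g"
  shows "flux g x (y + 1) = flux g x y"
proof -
  let ?k = "\<lambda>p. of_bool (fst p < x \<and> snd p = y + 1) :: int"
  have hd: "hd g = (c, h)" "last g = (d, 0)" "g \<noteq> []"
    using g walkD[OF g(1)] by (auto simp: walk_def)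
  have "of_bool (fst p < x) * (of_bool (y < snd p) - of_bool (y < snd q)) -
      of_bool (fst p < x) * (of_bool (y + 1 < snd p) - of_bool (y + 1 < snd q)) = ?k p - ?k q"
    if "g = g1 @ p # q # g2" for g1 p q g2
  proof -
    have e: "{p, q} \<in> E f" using walk_step g that by metis
    have "p \<noteq> (x, y + 1)" "q \<noteq> (x, y + 1)" using v that by auto
    then show ?thesis using int_step[of "fst p" "fst q" "snd p" "snd q"] e
      unfolding E_iff by (cases p; cases q) auto
  qed
  then have "sum_list (map2 (\<lambda>p q. of_bool (fst p < x) * (of_bool (y < snd p) - of_bool (y < snd q)) -
      of_bool (fst p < x) * (of_bool (y + 1 < snd p) - of_bool (y + 1 < snd q))) g (tl g)) =
    sum_list (map2 (\<lambda>p q. ?k p - ?k q) g (tl g))"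
    by (rule sum_list_map2_cong)
  also have "\<dots> = ?k (hd g) - ?k (last g)" by (rule sum_list_map2_telescope) (rule hd)
  finally show ?thesis using v(1) unfolding flux_def sum_list_map2_diff hd by (auto simp: V_def)
qed

lemma flux_edge:
  assumes g: "walk f (c, h) (d, 0) g" "(c, h + 1) \<notin> V f"
    and v: "{v, v'} \<in> E f" "v \<notin> set g" "v' \<notin> set g"
  shows "flux g (fst v) (snd v) = flux g (fst v') (snd v')"
proof -
  obtain a b a' b' where [simp]: "v = (a, b)" "v' = (a', b')" by (cases v; cases v')
  from v(1) consider "a = a'" "b = b' + 1" | "a = a'" "b' = b + 1" | "b = b'" "a = a' + 1" | "b = b'" "a' = a + 1"
    unfolding E_iff using int_step[of a a' b b'] by auto
  then show ?thesis
    using flux_vertical[OF g] flux_horizontal[OF g] v unfolding E_iff by cases auto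
qed

lemma flux_walk:
  assumes g: "walk f (c, h) (d, 0) g" "(c, h + 1) \<notin> V f"
    and "walk f x y p" "set p \<inter> set g = {}"
  shows "flux g (fst x) (snd x) = flux g (fst y) (snd y)"
  using assms(3,4)
proof (induction p arbitrary: x rule: induct_list012)
  case (3 a b p)
  have "{a, b} \<in> E f" "walk f b y (b # p)" "x = a" using 3(3) by (auto simp: walk_def is_path_def)
  then show ?case using 3 flux_edge[OF g, of a b] by auto
qed (auto simp: walk_def is_path_def)

text \<open>A discrete Jordan argument: the flux vanishes at \<open>x\<close>, because nothing of
  \<open>g\<close> is strictly to the left, and equals 1 at \<open>y\<close>. A path avoiding
  \<open>g\<close> would have constant flux.\<close>

lemma crossing_meets:
  assumes g: "walk f (c, h) (d, 0) g" "(c, h + 1) \<notin> V f"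
    and cols: "\<And>v. v \<in> set g \<Longrightarrow> u \<le> fst v \<and> fst v \<le> u'"
    and p: "walk f x y p" "fst x \<le> u" "u' \<le> fst y"
  shows "set p \<inter> set g \<noteq> {}"
proof
  assume disj: "set p \<inter> set g = {}"
  have hd: "hd g = (c, h)" "last g = (d, 0)" "g \<noteq> []" "(c, h) \<in> set g" "(c, h) \<in> V f"
    using g walkD[OF g(1)] by (auto simp: walk_def)
  obtain x1 x2 y1 y2 where [simp]: "x = (x1, x2)" "y = (y1, y2)" by (cases x; cases y)
  have y: "(y1, y2) \<in> V f" "(y1, y2) \<notin> set g" using walkD[OF p(1)] disj by auto
  have "sum_list (map2 (\<lambda>p q. of_bool (fst p < x1) * (of_bool (x2 < snd p) - of_bool (x2 < snd q))) g (tl g)) =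
    (sum_list (map2 (\<lambda>p q. 0 - 0) g (tl g)) :: int)"
  proof (rule sum_list_map2_cong)
    fix g1 s t g2 assume "g = g1 @ s # t # g2"
    then have "s \<in> set g" by auto
    then have "\<not> fst s < x1" using cols p(2) by fastforce
    then show "of_bool (fst s < x1) * (of_bool (x2 < snd s) - of_bool (x2 < snd t)) = (0 - 0 :: int)" by simp
  qed
  also have "\<dots> = 0" using sum_list_map2_telescope[OF hd(3), of "\<lambda>_. 0"] by simp
  finally have 1: "flux g x1 x2 = 0" using cols[OF hd(4)] p(2) unfolding flux_def hd by auto
  let ?k = "\<lambda>p. of_bool (y2 < snd p) :: int"
  \<comment> \<open>The flux omits steps in column \<open>y1\<close> itself, but a step there across
    this height would have \<open>y\<close> as its lower end. So all crossings count and the sum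
    telescopes.\<close>
  have "sum_list (map2 (\<lambda>p q. of_bool (fst p < y1) * (of_bool (y2 < snd p) - of_bool (y2 < snd q))) g (tl g)) =
    sum_list (map2 (\<lambda>p q. ?k p - ?k q) g (tl g))"
  proof (rule sum_list_map2_cong)
    fix g1 p' q g2 assume *: "g = g1 @ p' # q # g2"
    have e: "{p', q} \<in> E f" using walk_step g * by metis
    have "p' \<noteq> (y1, y2)" "q \<noteq> (y1, y2)" using y * by auto
    moreover have "fst p' \<le> y1" "fst q \<le> y1" using cols[of p'] cols[of q] p(3) * by auto
    ultimately show "of_bool (fst p' < y1) * (of_bool (y2 < snd p') - of_bool (y2 < snd q)) = ?k p' - ?k q"
      using int_step[of "fst p'" "fst q" "snd p'" "snd q"] e unfolding E_iff by (cases p'; cases q) auto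
  qed
  also have "\<dots> = ?k (hd g) - ?k (last g)" by (rule sum_list_map2_telescope) (rule hd)
  finally have "flux g y1 y2 = of_bool (c < y1 \<and> h \<le> y2) + of_bool (y2 < h) - of_bool (y2 < 0)"
    unfolding flux_def hd by simp
  moreover have "\<not> y2 < 0" using y(1) by (auto simp: V_def)
  moreover have "c < y1" if "h \<le> y2"
  proof -
    have "c \<le> y1" using cols[OF hd(4)] p(3) by simp
    moreover have "c \<noteq> y1" using that y hd not_top_iff[OF hd(5) g(2)] by (metis antisym)
    ultimately show ?thesis by simp
  qed
  ultimately have "flux g y1 y2 = 1" by (cases "h \<le> y2") auto
  with 1 flux_walk[OF g p(1) disj] show False by simp
qed

section \<open>Passage times between columns\<close>

definition column_time :: "(real \<Rightarrow> real) \<Rightarrow> int \<Rightarrow> int \<Rightarrow> (edge \<Rightarrow> real) \<Rightarrow> real" where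
  "column_time f a b w = T_set_set f w (P a) (P b)"

text \<open>The starting vertex is a top of \<open>V f\<close> rather than of the region. Regions
  are cut out by columns, so this is the same, and it permits arbitrary columns instead of the
  sequence \<open>r\<close>.\<close>

definition open_crossing :: "(real \<Rightarrow> real) \<Rightarrow> int \<Rightarrow> int \<Rightarrow> (edge \<Rightarrow> real) \<Rightarrow> bool" where
  "open_crossing f u u' w \<longleftrightarrow> (\<exists>g c h d. walk f (c, h) (d, 0) g \<and> (c, h + 1) \<notin> V f \<and>
     (\<forall>v\<in>set g. u \<le> fst v \<and> fst v \<le> u') \<and> open_path w g)"

text \<open>The paths are confined to the slab so that there are only finitely many possible balls;
  the proof of \<open>N_submultiplicative\<close> sums over them.\<close>

definition passage_ball :: "(real \<Rightarrow> real) \<Rightarrow> int \<Rightarrow> int \<Rightarrow> (edge \<Rightarrow> real) \<Rightarrow> real \<Rightarrow> vertex set" where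
  "passage_ball f a b w \<rho> = {x. \<exists>y g. walk f y x g \<and> fst y = a \<and> set (path_edges g) \<subseteq> slab f a b \<and> passage_time w g \<le> \<rho>}"

definition bottom_edge :: "int \<Rightarrow> edge" where
  "bottom_edge k = {(k, 0), (k + 1, 0)}"

lemma P_iff [simp]: "x \<in> P n \<longleftrightarrow> fst x = n"
  by (cases x) (simp add: P_def)

lemma open_crossing_iff:
  "(\<exists>g. top_down_crossing f r i g \<and> open_path w g) \<longleftrightarrow> open_crossing f (r i) (r (Suc i)) w"
proof
  assume "\<exists>g. top_down_crossing f r i g \<and> open_path w g"
  then obtain g where g: "top_down_crossing f r i g" "open_path w g" by blast
  obtain c h d k where hl: "hd g = (c, h)" "last g = (d, k)" by (cases "hd g"; cases "last g")
  have "walk f (c, h) (d, 0) g" "(c, h + 1) \<notin> V f" "\<forall>v\<in>set g. r i \<le> fst v \<and> fst v \<le> r (Suc i)"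
    using g hl unfolding top_down_crossing_def walk_def R_def by auto
  with g show "open_crossing f (r i) (r (Suc i)) w" unfolding open_crossing_def by blast
next
  assume "open_crossing f (r i) (r (Suc i)) w"
  then obtain g c h d where g: "walk f (c, h) (d, 0) g" "(c, h + 1) \<notin> V f"
     "\<forall>v\<in>set g. r i \<le> fst v \<and> fst v \<le> r (Suc i)" "open_path w g"
    unfolding open_crossing_def by blast
  then have "top_down_crossing f r i g"
    using walkD[OF g(1)] unfolding top_down_crossing_def walk_def R_def by fastforce
  with g show "\<exists>g. top_down_crossing f r i g \<and> open_path w g" by blast
qed

lemma open_crossing_mono:
  assumes "open_crossing f u u' w" "\<And>e. e \<in> E f \<Longrightarrow> e \<subseteq> {u..u'} \<times> UNIV \<Longrightarrow> w e = 0 \<Longrightarrow> w' e = 0"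
  shows "open_crossing f u u' w'"
proof -
  from assms obtain g c h d where g: "walk f (c, h) (d, 0) g" "(c, h + 1) \<notin> V f"
     "\<forall>v\<in>set g. u \<le> fst v \<and> fst v \<le> u'" "open_path w g"
    unfolding open_crossing_def by blast
  have "w' e = 0" if e: "e \<in> set (path_edges g)" for e
  proof -
    obtain g1 s t g2 where "g = g1 @ s # t # g2" "e = {s, t}" using e by (rule path_edges_pair)
    then have "e \<subseteq> {u..u'} \<times> UNIV" using g by (cases s; cases t) auto
    then show ?thesis using assms(2) e g walkD(3)[OF g(1)] by (auto simp: open_path_def)
  qed
  then have "open_path w' g" by (simp add: open_path_def)
  with g show ?thesis unfolding open_crossing_def by blast
qed

lemma slab_mono: "a' \<le> a \<Longrightarrow> b \<le> b' \<Longrightarrow> slab f a b \<subseteq> slab f a' b'"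
  by (auto simp: slab_def)

lemma slab_subset_E: "slab f a b \<subseteq> E f" by (auto simp: slab_def)

lemma E_obtain:
  assumes "e \<in> E f"
  obtains u v where "e = {u, v}" "u \<in> V f" "v \<in> V f" "\<bar>fst u - fst v\<bar> + \<bar>snd u - snd v\<bar> = 1"
proof -
  obtain u v where "e = {u, v}" using assms unfolding E_def lattice_edges_def by blast
  then show thesis using assms that E_iff by blast
qed

lemma slab_edge_columns:
  assumes "{u, v} \<in> slab f a b"
  shows "a \<le> fst u" "fst u \<le> b" "a \<le> fst v" "fst v \<le> b"
  using assms unfolding slab_def E_def by (auto simp: left_end_pair lattice_edges_iff)

lemma finite_columns: "finite {v \<in> V f. a \<le> fst v \<and> fst v \<le> b}"
proof (rule finite_subset)
  show "{v \<in> V f. a \<le> fst v \<and> fst v \<le> b} \<subseteq> (SIGMA x:{a..b}. {0..\<lfloor>f (real_of_int x)\<rfloor>})"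
    by (auto simp: V_def le_floor_iff)
qed auto

lemma finite_slab: "finite (slab f a b)"
proof (rule finite_subset)
  show "slab f a b \<subseteq> Pow {v \<in> V f. a \<le> fst v \<and> fst v \<le> b}"
  proof
    fix e assume e: "e \<in> slab f a b"
    then obtain u v where uv: "e = {u, v}" "u \<in> V f" "v \<in> V f"
      using slab_subset_E E_obtain by (metis subsetD)
    with e slab_edge_columns[of u v f a b] show "e \<in> Pow {v \<in> V f. a \<le> fst v \<and> fst v \<le> b}" by auto
  qed
  show "finite (Pow {v \<in> V f. a \<le> fst v \<and> fst v \<le> b})" using finite_columns by simp
qed

lemma passage_time_subwalk:
  assumes "\<And>e. 0 \<le> w e" "path_edges g = path_edges g1 @ path_edges h @ path_edges g2"
  shows "passage_time w h \<le> passage_time w g"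
  using passage_time_nonneg[of g1 w] passage_time_nonneg[of g2 w] assms(1)
  unfolding passage_time_def assms(2) by simp

section \<open>Connectedness, and passage times as infima over walks\<close>

locale wedge =
  fixes f :: "real \<Rightarrow> real"
  assumes f_nonneg: "\<And>x. 0 \<le> x \<Longrightarrow> 0 \<le> f x"
begin

lemma base_in_V: "0 \<le> a \<Longrightarrow> (a, 0) \<in> V f"
  by (simp add: V_def f_nonneg)

lemma P_Int_V_nonempty: "0 \<le> a \<Longrightarrow> P a \<inter> V f \<noteq> {}"
  using base_in_V[of a] by (auto simp: P_def)

lemma walk_vertical:
  "(a, int k) \<in> V f \<Longrightarrow> \<exists>g. walk f (a, 0) (a, int k) g"
proof (induction k)
  case 0
  then show ?case using walk_single by fastforce
next
  case (Suc k)
  then have v: "(a, int k) \<in> V f" by (auto simp: V_def)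
  then obtain g where "walk f (a, 0) (a, int k) g" using Suc by blast
  moreover have "{(a, int k), (a, int (Suc k))} \<in> E f" using v Suc(2) by (simp add: E_iff)
  ultimately show ?case using walk_join walk_edge by metis
qed

lemma walk_horizontal:
  assumes "0 \<le> a"
  shows "\<exists>g. walk f (a, 0) (a + int k, 0) g \<and> path_edges g = map bottom_edge (map (\<lambda>j. a + int j) [0..<k])"
proof (induction k)
  case 0
  then show ?case using walk_single[OF base_in_V[OF assms]] by fastforce
next
  case (Suc k)
  then obtain g where g: "walk f (a, 0) (a + int k, 0) g"
    "path_edges g = map bottom_edge (map (\<lambda>j. a + int j) [0..<k])" by blast
  have "{(a + int k, 0), (a + int (Suc k), 0)} \<in> E f"
    using assms base_in_V by (simp add: E_iff)
  then obtain g' where "walk f (a, 0) (a + int (Suc k), 0) g'"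
     "path_edges g' = path_edges g @ path_edges [(a + int k, 0), (a + int (Suc k), 0)]"
    using walk_join[OF g(1) walk_edge] by metis
  then show ?case using g by (auto simp: bottom_edge_def algebra_simps)
qed

lemma walk_exists:
  assumes "x \<in> V f" "y \<in> V f"
  shows "\<exists>g. walk f x y g"
proof -
  have *: "\<exists>g. walk f (0, 0) x g" if x: "x \<in> V f" for x
  proof -
    obtain a b where [simp]: "x = (a, b)" by (cases x)
    have ab: "0 \<le> a" "0 \<le> b" using x by (auto simp: V_def)
    obtain g where "walk f (0, 0) (a, 0) g" using walk_horizontal[of 0 "nat a"] ab by auto
    moreover obtain g' where "walk f (a, 0) (a, b) g'"
      using walk_vertical[of a "nat b"] ab x by auto
    ultimately show ?thesis using walk_join by (metis \<open>x = (a, b)\<close>)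
  qed
  then show ?thesis using assms walk_rev walk_join by metis
qed

lemma T_set_set_ge:
  assumes "S \<inter> V f \<noteq> {}" "S' \<inter> V f \<noteq> {}"
    and "\<And>x y g. x \<in> S \<Longrightarrow> y \<in> S' \<Longrightarrow> walk f x y g \<Longrightarrow> c \<le> passage_time w g"
  shows "c \<le> T_set_set f w S S'"
  unfolding T_set_set_def T_pt_set_def T_pt_pt_def
proof (intro cINF_greatest)
  fix x y assume "x \<in> S \<inter> V f" "y \<in> S' \<inter> V f"
  then show "{\<gamma>. is_path f \<gamma> \<and> hd \<gamma> = x \<and> last \<gamma> = y} \<noteq> {}"
    using walk_exists[of x y] by (auto simp: walk_def)
qed (use assms in \<open>auto simp: walk_def\<close>)

text \<open>Nonnegative weights bound the three nested real infima from below; without this a real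
  infimum is no lower bound for its family.\<close>

lemma T_set_set_le:
  assumes w: "\<And>e. 0 \<le> w e" and "walk f x y g" "x \<in> S" "y \<in> S'"
  shows "T_set_set f w S S' \<le> passage_time w g"
proof -
  have pp: "0 \<le> T_pt_pt f w x y" if "x \<in> V f" "y \<in> V f" for x y
    unfolding T_pt_pt_def using walk_exists[OF that]
    by (intro cINF_greatest passage_time_nonneg w) (auto simp: walk_def)
  have ps: "0 \<le> T_pt_set f w x S'" if "x \<in> V f" for x
    unfolding T_pt_set_def using walkD[OF assms(2)] assms pp that by (intro cINF_greatest) auto
  have "T_set_set f w S S' \<le> T_pt_set f w x S'"
    unfolding T_set_set_def using walkD[OF assms(2)] assms ps
    by (intro cINF_lower bdd_belowI2[where m = 0]) auto
  also have "\<dots> \<le> T_pt_pt f w x y"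
    unfolding T_pt_set_def using walkD[OF assms(2)] assms pp
    by (intro cINF_lower bdd_belowI2[where m = 0]) auto
  also have "\<dots> \<le> passage_time w g"
    unfolding T_pt_pt_def using assms(2) w
    by (intro cINF_lower bdd_belowI2[where m = 0]) (auto simp: walk_def passage_time_nonneg)
  finally show ?thesis .
qed

lemma column_time_ge:
  assumes "0 \<le> a" "0 \<le> b"
    and "\<And>x y g. fst x = a \<Longrightarrow> fst y = b \<Longrightarrow> walk f x y g \<Longrightarrow> c \<le> passage_time w g"
  shows "c \<le> column_time f a b w"
  unfolding column_time_def by (rule T_set_set_ge) (use assms P_Int_V_nonempty in auto)

lemma column_time_le:
  assumes "\<And>e. 0 \<le> w e" "walk f x y g" "fst x = a" "fst y = b"
  shows "column_time f a b w \<le> passage_time w g"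
  unfolding column_time_def by (rule T_set_set_le) (use assms in auto)

lemma column_time_nonneg:
  assumes "\<And>e. 0 \<le> w e" "0 \<le> a" "0 \<le> b"
  shows "0 \<le> column_time f a b w"
  using assms by (intro column_time_ge passage_time_nonneg)

text \<open>The infimum in \<open>column_time\<close> runs over paths in the whole graph. Each
  contains a piece inside the slab, by \<open>walk_slab\<close>, and discarding the rest does not
  increase the cost.\<close>

lemma column_time_ge_slab:
  assumes "0 \<le> a" "a \<le> b" "\<And>e. 0 \<le> w e"
    and "\<And>x y g. fst x = a \<Longrightarrow> fst y = b \<Longrightarrow> walk f x y g \<Longrightarrow> set (path_edges g) \<subseteq> slab f a b
      \<Longrightarrow> c \<le> passage_time w g"
  shows "c \<le> column_time f a b w"
proof (rule column_time_ge)
  fix x y g assume *: "fst x = a" "fst y = b" "walk f x y g"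
  obtain u v g1 h g2 where h: "fst u = a" "fst v = b" "walk f u v h"
    "set (path_edges h) \<subseteq> slab f a b" "path_edges g = path_edges g1 @ path_edges h @ path_edges g2"
    using walk_slab[OF *(3), of a b] * assms(2) by (metis order_refl)
  have "passage_time w h \<le> passage_time w g"
    by (rule passage_time_subwalk[OF _ h(5)]) (rule assms(3))
  with assms(4)[OF h(1-4)] show "c \<le> passage_time w g" by simp
qed (use assms in auto)

lemma column_time_mono:
  assumes "0 \<le> a" "a \<le> b" "\<And>e. 0 \<le> w e" "\<And>e. 0 \<le> w' e"
    and "\<And>e. e \<in> slab f a b \<Longrightarrow> w e \<le> w' e"
  shows "column_time f a b w \<le> column_time f a b w'"
proof (rule column_time_ge_slab)
  fix x y g assume *: "fst x = a" "fst y = b" "walk f x y g" "set (path_edges g) \<subseteq> slab f a b"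
  have "column_time f a b w \<le> passage_time w g" using column_time_le assms * by blast
  also have "\<dots> \<le> passage_time w' g" using assms * by (intro passage_time_mono) auto
  finally show "column_time f a b w \<le> passage_time w' g" .
qed (use assms in auto)

lemma column_time_cong:
  assumes "0 \<le> a" "a \<le> b" "\<And>e. 0 \<le> w e" "\<And>e. 0 \<le> w' e"
    and "\<And>e. e \<in> slab f a b \<Longrightarrow> w e = w' e"
  shows "column_time f a b w = column_time f a b w'"
  using assms by (intro antisym column_time_mono) auto

text \<open>Every path from \<open>a\<close> to \<open>c\<close> visits column \<open>b\<close>; cut
  it there.\<close>

lemma column_time_superadd:
  assumes "0 \<le> a" "a \<le> b" "b \<le> c" "\<And>e. 0 \<le> w e"
  shows "column_time f a b w + column_time f b c w \<le> column_time f a c w"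
proof (rule column_time_ge)
  fix x y g assume *: "fst x = a" "fst y = c" "walk f x y g"
  obtain g1 v g2 where v: "g = g1 @ v # g2" "fst v = b"
    using walk_first_column[OF *(3), of b] * assms by metis
  note wa = walk_append[OF *(3)[unfolded v(1)]]
  have "column_time f a b w \<le> passage_time w (g1 @ [v])"
    using column_time_le[where w = w, OF assms(4) wa(1)] * v by simp
  moreover have "column_time f b c w \<le> passage_time w (v # g2)"
    using column_time_le[where w = w, OF assms(4) wa(2)] * v by simp
  ultimately show "column_time f a b w + column_time f b c w \<le> passage_time w g"
    using passage_time_append[OF wa(3), of w] v by simp
qed (use assms in auto)

lemma column_time_mono_columns:
  assumes "0 \<le> a" "a \<le> a'" "a' \<le> b'" "b' \<le> b" "\<And>e. 0 \<le> w e"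
  shows "column_time f a' b' w \<le> column_time f a b w"
proof -
  have "column_time f a' b' w \<le> column_time f a b' w"
    using column_time_superadd[of a a' b' w] column_time_nonneg[of w a a'] assms by simp
  also have "\<dots> \<le> column_time f a b w"
    using column_time_superadd[of a b' b w] column_time_nonneg[of w b' b] assms by simp
  finally show ?thesis .
qed

lemma column_time_bottom:
  assumes "0 \<le> a" "\<And>e. 0 \<le> w e"
  shows "column_time f a (a + int k) w \<le> (\<Sum>j<k. w (bottom_edge (a + int j)))"
proof -
  obtain g where g: "walk f (a, 0) (a + int k, 0) g"
    "path_edges g = map bottom_edge (map (\<lambda>j. a + int j) [0..<k])"
    using walk_horizontal[OF assms(1)] by blast
  have "column_time f a (a + int k) w \<le> passage_time w g"
    using column_time_le[where w = w, OF assms(2) g(1)] by simp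
  also have "\<dots> = (\<Sum>j<k. w (bottom_edge (a + int j)))"
    unfolding passage_time_def g(2) by (simp add: comp_def interv_sum_list_conv_sum_set_nat atLeast0LessThan)
  finally show ?thesis .
qed

text \<open>Planarity gives one inequality: every path meets \<open>g\<close> and can be cut there.
  For the other, any approach to \<open>g\<close> and any departure from \<open>g\<close> can be
  joined along \<open>g\<close> at no cost.\<close>

lemma column_time_decompose:
  assumes g: "walk f (c, h) (d, 0) g" "(c, h + 1) \<notin> V f" "open_path w g"
    and cols: "\<forall>v\<in>set g. u \<le> fst v \<and> fst v \<le> u'"
    and "0 \<le> a" "a \<le> u" "u' \<le> b" "\<And>e. 0 \<le> w e"
  shows "column_time f a b w = T_set_set f w (P a) (set g) + T_set_set f w (set g) (P b)"
proof (rule antisym)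
  have ch: "(c, h) \<in> set g" "(c, h) \<in> V f" using walkD[OF g(1)] by auto
  have "u \<le> u'" using cols ch by force
  then have b: "0 \<le> b" using assms by linarith
  have ne: "set g \<inter> V f \<noteq> {}" using ch by blast
  note ne' = P_Int_V_nonempty[OF assms(5)] P_Int_V_nonempty[OF b]
  have "T_set_set f w (P a) (set g) + T_set_set f w (set g) (P b) \<le> passage_time w p"
    if p: "fst x = a" "fst y = b" "walk f x y p" for x y p
  proof -
    have "set p \<inter> set g \<noteq> {}"
      using crossing_meets[OF g(1,2) _ p(3), of u u'] cols p assms by auto
    then obtain v where v: "v \<in> set p" "v \<in> set g" by blast
    obtain p1 p2 where p12: "walk f x v p1" "walk f v y p2" "path_edges p = path_edges p1 @ path_edges p2"
      using walk_split[OF p(3) v(1)] by blast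
    have "T_set_set f w (P a) (set g) \<le> passage_time w p1"
      using T_set_set_le[where w = w, OF assms(8) p12(1)] p v by simp
    moreover have "T_set_set f w (set g) (P b) \<le> passage_time w p2"
      using T_set_set_le[where w = w, OF assms(8) p12(2)] p v by simp
    ultimately show ?thesis using passage_time_append[OF p12(3), of w] by simp
  qed
  then show "T_set_set f w (P a) (set g) + T_set_set f w (set g) (P b) \<le> column_time f a b w"
    using column_time_ge assms(5) b by blast
  \<comment> \<open>From \<open>s\<close> go back along \<open>g\<close> to its first vertex, then
    forward to \<open>t\<close>; all edges used are open.\<close>
  have conn: "\<exists>q. walk f s t q \<and> passage_time w q = 0" if st: "s \<in> set g" "t \<in> set g" for s t
  proof -
    obtain q1 q2 where q: "walk f (c, h) s q1" "path_edges g = path_edges q1 @ path_edges q2"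
      using walk_split[OF g(1) st(1)] by blast
    obtain q3 q4 where q': "walk f (c, h) t q3" "path_edges g = path_edges q3 @ path_edges q4"
      using walk_split[OF g(1) st(2)] by blast
    obtain q5 where q5: "walk f s t q5" "path_edges q5 = path_edges (rev q1) @ path_edges q3"
      using walk_join[OF walk_rev[OF q(1)] q'(1)] by blast
    have "set (path_edges q1) \<subseteq> set (path_edges g)" "set (path_edges q3) \<subseteq> set (path_edges g)"
      using q(2) q'(2) by (metis set_append Un_upper1)+
    then have "set (path_edges q5) \<subseteq> set (path_edges g)"
      unfolding q5(2) set_append path_edges_rev by simp
    then have "open_path w q5" using g(3) unfolding open_path_def by blast
    with q5(1) passage_time_zero show ?thesis by blast
  qed
  have "column_time f a b w - T_set_set f w (set g) (P b) \<le> passage_time w p1"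
    if p1: "fst x = a" "s \<in> set g" "walk f x s p1" for x s p1
  proof -
    have "column_time f a b w - passage_time w p1 \<le> passage_time w p2"
      if p2: "t \<in> set g" "fst y = b" "walk f t y p2" for t y p2
    proof -
      obtain q where q: "walk f s t q" "passage_time w q = 0" using conn p1(2) p2(1) by blast
      obtain q' where q': "walk f x t q'" "path_edges q' = path_edges p1 @ path_edges q"
        using walk_join[OF p1(3) q(1)] by blast
      obtain q'' where q'': "walk f x y q''" "path_edges q'' = path_edges q' @ path_edges p2"
        using walk_join[OF q'(1) p2(3)] by blast
      have "column_time f a b w \<le> passage_time w q''"
        using column_time_le[where w = w, OF assms(8) q''(1)] p1 p2 by simp
      then show ?thesis using passage_time_append[OF q''(2), of w] passage_time_append[OF q'(2), of w] q(2) by simp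
    qed
    then have "column_time f a b w - passage_time w p1 \<le> T_set_set f w (set g) (P b)"
      by (intro T_set_set_ge[OF ne ne'(2)]) auto
    then show ?thesis by simp
  qed
  then have "column_time f a b w - T_set_set f w (set g) (P b) \<le> T_set_set f w (P a) (set g)"
    by (intro T_set_set_ge[OF ne'(1) ne]) auto
  then show "column_time f a b w \<le> T_set_set f w (P a) (set g) + T_set_set f w (set g) (P b)" by simp
qed

text \<open>By \<open>column_time_decompose\<close> the passage time is a function of the left
  column plus a function of the right column, as long as the crossing lies in between. So right
  columns may be interchanged.\<close>

lemma column_time_exchange:
  assumes cr: "open_crossing f u u' w"
    and "0 \<le> a" "a \<le> u" "0 \<le> a'" "a' \<le> u" "u' \<le> b" "u' \<le> b'" and w: "\<And>e. 0 \<le> w e"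
  shows "column_time f a b w + column_time f a' b' w = column_time f a b' w + column_time f a' b w"
proof -
  from cr obtain g c h d where g: "walk f (c, h) (d, 0) g" "(c, h + 1) \<notin> V f" "open_path w g"
     "\<forall>v\<in>set g. u \<le> fst v \<and> fst v \<le> u'"
    unfolding open_crossing_def by blast
  have D: "column_time f s t w = T_set_set f w (P s) (set g) + T_set_set f w (set g) (P t)"
    if "0 \<le> s" "s \<le> u" "u' \<le> t" for s t
    by (rule column_time_decompose[OF g(1-4) that w])
  have "column_time f a b w = T_set_set f w (P a) (set g) + T_set_set f w (set g) (P b)"
    "column_time f a' b' w = T_set_set f w (P a') (set g) + T_set_set f w (set g) (P b')"
    "column_time f a b' w = T_set_set f w (P a) (set g) + T_set_set f w (set g) (P b')"
    "column_time f a' b w = T_set_set f w (P a') (set g) + T_set_set f w (set g) (P b)"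
    by (rule D; use assms in linarith)+
  then show ?thesis by linarith
qed

text \<open>Exchange between the pairs \<open>(a, b)\<close> and \<open>(u, u')\<close>; the time
  from \<open>u\<close> to \<open>u'\<close> is dropped. The two times on the right overlap in the
  region of the crossing, which avoids any reference to the crossing itself.\<close>

lemma column_time_crossing_le:
  assumes cr: "open_crossing f u u' w"
    and "0 \<le> a" "a \<le> u" "u \<le> u'" "u' \<le> b" and w: "\<And>e. 0 \<le> w e"
  shows "column_time f a b w \<le> column_time f a u' w + column_time f u b w"
proof -
  have "column_time f a b w + column_time f u u' w = column_time f a u' w + column_time f u b w"
    by (rule column_time_exchange[OF cr]) (use assms in auto)
  moreover have "0 \<le> column_time f u u' w" by (rule column_time_nonneg) (use assms in auto)
  ultimately show ?thesis by linarith
qed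

section \<open>Bernoulli weights and the exploration of balls\<close>

lemma passage_time_01:
  assumes "\<And>e. w e \<in> {0, 1 :: real}"
  shows "passage_time w g = real (length (filter (\<lambda>e. w e \<noteq> 0) (path_edges g)))"
proof -
  have "sum_list (map w es) = real (length (filter (\<lambda>e. w e \<noteq> 0) es))" for es
  proof (induction es)
    case (Cons e es)
    then show ?case using assms[of e] by auto
  qed simp
  then show ?thesis unfolding passage_time_def .
qed

text \<open>Passage times are natural numbers here, so the infimum is a least element; minimal paths
  need to exist only for such weights.\<close>

lemma column_time_attained:
  assumes "0 \<le> a" "a \<le> b" and w01: "\<And>e. w e \<in> {0, 1 :: real}"
  shows "\<exists>x y g. fst x = a \<and> fst y = b \<and> walk f x y g \<and> set (path_edges g) \<subseteq> slab f a b \<and>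
    column_time f a b w = real (length (filter (\<lambda>e. w e \<noteq> 0) (path_edges g)))"
proof -
  define Q where "Q n \<longleftrightarrow> (\<exists>x y g. fst x = a \<and> fst y = b \<and> walk f x y g \<and> set (path_edges g) \<subseteq> slab f a b \<and>
    n = length (filter (\<lambda>e. w e \<noteq> 0) (path_edges g)))" for n
  have w: "0 \<le> w e" for e using w01[of e] by auto
  obtain g where "walk f (a, 0) (b, 0) g" using walk_exists base_in_V assms by (metis order_trans)
  then obtain u v h where "fst u = a" "fst v = b" "walk f u v h" "set (path_edges h) \<subseteq> slab f a b"
    by (rule walk_slab[where a = a and b = b]) (use assms(2) in auto)
  then have "Q (length (filter (\<lambda>e. w e \<noteq> 0) (path_edges h)))" unfolding Q_def by blast
  then have L: "Q (LEAST n. Q n)" by (rule LeastI)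
  then obtain x y g where g: "fst x = a" "fst y = b" "walk f x y g" "set (path_edges g) \<subseteq> slab f a b"
    "(LEAST n. Q n) = length (filter (\<lambda>e. w e \<noteq> 0) (path_edges g))" unfolding Q_def by metis
  have "column_time f a b w = passage_time w g"
  proof (rule antisym)
    show "passage_time w g \<le> column_time f a b w"
    proof (rule column_time_ge_slab[where w = w, OF assms(1,2) w])
      fix x' y' g' assume "fst x' = a" "fst y' = b" "walk f x' y' g'" "set (path_edges g') \<subseteq> slab f a b"
      then have "Q (length (filter (\<lambda>e. w e \<noteq> 0) (path_edges g')))" unfolding Q_def by blast
      then have "(LEAST n. Q n) \<le> length (filter (\<lambda>e. w e \<noteq> 0) (path_edges g'))" by (rule Least_le)
      then show "passage_time w g \<le> passage_time w g'" using g(5) passage_time_01[where w = w, OF w01] by simp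
    qed
  qed (use column_time_le[where w = w, OF w g(3)] g in auto)
  with g passage_time_01[where w = w and g = g, OF w01] show ?thesis by metis
qed

lemma passage_ballI:
  "walk f y x g \<Longrightarrow> fst y = a \<Longrightarrow>
    set (path_edges g) \<subseteq> slab f a b \<Longrightarrow> passage_time w g \<le> \<rho> \<Longrightarrow>
    x \<in> passage_ball f a b w \<rho>"
  unfolding passage_ball_def by blast

lemma passage_ball_subset: "passage_ball f a b w \<rho> \<subseteq> {v \<in> V f. a \<le> fst v \<and> fst v \<le> max a b}"
proof
  fix x assume "x \<in> passage_ball f a b w \<rho>"
  then obtain y g where g: "walk f y x g" "fst y = a" "set (path_edges g) \<subseteq> slab f a b"
    unfolding passage_ball_def by blast
  have "a \<le> fst x \<and> fst x \<le> max a b"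
  proof (cases "y = x")
    case False
    then obtain g' u where "g = g' @ [u, x]"
      using g(1) unfolding walk_def is_path_def
      by (metis append_butlast_last_id append_is_Nil_conv append_Cons append_Nil append_assoc list.sel(1) not_Cons_self2 rev_exhaust)
    then have "{u, x} \<in> slab f a b" using g(3) path_edges_append[of g' u "[x]"] by simp
    then have "a \<le> fst x" "fst x \<le> b" by (rule slab_edge_columns)+
    then show ?thesis by simp
  qed (use g in auto)
  then show "x \<in> {v \<in> V f. a \<le> fst v \<and> fst v \<le> max a b}" using walkD(7)[OF g(1)] by simp
qed

lemma passage_ball_walk:
  assumes g: "walk f y x g" "fst y = a" "set (path_edges g) \<subseteq> slab f a b" "passage_time w g \<le> \<rho>"
    and w: "\<And>e. 0 \<le> w e" and v: "v \<in> set g"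
  shows "v \<in> passage_ball f a b w \<rho>"
proof -
  obtain g1 g2 where s: "walk f y v g1" "path_edges g = path_edges g1 @ path_edges g2"
    using walk_split[OF g(1) v] by blast
  have "passage_time w g1 \<le> \<rho>"
    using passage_time_append[OF s(2), of w] passage_time_nonneg[of g2 w] w g(4) by simp
  moreover have "set (path_edges g1) \<subseteq> slab f a b" using g(3) s(2) by simp
  ultimately show ?thesis using s(1) g(2) unfolding passage_ball_def by blast
qed

text \<open>The ball is found by inspecting only edges that touch it. Walks inside it use such edges
  only. Conversely, follow a cheap walk for \<open>w'\<close>: as long as it is in the ball of
  \<open>w\<close>, its next edge touches this ball, so the weights agree and the walk stays cheap
  for \<open>w\<close>.\<close>

lemma passage_ball_local:
  assumes w: "\<And>e. 0 \<le> w e" "\<And>e. 0 \<le> w' e" and "0 \<le> \<rho>"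
    and eq: "\<And>e. e \<in> slab f a b \<Longrightarrow> e \<inter> passage_ball f a b w \<rho> \<noteq> {} \<Longrightarrow> w' e = w e"
  shows "passage_ball f a b w' \<rho> = passage_ball f a b w \<rho>"
proof
  show "passage_ball f a b w \<rho> \<subseteq> passage_ball f a b w' \<rho>"
  proof
    fix x assume "x \<in> passage_ball f a b w \<rho>"
    then obtain y g where g: "walk f y x g" "fst y = a" "set (path_edges g) \<subseteq> slab f a b" "passage_time w g \<le> \<rho>"
      unfolding passage_ball_def by blast
    have "w' e = w e" if e: "e \<in> set (path_edges g)" for e
    proof -
      obtain g1 s t g2 where st: "g = g1 @ s # t # g2" "e = {s, t}" using e by (rule path_edges_pair)
      then have "s \<in> passage_ball f a b w \<rho>" using passage_ball_walk[OF g w(1)] by simp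
      then show ?thesis using eq e g(3) st by blast
    qed
    then have "passage_time w' g = passage_time w g" by (rule passage_time_cong)
    with g show "x \<in> passage_ball f a b w' \<rho>" by (intro passage_ballI[of y x g]) auto
  qed
  have "x \<in> passage_ball f a b w \<rho> \<and> passage_time w g = passage_time w' g"
    if "walk f y x g" "fst y = a" "set (path_edges g) \<subseteq> slab f a b" "passage_time w' g \<le> \<rho>" for x y g
    using that
  proof (induction g arbitrary: x rule: rev_induct)
    case Nil
    then show ?case by (simp add: walk_def is_path_def)
  next
    case (snoc z g)
    show ?case
    proof (cases g rule: rev_cases)
      case Nil
      then have "walk f y x [x]" "passage_time w [x] = 0" "z = x" using snoc by (auto simp: walk_def passage_time_def)
      moreover have "x \<in> passage_ball f a b w \<rho>"
        using calculation snoc(3) assms(3) by (intro passage_ballI[of y x "[x]"]) auto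
      ultimately show ?thesis using Nil by (auto simp: passage_time_def)
    next
      case (snoc g' u)
      have z: "z = x" using snoc.prems by (simp add: walk_def)
      have wg: "walk f y u g" using walk_append(1)[of f y x g' u "[z]"] snoc.prems snoc by simp
      have pe: "path_edges (g @ [z]) = path_edges g @ [{u, z}]"
        using path_edges_append[of g' u "[z]"] snoc by simp
      have t': "passage_time w' (g @ [z]) = passage_time w' g + w' {u, z}"
        and t: "passage_time w (g @ [z]) = passage_time w g + w {u, z}"
        unfolding passage_time_def pe by simp_all
      have "passage_time w' g \<le> \<rho>" using t' snoc.prems(4) w(2)[of "{u, z}"] by linarith
      then have IH: "u \<in> passage_ball f a b w \<rho>" "passage_time w g = passage_time w' g"
        using snoc.IH[OF wg] snoc.prems pe by auto
      then have "w' {u, z} = w {u, z}" using eq snoc.prems(3) pe by auto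
      then have "passage_time w (g @ [z]) = passage_time w' (g @ [z])" using t t' IH by simp
      then show ?thesis using snoc.prems passage_ballI[of y x "g @ [z]" a b w \<rho>] by auto
    qed
  qed
  then show "passage_ball f a b w' \<rho> \<subseteq> passage_ball f a b w \<rho>" unfolding passage_ball_def[of f a b w'] by blast
qed

lemma column_time_less_passage_ball:
  assumes "0 \<le> a" "a \<le> b" "\<And>e. 0 \<le> w e" "\<rho> < column_time f a b w"
  shows "passage_ball f a b w \<rho> \<inter> P b = {}"
proof (rule ccontr)
  assume "\<not> ?thesis"
  then obtain x where x: "x \<in> passage_ball f a b w \<rho>" "x \<in> P b" by blast
  then obtain y g where g: "walk f y x g" "fst y = a" "passage_time w g \<le> \<rho>" "fst x = b"
    unfolding passage_ball_def P_iff by blast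
  have "column_time f a b w \<le> passage_time w g"
    by (rule column_time_le[OF _ g(1,2,4)]) (rule assms(3))
  with g(3) assms(4) show False by simp
qed

lemma passage_ball_column_time_ge:
  assumes "0 \<le> a" "a \<le> b" and w01: "\<And>e. w e \<in> {0, 1 :: real}"
    and "passage_ball f a b w (real j) \<inter> P b = {}"
  shows "real (Suc j) \<le> column_time f a b w"
proof (rule ccontr)
  assume n: "\<not> ?thesis"
  obtain x y g where g: "fst x = a" "fst y = b" "walk f x y g" "set (path_edges g) \<subseteq> slab f a b"
    "column_time f a b w = real (length (filter (\<lambda>e. w e \<noteq> 0) (path_edges g)))"
    using column_time_attained[where w = w, OF assms(1-3)] by metis
  have "passage_time w g \<le> real j" using n g(5) passage_time_01[where w = w and g = g, OF w01] by simp
  then have "y \<in> passage_ball f a b w (real j)" using g unfolding passage_ball_def by blast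
  then show False using assms(4) g(2) by auto
qed

text \<open>Consider the last exit of a walk from the ball. The exit vertex is reached at cost at
  most \<open>\<rho>\<close> and the exit edge costs at most 1, so the remainder costs at least
  \<open>k\<close>. It avoids the ball, hence its weights survive when the edges touching the ball
  are set to 0.\<close>

lemma column_time_restart:
  assumes "0 \<le> a" "a \<le> b" and w01: "\<And>e. 0 \<le> w e" "\<And>e. w e \<le> 1" and "0 \<le> \<rho>" "0 < k"
    and ge: "\<rho> + 1 + k \<le> column_time f a b w"
  shows "k \<le> column_time f a b (\<lambda>e. if e \<inter> passage_ball f a b w \<rho> = {} then w e else 0)"
    (is "_ \<le> column_time f a b ?w")
proof (rule column_time_ge_slab[OF assms(1,2)])
  fix x y h assume h: "fst x = a" "fst y = b" "walk f x y h" "set (path_edges h) \<subseteq> slab f a b"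
  let ?U = "passage_ball f a b w \<rho>"
  have disj: "?U \<inter> P b = {}" using column_time_less_passage_ball[where w = w, OF assms(1,2) w01(1)] ge assms(5,6) by simp
  have xU: "x \<in> ?U" using walk_single[OF walkD(6)[OF h(3)]] h(1) assms(5)
    by (intro passage_ballI[of x x "[x]"]) (auto simp: passage_time_def)
  have yU: "y \<notin> ?U" using disj h(2) by auto
  have "\<exists>v\<in>set h. v \<in> ?U" using xU walkD(4)[OF h(3)] by blast
  then obtain g1 v g2 where v: "h = g1 @ v # g2" "v \<in> ?U" "\<forall>u\<in>set g2. u \<notin> ?U"
    using split_list_last_prop[of h "\<lambda>u. u \<in> ?U"] by blast
  have "g2 \<noteq> []" using v yU h(3) by (auto simp: walk_def)
  then obtain u g2' where u: "g2 = u # g2'" by (cases g2) auto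
  note wa = walk_append[OF h(3)[unfolded v(1)]]
  have wu: "walk f u y (u # g2')" using walk_append(2)[of f v y "[v]" u g2'] wa(2) u by simp
  have e: "walk f v u [v, u]" using wa(2) u by (intro walk_edge) (auto simp: walk_def is_path_def)
  obtain y0 q where q: "walk f y0 v q" "fst y0 = a" "passage_time w q \<le> \<rho>" using v(2) unfolding passage_ball_def by blast
  obtain q1 where q1: "walk f y0 u q1" "path_edges q1 = path_edges q @ path_edges [v, u]"
    using walk_join[OF q(1) e] by blast
  obtain q2 where q2: "walk f y0 y q2" "path_edges q2 = path_edges q1 @ path_edges (u # g2')"
    using walk_join[OF q1(1) wu] by blast
  have "column_time f a b w \<le> passage_time w q2" using column_time_le[where w = w, OF w01(1) q2(1) q(2) h(2)] .
  also have "\<dots> = passage_time w q + w {v, u} + passage_time w (u # g2')"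
    using q1(2) q2(2) by (simp add: passage_time_def)
  also have "\<dots> \<le> \<rho> + 1 + passage_time w (u # g2')" using q(3) w01(2)[of "{v, u}"] by simp
  also have "passage_time w (u # g2') = passage_time ?w (u # g2')"
  proof (rule passage_time_cong)
    fix e assume "e \<in> set (path_edges (u # g2'))"
    then obtain k1 s t k2 where "u # g2' = k1 @ s # t # k2" "e = {s, t}" by (rule path_edges_pair)
    then have "s \<in> set g2" "t \<in> set g2" "e = {s, t}" unfolding u by auto
    then show "w e = ?w e" using v(3) by auto
  qed
  finally have "k \<le> passage_time ?w (u # g2')" using ge by simp
  also have "\<dots> \<le> passage_time ?w h"
  proof -
    have "path_edges h = path_edges (g1 @ [v]) @ [{v, u}] @ path_edges (u # g2')"
      using wa(3) v(1) u by simp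
    then show ?thesis
      using passage_time_nonneg[of "g1 @ [v]" ?w] w01(1)[of "{v, u}"] w01(1) by (auto simp: passage_time_def)
  qed
  finally show "k \<le> passage_time ?w h" .
qed (simp add: w01(1))

end

section \<open>Product spaces and the Efron--Stein inequality\<close>

lemma (in prob_space) square_integrable_mult:
  fixes X Y :: "'a \<Rightarrow> real"
  assumes [measurable]: "random_variable borel X" "random_variable borel Y"
    and "integrable M (\<lambda>x. (X x)\<^sup>2)" "integrable M (\<lambda>x. (Y x)\<^sup>2)"
  shows "integrable M (\<lambda>x. X x * Y x)"
proof (rule Bochner_Integration.integrable_bound)
  show "integrable M (\<lambda>x. (X x)\<^sup>2 + (Y x)\<^sup>2)" using assms by simp
  have "norm (a * b) \<le> norm (a\<^sup>2 + b\<^sup>2)" for a b :: real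
  proof -
    have "2 * \<bar>a\<bar> * \<bar>b\<bar> \<le> a\<^sup>2 + b\<^sup>2" using sum_squares_bound[of "\<bar>a\<bar>" "\<bar>b\<bar>"] by simp
    moreover have "0 \<le> \<bar>a\<bar> * \<bar>b\<bar>" by simp
    ultimately show ?thesis unfolding real_norm_def abs_mult by linarith
  qed
  then show "AE x in M. norm (X x * Y x) \<le> norm ((X x)\<^sup>2 + (Y x)\<^sup>2)" by blast
qed simp

lemma (in prob_space) square_integrable_integrable:
  fixes X :: "'a \<Rightarrow> real"
  assumes "random_variable borel X" "integrable M (\<lambda>x. (X x)\<^sup>2)"
  shows "integrable M X"
  using square_integrable_mult[of X "\<lambda>_. 1"] assms by simp

lemma (in prob_space) square_integrable_add:
  fixes X Y :: "'a \<Rightarrow> real"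
  assumes "random_variable borel X" "random_variable borel Y"
    and "integrable M (\<lambda>x. (X x)\<^sup>2)" "integrable M (\<lambda>x. (Y x)\<^sup>2)"
  shows "integrable M (\<lambda>x. (X x + Y x)\<^sup>2)"
  using square_integrable_mult[OF assms] assms(3,4)
  by (simp add: power2_sum mult.assoc)

lemma (in prob_space) square_integrable_diff:
  fixes X Y :: "'a \<Rightarrow> real"
  assumes "random_variable borel X" "random_variable borel Y"
    and "integrable M (\<lambda>x. (X x)\<^sup>2)" "integrable M (\<lambda>x. (Y x)\<^sup>2)"
  shows "integrable M (\<lambda>x. (X x - Y x)\<^sup>2)"
  using square_integrable_mult[OF assms] assms(3,4)
  by (simp add: power2_diff mult.assoc)

lemma (in prob_space) square_integrable_sum:
  fixes X :: "'k \<Rightarrow> 'a \<Rightarrow> real"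
  assumes "\<And>k. k \<in> J \<Longrightarrow> random_variable borel (X k)" "\<And>k. k \<in> J \<Longrightarrow> integrable M (\<lambda>x. (X k x)\<^sup>2)"
  shows "integrable M (\<lambda>x. (\<Sum>k\<in>J. X k x)\<^sup>2)"
  using assms by (induction J rule: infinite_finite_induct) (auto intro!: square_integrable_add borel_measurable_sum)

lemma (in prob_space) expectation_square_sum_uncorrelated:
  fixes Y :: "'k \<Rightarrow> 'a \<Rightarrow> real"
  assumes "finite J" "\<And>k. k \<in> J \<Longrightarrow> random_variable borel (Y k)"
    and "\<And>k. k \<in> J \<Longrightarrow> integrable M (\<lambda>x. (Y k x)\<^sup>2)"
    and "\<And>k l. k \<in> J \<Longrightarrow> l \<in> J \<Longrightarrow> k \<noteq> l \<Longrightarrow> expectation (\<lambda>x. Y k x * Y l x) = 0"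
  shows "expectation (\<lambda>x. (\<Sum>k\<in>J. Y k x)\<^sup>2) = (\<Sum>k\<in>J. expectation (\<lambda>x. (Y k x)\<^sup>2))"
proof -
  have i: "integrable M (\<lambda>x. Y k x * Y l x)" if "k \<in> J" "l \<in> J" for k l
    using assms that by (intro square_integrable_mult) auto
  have "expectation (\<lambda>x. (\<Sum>k\<in>J. Y k x)\<^sup>2) = expectation (\<lambda>x. \<Sum>k\<in>J. \<Sum>l\<in>J. Y k x * Y l x)"
    by (simp add: power2_eq_square sum_product)
  also have "\<dots> = (\<Sum>k\<in>J. \<Sum>l\<in>J. expectation (\<lambda>x. Y k x * Y l x))"
    using i by (simp add: Bochner_Integration.integral_sum Bochner_Integration.integrable_sum)
  also have "\<dots> = (\<Sum>k\<in>J. \<Sum>l\<in>J. if l = k then expectation (\<lambda>x. (Y k x)\<^sup>2) else 0)"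
    using assms(4) by (intro sum.cong refl) (auto simp: power2_eq_square)
  also have "\<dots> = (\<Sum>k\<in>J. expectation (\<lambda>x. (Y k x)\<^sup>2))" using assms(1) by (simp add: sum.delta)
  finally show ?thesis .
qed

text \<open>Expand the nonnegative second moment of \<open>X - S\<close>, where \<open>X\<close> is
  the centred \<open>T\<close> and \<open>S\<close> the sum of the centred indicators. With
  \<open>s\<close> the sum of the probabilities, pairwise independence gives E(S^2) \<le> s and the
  covariance hypothesis gives E(X S) \<ge> s, so the variance is at least 2 s - s.\<close>

lemma (in prob_space) variance_ge_sum_prob:
  fixes T :: "'a \<Rightarrow> real"
  assumes J: "finite J" and T[measurable]: "random_variable borel T" "integrable M (\<lambda>x. (T x)\<^sup>2)"
    and G[measurable]: "\<And>i. i \<in> J \<Longrightarrow> G i \<in> events"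
    and indep: "\<And>i j. i \<in> J \<Longrightarrow> j \<in> J \<Longrightarrow> i \<noteq> j \<Longrightarrow> prob (G i \<inter> G j) = prob (G i) * prob (G j)"
    and cov: "\<And>i. i \<in> J \<Longrightarrow> prob (G i) \<le> expectation (\<lambda>x. T x * indicator (G i) x) - expectation T * prob (G i)"
  shows "(\<Sum>i\<in>J. prob (G i)) \<le> variance T"
proof -
  define Y where "Y i x = indicator (G i) x - prob (G i)" for i x
  define X where "X x = T x - expectation T" for x
  have Tint: "integrable M T" by (rule square_integrable_integrable) (use T in auto)
  have Gint: "integrable M (indicator (G i) :: 'a \<Rightarrow> real)" if "i \<in> J" for i
    using G[OF that] by (simp add: emeasure_eq_measure integrable_real_indicator)
  have Ym: "random_variable borel (Y i)" if "i \<in> J" for i unfolding Y_def using G[OF that] by simp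
  have Yb: "\<bar>Y i x\<bar> \<le> 1" for i x unfolding Y_def by (cases "x \<in> G i") auto
  have Yint: "integrable M (\<lambda>x. (Y i x)\<^sup>2)" if "i \<in> J" for i
    by (rule integrable_const_bound[of _ 1]) (use Ym[OF that] Yb[of i] abs_square_le_1 in auto)
  have Xm: "random_variable borel X" unfolding X_def by simp
  have Xint: "integrable M (\<lambda>x. (X x)\<^sup>2)" unfolding X_def
    by (intro square_integrable_diff) (use T in auto)
  have YE: "expectation (\<lambda>x. Y i x * Y j x) = prob (G i \<inter> G j) - prob (G i) * prob (G j)"
    if ij: "i \<in> J" "j \<in> J" for i j
  proof -
    have "expectation (\<lambda>x. Y i x * Y j x) = expectation (\<lambda>x. indicator (G i \<inter> G j) x -
        prob (G i) * indicator (G j) x - prob (G j) * indicator (G i) x + prob (G i) * prob (G j))"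
      unfolding Y_def by (intro Bochner_Integration.integral_cong refl) (simp add: algebra_simps indicator_inter_arith)
    also have "\<dots> = prob (G i \<inter> G j) - prob (G i) * prob (G j)"
      using Gint[of i] Gint[of j] ij G
      by (subst Bochner_Integration.integral_add Bochner_Integration.integral_diff;
          (simp add: prob_space emeasure_eq_measure integrable_real_indicator)?)+
    finally show ?thesis .
  qed
  have "expectation (\<lambda>x. (\<Sum>i\<in>J. Y i x)\<^sup>2) = (\<Sum>i\<in>J. expectation (\<lambda>x. (Y i x)\<^sup>2))"
    by (rule expectation_square_sum_uncorrelated[OF J Ym Yint]) (use YE indep in auto)
  also have "\<dots> \<le> (\<Sum>i\<in>J. prob (G i))"
  proof (rule sum_mono)
    fix i assume "i \<in> J"
    then show "expectation (\<lambda>x. (Y i x)\<^sup>2) \<le> prob (G i)" using YE[of i i] by (simp add: power2_eq_square)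
  qed
  finally have 1: "expectation (\<lambda>x. (\<Sum>i\<in>J. Y i x)\<^sup>2) \<le> (\<Sum>i\<in>J. prob (G i))" .
  have XYi: "integrable M (\<lambda>x. X x * Y i x)" if "i \<in> J" for i
    by (rule square_integrable_mult[OF Xm Ym[OF that] Xint Yint[OF that]])
  have TG: "integrable M (\<lambda>x. T x * indicator (G i) x)" if "i \<in> J" for i
    using integrable_mult_indicator[OF G[OF that] Tint] by (simp add: mult.commute)
  have XE: "expectation (\<lambda>x. X x * Y i x) = expectation (\<lambda>x. T x * indicator (G i) x) - expectation T * prob (G i)"
    if i: "i \<in> J" for i
  proof -
    have "expectation (\<lambda>x. X x * Y i x) = expectation (\<lambda>x. T x * indicator (G i) x -
        expectation T * indicator (G i) x - prob (G i) * T x + prob (G i) * expectation T)"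
      unfolding Y_def X_def by (intro Bochner_Integration.integral_cong refl) (simp add: algebra_simps)
    also have "\<dots> = expectation (\<lambda>x. T x * indicator (G i) x) - expectation T * prob (G i)"
      using Gint[of i] TG[of i] i G Tint
      by (subst Bochner_Integration.integral_add Bochner_Integration.integral_diff; (simp add: prob_space)?)+
    finally show ?thesis .
  qed
  have "(\<Sum>i\<in>J. prob (G i)) \<le> (\<Sum>i\<in>J. expectation (\<lambda>x. X x * Y i x))"
    using cov XE by (intro sum_mono) auto
  also have "\<dots> = expectation (\<lambda>x. X x * (\<Sum>i\<in>J. Y i x))"
    using XYi by (simp add: sum_distrib_left Bochner_Integration.integral_sum)
  finally have 2: "(\<Sum>i\<in>J. prob (G i)) \<le> expectation (\<lambda>x. X x * (\<Sum>i\<in>J. Y i x))" .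
  have Sm: "random_variable borel (\<lambda>x. \<Sum>i\<in>J. Y i x)" using Ym by simp
  have Sint: "integrable M (\<lambda>x. (\<Sum>i\<in>J. Y i x)\<^sup>2)" by (rule square_integrable_sum[OF Ym Yint])
  note XS = square_integrable_mult[OF Xm Sm Xint Sint]
  have "0 \<le> expectation (\<lambda>x. (X x - (\<Sum>i\<in>J. Y i x))\<^sup>2)" by simp
  also have "\<dots> = expectation (\<lambda>x. (X x)\<^sup>2 + (\<Sum>i\<in>J. Y i x)\<^sup>2 - 2 * (X x * (\<Sum>i\<in>J. Y i x)))"
    by (intro Bochner_Integration.integral_cong refl) (simp add: power2_diff mult.assoc)
  also have "\<dots> = expectation (\<lambda>x. (X x)\<^sup>2) + expectation (\<lambda>x. (\<Sum>i\<in>J. Y i x)\<^sup>2)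
      - 2 * expectation (\<lambda>x. X x * (\<Sum>i\<in>J. Y i x))"
    using Xint Sint XS by simp
  finally show ?thesis using 1 2 unfolding X_def by linarith
qed

text \<open>Holds for all total functions, not almost surely or only on the space of the product. So
  it can be checked configuration by configuration, and independence follows by factoring through a
  restriction.\<close>

definition depends_on :: "'i set \<Rightarrow> (('i \<Rightarrow> 'b) \<Rightarrow> 'c) \<Rightarrow> bool" where
  "depends_on A g \<longleftrightarrow> (\<forall>w w'. (\<forall>i\<in>A. w i = w' i) \<longrightarrow> g w = g w')"

lemma depends_onD: "depends_on A g \<Longrightarrow> (\<And>i. i \<in> A \<Longrightarrow> w i = w' i) \<Longrightarrow> g w = g w'"
  by (auto simp: depends_on_def)

lemma depends_on_mono: "depends_on A g \<Longrightarrow> A \<subseteq> B \<Longrightarrow> depends_on B g"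
  unfolding depends_on_def by blast

lemma depends_on_compose: "depends_on A g \<Longrightarrow> depends_on A (\<lambda>w. h (g w))"
  unfolding depends_on_def by metis

section \<open>Independence on a product space\<close>

locale iid_product =
  fixes I :: "'i set" and \<nu> :: "real measure"
  assumes prob_nu: "prob_space \<nu>" and sets_nu: "sets \<nu> = sets borel"
begin

definition Q :: "('i \<Rightarrow> real) measure" where "Q = PiM I (\<lambda>_. \<nu>)"

sublocale Q: prob_space Q
  unfolding Q_def by (rule prob_space_PiM) (rule prob_nu)

lemma space_nu: "space \<nu> = UNIV"
  using sets_eq_imp_space_eq[OF sets_nu] by simp

lemma coordinate_measurable: "i \<in> I \<Longrightarrow> (\<lambda>w. w i) \<in> borel_measurable Q"
  unfolding Q_def using measurable_component_singleton[of i I "\<lambda>_. \<nu>"] measurable_cong_sets[OF refl sets_nu] by blast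

lemma distr_coordinate: "i \<in> I \<Longrightarrow> distr Q \<nu> (\<lambda>w. w i) = \<nu>"
  unfolding Q_def by (rule distr_PiM_component) (rule prob_nu)

lemma indep_coordinates: "Q.indep_vars (\<lambda>_. \<nu>) (\<lambda>i w. w i) I"
proof (cases "I = {}")
  case True
  then show ?thesis unfolding Q.indep_vars_def Q.indep_sets_def by simp
next
  case False
  have "distr Q (PiM I (\<lambda>_. \<nu>)) (\<lambda>x. \<lambda>i\<in>I. x i) = distr Q Q (\<lambda>x. x)"
    by (intro distr_cong) (auto simp: Q_def space_PiM PiE_def extensional_restrict)
  also have "\<dots> = (\<Pi>\<^sub>M i\<in>I. distr Q \<nu> (\<lambda>w. w i))"
    unfolding distr_id unfolding Q_def[symmetric]
    by (subst Q_def, intro PiM_cong refl) (simp add: distr_coordinate)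
  finally show ?thesis
    using False by (subst Q.indep_vars_iff_distr_eq_PiM') (auto simp: Q_def)
qed

lemma depends_on_factor:
  assumes "g \<in> borel_measurable Q" "depends_on A g" "A \<subseteq> I"
  shows "\<exists>g'\<in>borel_measurable (PiM A (\<lambda>_. \<nu>)). \<forall>w. g' (restrict w A) = g w"
proof (intro bexI allI)
  \<comment> \<open>Any extension of a configuration on \<open>A\<close> will do, because
    \<open>g\<close> ignores the coordinates outside \<open>A\<close>; the value 0 is
    arbitrary.\<close>
  define ex where "ex v = (\<lambda>i\<in>I. if i \<in> A then v i else (0::real))" for v :: "'i \<Rightarrow> real"
  show "g (ex (restrict w A)) = g w" for w
    by (rule depends_onD[OF assms(2)]) (use assms(3) in \<open>auto simp: ex_def\<close>)
  have "(\<lambda>v. if i \<in> A then v i else 0) \<in> measurable (PiM A (\<lambda>_. \<nu>)) \<nu>" for i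
    by (cases "i \<in> A") (simp_all add: space_nu)
  then have "ex \<in> measurable (PiM A (\<lambda>_. \<nu>)) (PiM I (\<lambda>_. \<nu>))"
    unfolding ex_def by (intro measurable_restrict)
  then show "(\<lambda>v. g (ex v)) \<in> borel_measurable (PiM A (\<lambda>_. \<nu>))"
    using assms(1) unfolding Q_def by simp
qed

lemma indep_vars_depends_on:
  assumes meas: "\<And>j. j \<in> J \<Longrightarrow> g j \<in> borel_measurable Q"
    and dep: "\<And>j. j \<in> J \<Longrightarrow> depends_on (K j) (g j)"
    and K: "\<And>j. j \<in> J \<Longrightarrow> K j \<subseteq> I" "disjoint_family_on K J"
  shows "Q.indep_vars (\<lambda>_. borel) g J"
proof -
  have "\<exists>h. \<forall>j\<in>J. h j \<in> borel_measurable (PiM (K j) (\<lambda>_. \<nu>)) \<and> (\<forall>w. h j (restrict w (K j)) = g j w)"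
    using depends_on_factor[OF meas dep K(1)] by (intro bchoice) blast
  then obtain h where h: "\<And>j. j \<in> J \<Longrightarrow> h j \<in> borel_measurable (PiM (K j) (\<lambda>_. \<nu>))"
    "\<And>j w. j \<in> J \<Longrightarrow> h j (restrict w (K j)) = g j w" by blast
  have "Q.indep_vars (\<lambda>j. PiM (K j) (\<lambda>_. \<nu>)) (\<lambda>j w. restrict (\<lambda>i. w i) (K j)) J"
    by (rule Q.indep_vars_restrict[OF indep_coordinates K])
  then have "Q.indep_vars (\<lambda>_. borel) (\<lambda>j w. h j (restrict (\<lambda>i. w i) (K j))) J"
    by (rule Q.indep_vars_compose2) (rule h(1))
  then show ?thesis
    by (rule Q.indep_vars_cong[THEN iffD1, rotated -1]) (use h(2) in auto)
qed

lemma indep_var_depends_on: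
  assumes meas: "g \<in> borel_measurable Q" "h \<in> borel_measurable Q"
    and dep: "depends_on A g" "depends_on B h" and AB: "A \<subseteq> I" "B \<subseteq> I" "A \<inter> B = {}"
  shows "Q.indep_var borel g borel h"
proof -
  have "Q.indep_vars (\<lambda>_. borel) (case_bool g h) UNIV"
    by (rule indep_vars_depends_on[where K = "case_bool A B"])
       (use assms in \<open>auto simp: disjoint_family_on_def split: bool.splits\<close>)
  moreover have "(\<lambda>_. borel) = case_bool borel borel"
    by (auto simp: fun_eq_iff split: bool.split)
  ultimately show ?thesis unfolding Q.indep_var_def by metis
qed

lemma expectation_mult_depends_on:
  fixes g h :: "('i \<Rightarrow> real) \<Rightarrow> real"
  assumes "integrable Q g" "integrable Q h"
    and "depends_on A g" "depends_on B h" "A \<subseteq> I" "B \<subseteq> I" "A \<inter> B = {}"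
  shows "Q.expectation (\<lambda>w. g w * h w) = Q.expectation g * Q.expectation h"
    and "integrable Q (\<lambda>w. g w * h w)"
proof -
  have iv: "Q.indep_var borel g borel h"
    by (rule indep_var_depends_on[OF _ _ assms(3-7)]) (use assms(1,2) in auto)
  show "Q.expectation (\<lambda>w. g w * h w) = Q.expectation g * Q.expectation h"
    by (rule Q.indep_var_lebesgue_integral[OF iv assms(1,2)])
  show "integrable Q (\<lambda>w. g w * h w)"
    by (rule Q.indep_var_integrable[OF iv assms(1,2)])
qed

lemma prob_Int_depends_on:
  assumes PQ: "{w \<in> space Q. p w} \<in> sets Q" "{w \<in> space Q. q w} \<in> sets Q"
    and "depends_on A p" "depends_on B q" "A \<subseteq> I" "B \<subseteq> I" "A \<inter> B = {}"
  shows "Q.prob {w \<in> space Q. p w \<and> q w} = Q.prob {w \<in> space Q. p w} * Q.prob {w \<in> space Q. q w}"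
proof -
  have [measurable]: "Measurable.pred Q p" "Measurable.pred Q q" using PQ by (auto simp: pred_def)
  have i: "integrable Q (\<lambda>w. of_bool (p w) :: real)" "integrable Q (\<lambda>w. of_bool (q w) :: real)"
    by (rule Q.integrable_const_bound[of _ 1]; simp)+
  have e: "Q.expectation (\<lambda>w. of_bool (X w) :: real) = Q.prob {w \<in> space Q. X w}"
    if [measurable]: "Measurable.pred Q X" for X
  proof -
    have "Q.expectation (\<lambda>w. of_bool (X w) :: real) = Q.expectation (indicator {w \<in> space Q. X w})"
      by (intro Bochner_Integration.integral_cong) (auto simp: indicator_def)
    then show ?thesis by simp
  qed
  have "Q.prob {w \<in> space Q. p w \<and> q w} = Q.expectation (\<lambda>w. of_bool (p w) * of_bool (q w))"
    by (subst e[symmetric]) (auto simp: of_bool_conj)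
  also have "\<dots> = Q.expectation (\<lambda>w. of_bool (p w)) * Q.expectation (\<lambda>w. of_bool (q w))"
    by (rule expectation_mult_depends_on(1)[OF i depends_on_compose[OF assms(3)] depends_on_compose[OF assms(4)] assms(5-7)])
  finally show ?thesis by (simp add: e)
qed

text \<open>Two independent copies of the environment are encoded as one environment on \<open>I \<times> UNIV\<close>.\<close>

definition mix :: "'i set \<Rightarrow> ('i \<times> bool \<Rightarrow> real) \<Rightarrow> 'i \<Rightarrow> real" where
  "mix S u = (\<lambda>i\<in>I. u (i, i \<in> S))"

text \<open>Interchanges the two copies on \<open>B\<close>. As a permutation of i.i.d. coordinates
  it preserves the law, and this symmetry drives \<open>efron_stein\<close>.\<close>

definition swap :: "'i set \<Rightarrow> ('i \<times> bool \<Rightarrow> real) \<Rightarrow> 'i \<times> bool \<Rightarrow> real" where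
  "swap B u = (\<lambda>p\<in>I \<times> UNIV. u (fst p, snd p \<noteq> (fst p \<in> B)))"

interpretation Q2: iid_product "I \<times> (UNIV :: bool set)" \<nu>
  by unfold_locales

lemma distr_mix: "distr Q2.Q Q (mix S) = Q"
  unfolding Q_def Q2.Q_def mix_def
  by (rule distr_PiM_reindex[where M = "\<lambda>_. \<nu>"]) (auto intro: prob_nu inj_onI)

lemma distr_swap: "distr Q2.Q Q2.Q (swap B) = Q2.Q"
  unfolding Q2.Q_def swap_def
  by (rule distr_PiM_reindex[where M = "\<lambda>_. \<nu>"]) (auto intro: prob_nu inj_onI)

lemma mix_measurable: "mix S \<in> measurable Q2.Q Q"
  unfolding mix_def Q_def Q2.Q_def by (intro measurable_restrict measurable_component_singleton) auto

lemma swap_measurable: "swap S \<in> measurable Q2.Q Q2.Q"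
  unfolding swap_def Q2.Q_def by (intro measurable_restrict measurable_component_singleton) auto

text \<open>Both operations toggle the Boolean component, so they compose by symmetric
  difference.\<close>

lemma mix_swap: "mix S (swap B u) = mix ((S - B) \<union> (B - S)) u"
proof
  fix i
  have "(i \<in> S) \<noteq> (i \<in> B) \<longleftrightarrow> i \<in> (S - B) \<union> (B - S)" by blast
  then show "mix S (swap B u) i = mix ((S - B) \<union> (B - S)) u i"
    unfolding mix_def swap_def by (simp only: restrict_def) simp
qed

lemma integral_mix:
  fixes g :: "('i \<Rightarrow> real) \<Rightarrow> real"
  assumes "g \<in> borel_measurable Q"
  shows "Q2.Q.expectation (\<lambda>u. g (mix S u)) = Q.expectation g"
  using integral_distr[OF mix_measurable, of g S] assms distr_mix by simp

lemma integrable_mix: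
  fixes g :: "('i \<Rightarrow> real) \<Rightarrow> real"
  assumes "integrable Q g"
  shows "integrable Q2.Q (\<lambda>u. g (mix S u))"
  using integrable_distr_eq[OF mix_measurable, of g S] assms distr_mix by simp

text \<open>Replace the copy block by block, from none to all blocks; the variance telescopes into
  E(g Delta_k) over the single replacements. Interchanging the copies on \<open>B k\<close> reverses
  the sign of Delta_k, so each term is half the expectation of a product of two differences across
  \<open>B k\<close>. Each difference is compared with \<open>h k\<close>, which does not see
  \<open>B k\<close>; the resulting four equal terms, halved, give the factor 2.\<close>

theorem efron_stein:
  fixes g :: "('i \<Rightarrow> real) \<Rightarrow> real" and h :: "nat \<Rightarrow> ('i \<Rightarrow> real) \<Rightarrow> real"
  assumes g[measurable]: "g \<in> borel_measurable Q" "integrable Q (\<lambda>w. (g w)\<^sup>2)"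
    and dep: "depends_on (\<Union>k<n. B k) g"
    and B: "\<And>k. k < n \<Longrightarrow> B k \<subseteq> I" "disjoint_family_on B {..<n}"
    and h[measurable]: "\<And>k. k < n \<Longrightarrow> h k \<in> borel_measurable Q" "\<And>k. k < n \<Longrightarrow> integrable Q (\<lambda>w. (h k w)\<^sup>2)"
    and hdep: "\<And>k. k < n \<Longrightarrow> depends_on (- B k) (h k)"
  shows "Q.variance g \<le> 2 * (\<Sum>k<n. Q.expectation (\<lambda>w. (g w - h k w)\<^sup>2))"
proof -
  let ?E = "Q2.Q.expectation"
  define G where "G S u = g (mix S u)" for S u
  define S where "S k = (\<Union>j<k. B j)" for k
  have Gm[measurable]: "G A \<in> borel_measurable Q2.Q" for A
    unfolding G_def using mix_measurable[of A] by simp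
  have Gi: "integrable Q2.Q (\<lambda>u. (G A u)\<^sup>2)" for A
    unfolding G_def by (rule integrable_mix) (rule g)
  have GG: "integrable Q2.Q (\<lambda>u. G A u * G A' u)" for A A'
    by (rule Q2.Q.square_integrable_mult) (use Gi in auto)
  have G1: "integrable Q2.Q (G A)" for A
    by (rule Q2.Q.square_integrable_integrable) (use Gi in auto)
  have gi: "integrable Q g" by (rule Q.square_integrable_integrable) (use g in auto)
  have SI: "S n \<subseteq> I" unfolding S_def using B(1) by blast
  have E1: "?E (G A) = Q.expectation g" for A unfolding G_def by (rule integral_mix) simp
  have E2: "?E (\<lambda>u. G A u * G A u) = Q.expectation (\<lambda>w. (g w)\<^sup>2)" for A
    unfolding G_def using integral_mix[of "\<lambda>w. (g w)\<^sup>2" A] by (simp add: power2_eq_square)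
  \<comment> \<open>The two factors read different copies of all the coordinates on which
    \<open>g\<close> depends.\<close>
  have "?E (\<lambda>u. G {} u * G (S n) u) = ?E (G {}) * ?E (G (S n))"
  proof (rule Q2.expectation_mult_depends_on[OF G1 G1, where A = "S n \<times> {False}" and B = "S n \<times> {True}"])
    show "depends_on (S n \<times> {False}) (G {})" "depends_on (S n \<times> {True}) (G (S n))"
      unfolding G_def depends_on_def
      by (intro allI impI depends_onD[OF dep]; use SI in \<open>auto simp: mix_def S_def\<close>)+
  qed (use SI in auto)
  then have v: "Q.variance g = ?E (\<lambda>u. G {} u * G {} u) - ?E (\<lambda>u. G {} u * G (S n) u)"
    using Q.variance_eq[OF gi g(2)] E1 E2 by (simp add: power2_eq_square)
  also have "\<dots> = (\<Sum>k<n. ?E (\<lambda>u. G {} u * G (S k) u) - ?E (\<lambda>u. G {} u * G (S (Suc k)) u))"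
    using sum_lessThan_telescope'[of "\<lambda>k. ?E (\<lambda>u. G {} u * G (S k) u)" n] by (simp add: S_def)
  also have "\<dots> \<le> (\<Sum>k<n. 2 * Q.expectation (\<lambda>w. (g w - h k w)\<^sup>2))"
  proof (rule sum_mono)
    fix k assume "k \<in> {..<n}"
    then have k: "k < n" by simp
    define \<Delta> where "\<Delta> u = G (S k) u - G (S (Suc k)) u" for u
    have "B j \<inter> B k = {}" if "j < k" for j
      using disjoint_family_onD[OF B(2), of j k] that k by simp
    then have dj: "S k \<inter> B k = {}" unfolding S_def by blast
    have SS: "S (Suc k) = S k \<union> B k" unfolding S_def by (auto simp: less_Suc_eq)
    have sw: "G {} (swap (B k) u) = G (B k) u" "G (S k) (swap (B k) u) = G (S (Suc k)) u"
      "G (S (Suc k)) (swap (B k) u) = G (S k) u" for u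
    proof -
      have "({} - B k) \<union> (B k - {}) = B k" "(S k - B k) \<union> (B k - S k) = S k \<union> B k"
        "(S k \<union> B k - B k) \<union> (B k - (S k \<union> B k)) = S k" using dj by blast+
      then show "G {} (swap (B k) u) = G (B k) u" "G (S k) (swap (B k) u) = G (S (Suc k)) u"
        "G (S (Suc k)) (swap (B k) u) = G (S k) u"
        unfolding G_def mix_swap SS by simp_all
    qed
    have D[measurable]: "\<Delta> \<in> borel_measurable Q2.Q" unfolding \<Delta>_def by simp
    have Di: "integrable Q2.Q (\<lambda>u. (\<Delta> u)\<^sup>2)" unfolding \<Delta>_def
      by (rule Q2.Q.square_integrable_diff) (use Gi in auto)
    have GD: "integrable Q2.Q (\<lambda>u. G A u * \<Delta> u)" for A
      by (rule Q2.Q.square_integrable_mult) (use Gi Di in auto)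
    \<comment> \<open>The swap on \<open>B k\<close> preserves the law, exchanges the two terms of
      \<open>\<Delta>\<close>, and turns \<open>G {}\<close> into \<open>G (B k)\<close>.\<close>
    have "?E (\<lambda>u. G {} u * \<Delta> u) = integral\<^sup>L (distr Q2.Q Q2.Q (swap (B k))) (\<lambda>u. G {} u * \<Delta> u)"
      by (simp add: distr_swap)
    also have "\<dots> = ?E (\<lambda>u. G {} (swap (B k) u) * \<Delta> (swap (B k) u))"
      by (rule integral_distr[OF swap_measurable]) simp
    also have "\<dots> = ?E (\<lambda>u. - (G (B k) u * \<Delta> u))"
      by (intro Bochner_Integration.integral_cong refl) (simp add: sw \<Delta>_def algebra_simps)
    also have "\<dots> = - ?E (\<lambda>u. G (B k) u * \<Delta> u)" by simp
    finally have "2 * ?E (\<lambda>u. G {} u * \<Delta> u) = ?E (\<lambda>u. G {} u * \<Delta> u) - ?E (\<lambda>u. G (B k) u * \<Delta> u)" by simp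
    also have "\<dots> = ?E (\<lambda>u. (G {} u - G (B k) u) * \<Delta> u)"
      by (subst Bochner_Integration.integral_diff[symmetric]) (use GD in \<open>auto simp: algebra_simps\<close>)
    also have "\<dots> \<le> ?E (\<lambda>u. (G {} u - h k (mix {} u))\<^sup>2 + (G (B k) u - h k (mix (B k) u))\<^sup>2
        + (G (S k) u - h k (mix (S k) u))\<^sup>2 + (G (S (Suc k)) u - h k (mix (S (Suc k)) u))\<^sup>2)"
      (is "_ \<le> Q2.Q.expectation ?F")
    proof (rule integral_mono)
      have Hint: "integrable Q2.Q (\<lambda>u. (G A u - h k (mix A u))\<^sup>2)" for A
        unfolding G_def by (rule integrable_mix[of "\<lambda>w. (g w - h k w)\<^sup>2"], rule Q.square_integrable_diff) (use g h k in auto)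
      show "integrable Q2.Q ?F" using Hint by simp
      show "integrable Q2.Q (\<lambda>u. (G {} u - G (B k) u) * \<Delta> u)"
        using GD by (simp add: left_diff_distrib)
      fix u
      have H: "h k (mix {} u) = h k (mix (B k) u)" "h k (mix (S k) u) = h k (mix (S (Suc k)) u)"
        by (rule depends_onD[OF hdep[OF k]]; simp add: mix_def SS)+
      \<comment> \<open>\<open>x\<close> and \<open>y\<close> are the values of \<open>h k\<close>
        common to the two configurations of each pair.\<close>
      have ineq: "(a - b) * (c - d) \<le> (a - x)\<^sup>2 + (b - x)\<^sup>2 + (c - y)\<^sup>2 + (d - y)\<^sup>2" for a b c d x y :: real
      proof -
        have "2 * ((a - b) * (c - d)) \<le> (a - b)\<^sup>2 + (c - d)\<^sup>2" using sum_squares_bound[of "a - b" "c - d"] by (simp only: mult.assoc)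
        moreover have "(a - b)\<^sup>2 \<le> 2 * (a - x)\<^sup>2 + 2 * (b - x)\<^sup>2" for a b x :: real
          using zero_le_power2[of "a + b - 2 * x"] by (simp add: power2_eq_square algebra_simps)
        from this[of a b x] this[of c d y] calculation show ?thesis by linarith
      qed
      show "(G {} u - G (B k) u) * \<Delta> u \<le> ?F u" unfolding \<Delta>_def H by (rule ineq)
    qed
    also have "\<dots> = 4 * Q.expectation (\<lambda>w. (g w - h k w)\<^sup>2)"
    proof -
      have Hint: "integrable Q2.Q (\<lambda>u. (G A u - h k (mix A u))\<^sup>2)" for A
        unfolding G_def by (rule integrable_mix[of "\<lambda>w. (g w - h k w)\<^sup>2"], rule Q.square_integrable_diff) (use g h k in auto)
      have "?E (\<lambda>u. (G A u - h k (mix A u))\<^sup>2) = Q.expectation (\<lambda>w. (g w - h k w)\<^sup>2)" for A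
        unfolding G_def by (rule integral_mix[of "\<lambda>w. (g w - h k w)\<^sup>2"]) (use h k in simp)
      then show ?thesis using Hint by simp
    qed
    finally have "?E (\<lambda>u. G {} u * \<Delta> u) \<le> 2 * Q.expectation (\<lambda>w. (g w - h k w)\<^sup>2)" by simp
    moreover have "?E (\<lambda>u. G {} u * \<Delta> u) = ?E (\<lambda>u. G {} u * G (S k) u) - ?E (\<lambda>u. G {} u * G (S (Suc k)) u)"
      unfolding \<Delta>_def by (subst Bochner_Integration.integral_diff[symmetric]) (use GG in \<open>auto simp: algebra_simps\<close>)
    ultimately show "?E (\<lambda>u. G {} u * G (S k) u) - ?E (\<lambda>u. G {} u * G (S (Suc k)) u)
        \<le> 2 * Q.expectation (\<lambda>w. (g w - h k w)\<^sup>2)" by simp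
  qed
  finally show ?thesis by (simp add: sum_distrib_left)
qed

end

section \<open>A central limit theorem for block approximations\<close>

lemma cmod_iexp_diff_le: "cmod (iexp a - iexp b) \<le> \<bar>a - b\<bar>"
proof -
  have "iexp a - iexp b = iexp b * (iexp (a - b) - 1)"
    by (simp add: algebra_simps exp_diff exp_minus field_simps)
  moreover have "cmod (iexp (a - b) - 1) \<le> \<bar>a - b\<bar>"
    using iexp_approx1[of "a - b" 0] by simp
  ultimately show ?thesis by (simp add: norm_mult)
qed

lemma exp_minus_lipschitz:
  fixes x y :: real
  assumes "0 \<le> x" "0 \<le> y"
  shows "\<bar>exp (- x) - exp (- y)\<bar> \<le> \<bar>x - y\<bar>"
proof -
  have *: "exp (- x) - exp (- y) \<le> y - x" "0 \<le> exp (- x) - exp (- y)" if "0 \<le> x" "x \<le> y" for x y :: real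
  proof -
    have "exp (- x) - exp (- y) = exp (- x) * (1 - exp (- (y - x)))"
      by (simp add: algebra_simps exp_add[symmetric])
    also have "\<dots> \<le> 1 * (y - x)"
    proof (rule mult_mono)
      show "1 - exp (- (y - x)) \<le> y - x" using exp_ge_add_one_self[of "- (y - x)"] by linarith
    qed (use that in auto)
    finally show "exp (- x) - exp (- y) \<le> y - x" by simp
    show "0 \<le> exp (- x) - exp (- y)" using that by simp
  qed
  show ?thesis using *[of x y] *[of y x] assms by (cases "x \<le> y") auto
qed

lemma exp_minus_taylor:
  fixes x :: real
  assumes "0 \<le> x"
  shows "\<bar>exp (- x) - (1 - x)\<bar> \<le> x\<^sup>2"
proof -
  have 1: "1 - x \<le> exp (- x)" using exp_ge_add_one_self[of "- x"] by simp
  have "exp (- x) \<le> 1 / (1 + x)"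
    using exp_ge_add_one_self[of x] assms by (simp add: exp_minus field_simps)
  also have "\<dots> \<le> 1 - x + x\<^sup>2"
  proof -
    have "1 \<le> (1 - x + x\<^sup>2) * (1 + x)" using assms by (simp add: algebra_simps power2_eq_square)
    then show ?thesis using assms by (simp add: pos_divide_le_eq)
  qed
  finally show ?thesis using 1 by simp
qed

lemma abs_le_eps_square:
  fixes x \<epsilon> :: real
  assumes "0 < \<epsilon>"
  shows "\<bar>x\<bar> \<le> (\<epsilon> + x\<^sup>2 / \<epsilon>) / 2"
proof -
  have "0 \<le> (\<bar>x\<bar> - \<epsilon>)\<^sup>2" by simp
  then have "2 * \<epsilon> * \<bar>x\<bar> \<le> \<epsilon>\<^sup>2 + x\<^sup>2" by (simp add: power2_diff mult_ac)
  then show ?thesis using assms by (simp add: field_simps power2_eq_square)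
qed

lemma power4_diff_le:
  fixes a b :: real
  shows "(a - b) ^ 4 \<le> 8 * (a ^ 4 + b ^ 4)"
proof -
  have sq: "(x - y)\<^sup>2 \<le> 2 * (x\<^sup>2 + y\<^sup>2)" for x y :: real
    using zero_le_power2[of "x + y"] by (simp add: power2_eq_square algebra_simps)
  have "(a - b) ^ 4 = ((a - b)\<^sup>2)\<^sup>2" by simp
  also have "\<dots> \<le> (2 * (a\<^sup>2 + b\<^sup>2))\<^sup>2" by (rule power_mono[OF sq]) simp
  also have "\<dots> = 4 * (a\<^sup>2 - (- (b\<^sup>2)))\<^sup>2" unfolding power_mult_distrib by simp
  also have "\<dots> \<le> 4 * (2 * ((a\<^sup>2)\<^sup>2 + (- (b\<^sup>2))\<^sup>2))" using sq[of "a\<^sup>2" "- (b\<^sup>2)"] by linarith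
  also have "\<dots> = 8 * (a ^ 4 + b ^ 4)" by simp
  finally show ?thesis .
qed

lemma power2_le_1_power4: "(x::real)\<^sup>2 \<le> 1 + x ^ 4"
proof -
  have "0 \<le> (x\<^sup>2 - 1)\<^sup>2 + 1 + (x\<^sup>2)\<^sup>2" by simp
  then show ?thesis by (simp add: power2_diff)
qed

lemma abs_power3_le_1_power4: "\<bar>x::real\<bar> ^ 3 \<le> 1 + x ^ 4"
proof (cases "\<bar>x\<bar> \<le> 1")
  case True
  then have "\<bar>x\<bar> ^ 3 \<le> 1" by (simp add: power_le_one)
  moreover have "0 \<le> x ^ 4" by simp
  ultimately show ?thesis by linarith
next
  case False
  then have "\<bar>x\<bar> ^ 3 \<le> \<bar>x\<bar> ^ 4" by (intro power_increasing) auto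
  then show ?thesis by simp
qed

section \<open>Fourth moments and characteristic functions\<close>

context prob_space
begin

lemma power4_integrable_square:
  fixes X :: "'a \<Rightarrow> real"
  assumes "random_variable borel X" "integrable M (\<lambda>x. X x ^ 4)"
  shows "integrable M (\<lambda>x. (X x)\<^sup>2)" "integrable M X" "integrable M (\<lambda>x. \<bar>X x\<bar> ^ 3)"
proof -
  show 2: "integrable M (\<lambda>x. (X x)\<^sup>2)"
    by (rule Bochner_Integration.integrable_bound[of _ "\<lambda>x. 1 + X x ^ 4"])
       (use assms power2_le_1_power4 in auto)
  show "integrable M X" by (rule square_integrable_integrable[OF assms(1) 2])
  show "integrable M (\<lambda>x. \<bar>X x\<bar> ^ 3)"
    by (rule Bochner_Integration.integrable_bound[of _ "\<lambda>x. 1 + X x ^ 4"])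
       (use assms abs_power3_le_1_power4 in auto)
qed

lemma expectation_square_le:
  fixes X :: "'a \<Rightarrow> real"
  assumes "random_variable borel X" "integrable M (\<lambda>x. (X x)\<^sup>2)"
  shows "(expectation X)\<^sup>2 \<le> expectation (\<lambda>x. (X x)\<^sup>2)"
  using variance_eq[OF square_integrable_integrable[OF assms] assms(2)] variance_positive[of X] by simp

text \<open>The constant is 8 * 2: 8 from \<open>power4_diff_le\<close>, and the fourth power of the
  mean is at most the fourth moment by Jensen's inequality for squares, applied twice.\<close>

lemma expectation_power4_centered:
  fixes X :: "'a \<Rightarrow> real"
  assumes X[measurable]: "random_variable borel X" "integrable M (\<lambda>x. X x ^ 4)"
  shows "integrable M (\<lambda>x. (X x - expectation X) ^ 4)"
    and "expectation (\<lambda>x. (X x - expectation X) ^ 4) \<le> 16 * expectation (\<lambda>x. X x ^ 4)"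
proof -
  let ?m = "expectation X"
  show i: "integrable M (\<lambda>x. (X x - ?m) ^ 4)"
  proof (rule Bochner_Integration.integrable_bound[of _ "\<lambda>x. 8 * (X x ^ 4 + ?m ^ 4)"])
    show "AE x in M. norm ((X x - ?m) ^ 4) \<le> norm (8 * (X x ^ 4 + ?m ^ 4))"
      using power4_diff_le by (intro AE_I2) (simp add: abs_mult)
  qed (use assms in auto)
  have "(?m\<^sup>2)\<^sup>2 \<le> (expectation (\<lambda>x. (X x)\<^sup>2))\<^sup>2"
    by (rule power_mono[OF expectation_square_le]) (use power4_integrable_square[OF assms] in auto)
  also have "\<dots> \<le> expectation (\<lambda>x. ((X x)\<^sup>2)\<^sup>2)"
    by (rule expectation_square_le) (use assms in auto)
  finally have m: "?m ^ 4 \<le> expectation (\<lambda>x. X x ^ 4)" by simp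
  have "expectation (\<lambda>x. (X x - ?m) ^ 4) \<le> expectation (\<lambda>x. 8 * (X x ^ 4 + ?m ^ 4))"
    by (intro integral_mono i power4_diff_le) (use assms in simp)
  also have "\<dots> = 8 * (expectation (\<lambda>x. X x ^ 4) + ?m ^ 4)" using assms by (simp add: prob_space)
  finally show "expectation (\<lambda>x. (X x - ?m) ^ 4) \<le> 16 * expectation (\<lambda>x. X x ^ 4)" using m by simp
qed

text \<open>The bound collects three errors: replacing the normalised \<open>T\<close> by the sum
  \<open>S\<close> of centred blocks, replacing each block by a Gaussian of the same variance, and
  correcting the total variance of the blocks to 1. It is quantitative because
  \<open>\<epsilon>\<close> remains fixed while \<open>s\<close> grows.\<close>

lemma char_normalized_bound:
  fixes T :: "'a \<Rightarrow> real" and Z :: "'k \<Rightarrow> 'a \<Rightarrow> real"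
  assumes T[measurable]: "random_variable borel T" "integrable M (\<lambda>x. (T x)\<^sup>2)"
    and s: "0 < s" "variance T = s\<^sup>2" and J: "finite J"
    and Z: "indep_vars (\<lambda>_. borel) Z J" "\<And>k. k \<in> J \<Longrightarrow> integrable M (\<lambda>x. Z k x ^ 4)"
      "\<And>k. k \<in> J \<Longrightarrow> expectation (\<lambda>x. Z k x ^ 4) \<le> B"
    and eps: "0 < \<epsilon>" "variance (\<lambda>x. T x - (\<Sum>k\<in>J. Z k x)) \<le> \<epsilon>\<^sup>2 * s\<^sup>2" and "0 \<le> B"
  shows "cmod (char (distr M borel (\<lambda>x. (T x - expectation T) / s)) \<theta> - complex_of_real (exp (- (\<theta>\<^sup>2 / 2))))
    \<le> \<bar>\<theta>\<bar> * \<epsilon> + \<theta>\<^sup>2 / 2 * (\<epsilon>\<^sup>2 + 2 * \<epsilon>)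
      + real (card J) * (\<bar>\<theta>\<bar> ^ 3 * (1 + 16 * B) / (6 * s ^ 3) + (\<theta>\<^sup>2 * (1 + 16 * B) / (2 * s\<^sup>2))\<^sup>2)"
proof -
  define X where "X x = (T x - expectation T) / s" for x
  define Y where "Y k x = (Z k x - expectation (Z k)) / s" for k x
  define S where "S x = (\<Sum>k\<in>J. Y k x)" for x
  define D where "D x = X x - S x" for x
  define v where "v k = expectation (\<lambda>x. (Y k x)\<^sup>2)" for k
  have Zm: "random_variable borel (Z k)" if "k \<in> J" for k using Z(1) that by (auto simp: indep_vars_def)
  have Xm[measurable]: "random_variable borel X" unfolding X_def by simp
  have Ym: "random_variable borel (Y k)" if "k \<in> J" for k unfolding Y_def using Zm[OF that] by simp
  have Sm[measurable]: "random_variable borel S" unfolding S_def using Ym by simp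
  have Dm[measurable]: "random_variable borel D" unfolding D_def by simp
  have Tint: "integrable M T" by (rule square_integrable_integrable) (use T in auto)
  have Zint: "integrable M (Z k)" if "k \<in> J" for k using power4_integrable_square Zm Z(2) that by blast
  have Y4: "integrable M (\<lambda>x. Y k x ^ 4)" "expectation (\<lambda>x. Y k x ^ 4) \<le> 16 * B / s ^ 4" if k: "k \<in> J" for k
  proof -
    note c = expectation_power4_centered[OF Zm[OF k] Z(2)[OF k]]
    show "integrable M (\<lambda>x. Y k x ^ 4)" unfolding Y_def power_divide using c(1) by simp
    have "expectation (\<lambda>x. Y k x ^ 4) = expectation (\<lambda>x. (Z k x - expectation (Z k)) ^ 4) / s ^ 4"
      unfolding Y_def power_divide by simp
    also have "\<dots> \<le> 16 * B / s ^ 4" using c(2) Z(3)[OF k] s(1) by (intro divide_right_mono) auto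
    finally show "expectation (\<lambda>x. Y k x ^ 4) \<le> 16 * B / s ^ 4" .
  qed
  note Yint = power4_integrable_square[OF Ym Y4(1)]
  have YE: "expectation (Y k) = 0" if "k \<in> J" for k
    unfolding Y_def using Zint[OF that] by (simp add: prob_space)
  have sY: "s * Y k x = Z k x - expectation (Z k)" for k x using s(1) by (simp add: Y_def)
  have Y4s: "integrable M (\<lambda>x. (s * Y k x) ^ 4)" "expectation (\<lambda>x. (s * Y k x) ^ 4) \<le> 16 * B" if k: "k \<in> J" for k
    using expectation_power4_centered[OF Zm[OF k] Z(2)[OF k]] Z(3)[OF k] unfolding sY by auto
  have v0: "0 \<le> v k" for k unfolding v_def by simp
  \<comment> \<open>For the centred but unscaled block \<open>s * Y k\<close>, squares and absolute
    cubes are at most 1 plus the fourth power; this is the origin of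
    \<open>1 + 16 * B\<close>.\<close>
  have vle: "s\<^sup>2 * v k \<le> 1 + 16 * B" if k: "k \<in> J" for k
  proof -
    have "s\<^sup>2 * v k = expectation (\<lambda>x. (s * Y k x)\<^sup>2)" unfolding v_def power_mult_distrib by simp
    also have "\<dots> \<le> expectation (\<lambda>x. 1 + (s * Y k x) ^ 4)"
    proof (rule integral_mono[OF _ _ power2_le_1_power4])
      show "integrable M (\<lambda>x. (s * Y k x)\<^sup>2)" using Yint(1)[OF k k] by (simp add: power_mult_distrib)
    qed (use Y4s(1)[OF k] in simp)
    also have "\<dots> \<le> 1 + 16 * B" using Y4s[OF k] by (simp add: prob_space)
    finally show ?thesis .
  qed
  have y3: "s ^ 3 * expectation (\<lambda>x. \<bar>Y k x\<bar> ^ 3) \<le> 1 + 16 * B" if k: "k \<in> J" for k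
  proof -
    have "s ^ 3 * expectation (\<lambda>x. \<bar>Y k x\<bar> ^ 3) = expectation (\<lambda>x. \<bar>s * Y k x\<bar> ^ 3)"
      using s(1) by (simp add: abs_mult power_mult_distrib)
    also have "\<dots> \<le> expectation (\<lambda>x. 1 + (s * Y k x) ^ 4)"
    proof (rule integral_mono[OF _ _ abs_power3_le_1_power4])
      show "integrable M (\<lambda>x. \<bar>s * Y k x\<bar> ^ 3)" using Yint(3)[OF k k] by (simp add: abs_mult power_mult_distrib)
    qed (use Y4s(1)[OF k] in simp)
    also have "\<dots> \<le> 1 + 16 * B" using Y4s[OF k] by (simp add: prob_space)
    finally show ?thesis .
  qed
  have indY: "indep_vars (\<lambda>_. borel) Y J"
    unfolding Y_def by (rule indep_vars_compose2[OF Z(1), where Y = "\<lambda>k z. (z - expectation (Z k)) / s"]) simp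
  have X2: "integrable M (\<lambda>x. (X x)\<^sup>2)" unfolding X_def power_divide
    using square_integrable_diff[of T "\<lambda>_. expectation T"] T by simp
  have S2: "integrable M (\<lambda>x. (S x)\<^sup>2)" unfolding S_def
    by (rule square_integrable_sum) (use Ym Yint in auto)
  have D2: "integrable M (\<lambda>x. (D x)\<^sup>2)" unfolding D_def
    by (rule square_integrable_diff) (use X2 S2 in auto)
  have EX2: "expectation (\<lambda>x. (X x)\<^sup>2) = 1" unfolding X_def power_divide using s by simp
  have ED2: "expectation (\<lambda>x. (D x)\<^sup>2) \<le> \<epsilon>\<^sup>2"
  proof -
    have e: "expectation (\<lambda>x. T x - (\<Sum>k\<in>J. Z k x)) = expectation T - (\<Sum>k\<in>J. expectation (Z k))"
      using Tint Zint by simp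
    have "D x = ((T x - (\<Sum>k\<in>J. Z k x)) - expectation (\<lambda>x. T x - (\<Sum>k\<in>J. Z k x))) / s" for x
      unfolding e D_def X_def S_def Y_def sum_divide_distrib[symmetric] by (simp add: sum_subtractf diff_divide_distrib)
    then have "expectation (\<lambda>x. (D x)\<^sup>2) = variance (\<lambda>x. T x - (\<Sum>k\<in>J. Z k x)) / s\<^sup>2"
      by (simp add: power_divide)
    also have "\<dots> \<le> \<epsilon>\<^sup>2" using eps(2) s(1) by (simp add: pos_divide_le_eq)
    finally show ?thesis .
  qed
  have D1: "integrable M D" by (rule square_integrable_integrable) (use D2 in auto)
  have EabsD: "expectation (\<lambda>x. \<bar>D x\<bar>) \<le> \<epsilon>"
  proof -
    have "expectation (\<lambda>x. \<bar>D x\<bar>) \<le> expectation (\<lambda>x. (\<epsilon> + (D x)\<^sup>2 / \<epsilon>) / 2)"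
      by (intro integral_mono abs_le_eps_square eps(1)) (use D1 D2 in auto)
    also have "\<dots> = (\<epsilon> + expectation (\<lambda>x. (D x)\<^sup>2) / \<epsilon>) / 2" using D2 by (simp add: prob_space)
    also have "\<dots> \<le> \<epsilon>" using ED2 eps(1) by (simp add: field_simps power2_eq_square)
    finally show ?thesis .
  qed
  have ch: "char (distr M borel W) \<theta> = (CLINT x|M. iexp (\<theta> * W x))"
    if [measurable]: "random_variable borel W" for W
    unfolding char_def by (subst integral_distr) auto
  have ie: "integrable M (\<lambda>x. iexp (\<theta> * W x))" if [measurable]: "random_variable borel W" for W
    by (rule integrable_const_bound[of _ 1]) auto
  \<comment> \<open>First error: E|D| \<le> \<open>\<epsilon>\<close>, and the exponential is
    Lipschitz.\<close>
  have step1: "cmod (char (distr M borel X) \<theta> - char (distr M borel S) \<theta>) \<le> \<bar>\<theta>\<bar> * \<epsilon>"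
  proof -
    have "cmod (char (distr M borel X) \<theta> - char (distr M borel S) \<theta>)
        = cmod (CLINT x|M. iexp (\<theta> * X x) - iexp (\<theta> * S x))"
      unfolding ch[OF Xm] ch[OF Sm]
      by (subst Bochner_Integration.integral_diff[OF ie[OF Xm] ie[OF Sm]]) (rule refl)
    also have "\<dots> \<le> expectation (\<lambda>x. cmod (iexp (\<theta> * X x) - iexp (\<theta> * S x)))"
      by (rule integral_norm_bound)
    also have "\<dots> \<le> expectation (\<lambda>x. \<bar>\<theta>\<bar> * \<bar>D x\<bar>)"
    proof (rule integral_mono)
      show "integrable M (\<lambda>x. cmod (iexp (\<theta> * X x) - iexp (\<theta> * S x)))"
        by (intro integrable_norm Bochner_Integration.integrable_diff ie Xm Sm)
      show "integrable M (\<lambda>x. \<bar>\<theta>\<bar> * \<bar>D x\<bar>)" using D1 by simp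
      show "cmod (iexp (\<theta> * X x) - iexp (\<theta> * S x)) \<le> \<bar>\<theta>\<bar> * \<bar>D x\<bar>" for x
        using cmod_iexp_diff_le[of "\<theta> * X x" "\<theta> * S x"]
        by (simp add: D_def abs_mult[symmetric] right_diff_distrib)
    qed
    also have "\<dots> \<le> \<bar>\<theta>\<bar> * \<epsilon>" using EabsD by (simp add: mult_left_mono)
    finally show ?thesis .
  qed
  \<comment> \<open>Second error, Lyapunov's argument: the factors have modulus at most 1, so
    products differ by at most the sum of the differences of their factors.\<close>
  have step2: "cmod (char (distr M borel S) \<theta> - (\<Prod>k\<in>J. complex_of_real (exp (- (\<theta>\<^sup>2 * v k / 2)))))
      \<le> real (card J) * (\<bar>\<theta>\<bar> ^ 3 * (1 + 16 * B) / (6 * s ^ 3) + (\<theta>\<^sup>2 * (1 + 16 * B) / (2 * s\<^sup>2))\<^sup>2)"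
  proof -
    have "char (distr M borel S) \<theta> = (\<Prod>k\<in>J. char (distr M borel (Y k)) \<theta>)"
      unfolding S_def by (rule char_distr_sum[OF indY])
    also have "cmod (\<dots> - (\<Prod>k\<in>J. complex_of_real (exp (- (\<theta>\<^sup>2 * v k / 2)))))
      \<le> (\<Sum>k\<in>J. cmod (char (distr M borel (Y k)) \<theta> - complex_of_real (exp (- (\<theta>\<^sup>2 * v k / 2)))))"
    proof (rule norm_prod_diff)
      fix k assume k: "k \<in> J"
      interpret Yk: real_distribution "distr M borel (Y k)" by (rule real_distribution_distr) (rule Ym[OF k])
      show "cmod (char (distr M borel (Y k)) \<theta>) \<le> 1" by (rule Yk.cmod_char_le_1)
      show "cmod (complex_of_real (exp (- (\<theta>\<^sup>2 * v k / 2)))) \<le> 1"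
        using v0[of k] by (simp add: norm_of_real)
    qed
    also have "\<dots> \<le> (\<Sum>k\<in>J. \<bar>\<theta>\<bar> ^ 3 * (1 + 16 * B) / (6 * s ^ 3) + (\<theta>\<^sup>2 * (1 + 16 * B) / (2 * s\<^sup>2))\<^sup>2)"
    proof (rule sum_mono)
      fix k assume k: "k \<in> J"
      have var: "variance (Y k) = v k" unfolding v_def using YE[OF k] by simp
      have "cmod (char (distr M borel (Y k)) \<theta> - (1 - \<theta>\<^sup>2 * v k / 2))
          \<le> \<theta>\<^sup>2 / 6 * expectation (\<lambda>x. min (6 * (Y k x)\<^sup>2) (\<bar>\<theta>\<bar> * \<bar>Y k x\<bar> ^ 3))"
        by (rule char_approx3'[OF Ym[OF k] Yint(2)[OF k k] Yint(1)[OF k k] YE[OF k] var refl])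
      also have "\<dots> \<le> \<theta>\<^sup>2 / 6 * expectation (\<lambda>x. \<bar>\<theta>\<bar> * \<bar>Y k x\<bar> ^ 3)"
      proof (rule mult_left_mono[OF integral_mono])
        show "integrable M (\<lambda>x. min (6 * (Y k x)\<^sup>2) (\<bar>\<theta>\<bar> * \<bar>Y k x\<bar> ^ 3))"
          using Yint[OF k k] by (intro integrable_min) auto
      qed (use Yint[OF k k] in auto)
      also have "\<dots> = \<bar>\<theta>\<bar> ^ 3 * (s ^ 3 * expectation (\<lambda>x. \<bar>Y k x\<bar> ^ 3)) / (6 * s ^ 3)"
        using s(1) by (simp add: power3_eq_cube power2_eq_square mult_ac abs_mult_self_eq)
      also have "\<dots> \<le> \<bar>\<theta>\<bar> ^ 3 * (1 + 16 * B) / (6 * s ^ 3)"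
        using y3[OF k] s(1) by (intro divide_right_mono mult_left_mono) auto
      finally have 1: "cmod (char (distr M borel (Y k)) \<theta> - (1 - \<theta>\<^sup>2 * v k / 2)) \<le> \<bar>\<theta>\<bar> ^ 3 * (1 + 16 * B) / (6 * s ^ 3)" .
      have "\<bar>exp (- (\<theta>\<^sup>2 * v k / 2)) - (1 - \<theta>\<^sup>2 * v k / 2)\<bar> \<le> (\<theta>\<^sup>2 * v k / 2)\<^sup>2"
        by (rule exp_minus_taylor) (simp add: v0)
      also have "\<dots> \<le> (\<theta>\<^sup>2 * (1 + 16 * B) / (2 * s\<^sup>2))\<^sup>2"
      proof (rule power_mono)
        have "v k \<le> (1 + 16 * B) / s\<^sup>2" using vle[OF k] s(1) by (simp add: pos_le_divide_eq mult.commute)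
        then have "\<theta>\<^sup>2 / 2 * v k \<le> \<theta>\<^sup>2 / 2 * ((1 + 16 * B) / s\<^sup>2)" by (intro mult_left_mono) auto
        then show "\<theta>\<^sup>2 * v k / 2 \<le> \<theta>\<^sup>2 * (1 + 16 * B) / (2 * s\<^sup>2)" by simp
      qed (simp add: v0)
      finally have 2: "cmod (complex_of_real (exp (- (\<theta>\<^sup>2 * v k / 2))) - complex_of_real (1 - \<theta>\<^sup>2 * v k / 2))
        \<le> (\<theta>\<^sup>2 * (1 + 16 * B) / (2 * s\<^sup>2))\<^sup>2"
        unfolding of_real_diff[symmetric] norm_of_real .
      show "cmod (char (distr M borel (Y k)) \<theta> - complex_of_real (exp (- (\<theta>\<^sup>2 * v k / 2))))
        \<le> \<bar>\<theta>\<bar> ^ 3 * (1 + 16 * B) / (6 * s ^ 3) + (\<theta>\<^sup>2 * (1 + 16 * B) / (2 * s\<^sup>2))\<^sup>2"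
        using norm_triangle_ineq4[of "char (distr M borel (Y k)) \<theta> - complex_of_real (1 - \<theta>\<^sup>2 * v k / 2)"
          "complex_of_real (exp (- (\<theta>\<^sup>2 * v k / 2))) - complex_of_real (1 - \<theta>\<^sup>2 * v k / 2)"] 1 2
        by simp
    qed
    finally show ?thesis by simp
  qed
  \<comment> \<open>Third error: uncorrelated blocks make the total variance E(S^2), and S = X - D
    with E(X^2) = 1 and E(D^2) \<le> \<open>\<epsilon>\<^sup>2\<close>.\<close>
  have step3: "cmod ((\<Prod>k\<in>J. complex_of_real (exp (- (\<theta>\<^sup>2 * v k / 2)))) - complex_of_real (exp (- (\<theta>\<^sup>2 / 2))))
      \<le> \<theta>\<^sup>2 / 2 * (\<epsilon>\<^sup>2 + 2 * \<epsilon>)"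
  proof -
    have ES2: "expectation (\<lambda>x. (S x)\<^sup>2) = (\<Sum>k\<in>J. v k)" unfolding S_def v_def
    proof (rule expectation_square_sum_uncorrelated[OF J Ym])
      fix k l assume kl: "k \<in> J" "l \<in> J" "k \<noteq> l"
      have "indep_var (PiM {k} (\<lambda>_. borel)) (\<lambda>x. restrict (\<lambda>i. Y i x) {k}) (PiM {l} (\<lambda>_. borel)) (\<lambda>x. restrict (\<lambda>i. Y i x) {l})"
        using kl by (intro indep_var_restrict[OF indY]) auto
      then have "indep_var borel ((\<lambda>v. v k) \<circ> (\<lambda>x. restrict (\<lambda>i. Y i x) {k})) borel ((\<lambda>v. v l) \<circ> (\<lambda>x. restrict (\<lambda>i. Y i x) {l}))"
        by (rule indep_var_compose) measurable
      then have "indep_var borel (Y k) borel (Y l)" by (simp add: comp_def)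
      then show "expectation (\<lambda>x. Y k x * Y l x) = 0"
        using indep_var_lebesgue_integral[of "Y k" "Y l"] Yint(2) YE kl by simp
    qed (use Yint in auto)
    have "\<bar>(\<Sum>k\<in>J. v k) - 1\<bar> \<le> \<epsilon>\<^sup>2 + 2 * \<epsilon>"
    proof -
      have XD: "integrable M (\<lambda>x. X x * D x)" by (rule square_integrable_mult) (use X2 D2 in auto)
      have "(\<Sum>k\<in>J. v k) = expectation (\<lambda>x. (X x)\<^sup>2 + (D x)\<^sup>2 - 2 * (X x * D x))"
        unfolding ES2[symmetric] by (intro Bochner_Integration.integral_cong refl) (simp add: D_def power2_eq_square algebra_simps)
      also have "\<dots> = 1 + expectation (\<lambda>x. (D x)\<^sup>2) - 2 * expectation (\<lambda>x. X x * D x)"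
        using X2 D2 XD EX2 by simp
      finally have 1: "(\<Sum>k\<in>J. v k) - 1 = expectation (\<lambda>x. (D x)\<^sup>2) - 2 * expectation (\<lambda>x. X x * D x)" by simp
      have "\<bar>expectation (\<lambda>x. X x * D x)\<bar> \<le> expectation (\<lambda>x. \<bar>X x * D x\<bar>)" by (rule integral_abs_bound)
      also have "\<dots> \<le> expectation (\<lambda>x. (\<epsilon> * (X x)\<^sup>2 + (D x)\<^sup>2 / \<epsilon>) / 2)"
      proof (rule integral_mono)
        fix x
        have "0 \<le> (\<epsilon> * \<bar>X x\<bar> - \<bar>D x\<bar>)\<^sup>2" by simp
        then have "2 * \<epsilon> * \<bar>X x * D x\<bar> \<le> \<epsilon>\<^sup>2 * (X x)\<^sup>2 + (D x)\<^sup>2"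
          by (simp add: power2_diff power_mult_distrib abs_mult mult_ac)
        then show "\<bar>X x * D x\<bar> \<le> (\<epsilon> * (X x)\<^sup>2 + (D x)\<^sup>2 / \<epsilon>) / 2"
          using eps(1) by (simp add: field_simps power2_eq_square)
      qed (use XD X2 D2 in auto)
      also have "\<dots> = (\<epsilon> + expectation (\<lambda>x. (D x)\<^sup>2) / \<epsilon>) / 2" using X2 D2 EX2 by simp
      also have "\<dots> \<le> \<epsilon>" using ED2 eps(1) by (simp add: field_simps power2_eq_square)
      finally have "\<bar>expectation (\<lambda>x. X x * D x)\<bar> \<le> \<epsilon>" .
      moreover have "0 \<le> expectation (\<lambda>x. (D x)\<^sup>2)" by simp
      ultimately show ?thesis using 1 ED2 by linarith
    qed
    moreover have "\<bar>exp (- (\<theta>\<^sup>2 * (\<Sum>k\<in>J. v k) / 2)) - exp (- (\<theta>\<^sup>2 / 2))\<bar> \<le> \<bar>\<theta>\<^sup>2 * (\<Sum>k\<in>J. v k) / 2 - \<theta>\<^sup>2 / 2\<bar>"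
      by (rule exp_minus_lipschitz) (auto intro!: mult_nonneg_nonneg sum_nonneg v0)
    moreover have "\<bar>\<theta>\<^sup>2 * (\<Sum>k\<in>J. v k) / 2 - \<theta>\<^sup>2 / 2\<bar> = \<theta>\<^sup>2 / 2 * \<bar>(\<Sum>k\<in>J. v k) - 1\<bar>"
    proof -
      have "\<theta>\<^sup>2 * (\<Sum>k\<in>J. v k) / 2 - \<theta>\<^sup>2 / 2 = \<theta>\<^sup>2 / 2 * ((\<Sum>k\<in>J. v k) - 1)" by (simp add: algebra_simps)
      then show ?thesis by (simp only: abs_mult) simp
    qed
    ultimately have "\<bar>exp (- (\<theta>\<^sup>2 * (\<Sum>k\<in>J. v k) / 2)) - exp (- (\<theta>\<^sup>2 / 2))\<bar> \<le> \<theta>\<^sup>2 / 2 * (\<epsilon>\<^sup>2 + 2 * \<epsilon>)"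
      by (smt (verit) mult_left_mono zero_le_power2 divide_nonneg_nonneg)
    moreover have "(\<Prod>k\<in>J. complex_of_real (exp (- (\<theta>\<^sup>2 * v k / 2)))) = complex_of_real (exp (- (\<theta>\<^sup>2 * (\<Sum>k\<in>J. v k) / 2)))"
      unfolding of_real_prod[symmetric] using J
      by (simp only: exp_sum[symmetric] sum_negf sum_divide_distrib sum_distrib_left)
    ultimately show ?thesis unfolding of_real_diff[symmetric] by (simp only: norm_of_real of_real_diff[symmetric])
  qed
  have "cmod (char (distr M borel X) \<theta> - complex_of_real (exp (- (\<theta>\<^sup>2 / 2)))) \<le>
      cmod (char (distr M borel X) \<theta> - char (distr M borel S) \<theta>) +
      (cmod (char (distr M borel S) \<theta> - (\<Prod>k\<in>J. complex_of_real (exp (- (\<theta>\<^sup>2 * v k / 2))))) +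
       cmod ((\<Prod>k\<in>J. complex_of_real (exp (- (\<theta>\<^sup>2 * v k / 2)))) - complex_of_real (exp (- (\<theta>\<^sup>2 / 2)))))"
    by (rule norm_diff_triangle_le[OF order_refl norm_diff_triangle_le[OF order_refl order_refl]])
  with step1 step2 step3 show ?thesis unfolding X_def by simp
qed

text \<open>\<open>B\<close> and \<open>C\<close> may depend on \<open>\<epsilon>\<close> but not on
  \<open>n\<close>. This permits blocks whose length grows as the required precision increases,
  while for each precision the growing variance removes the Lyapunov error.\<close>

theorem clt_of_block_approximation:
  fixes T :: "nat \<Rightarrow> 'a \<Rightarrow> real"
  assumes T: "\<And>n. random_variable borel (T n)" "\<And>n. integrable M (\<lambda>x. (T n x)\<^sup>2)"
    and var_inf: "filterlim (\<lambda>n. variance (T n)) at_top sequentially"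
    and approx: "\<And>\<epsilon>. 0 < \<epsilon> \<Longrightarrow> \<exists>B\<ge>0. \<exists>C\<ge>0. \<forall>\<^sub>F n in sequentially. \<exists>J (Z :: nat \<Rightarrow> 'a \<Rightarrow> real).
      finite J \<and> indep_vars (\<lambda>_. borel) Z J \<and>
      (\<forall>k\<in>J. integrable M (\<lambda>x. Z k x ^ 4) \<and> expectation (\<lambda>x. Z k x ^ 4) \<le> B) \<and>
      real (card J) \<le> C * variance (T n) \<and>
      variance (\<lambda>x. T n x - (\<Sum>k\<in>J. Z k x)) \<le> \<epsilon>\<^sup>2 * variance (T n)"
  shows "weak_conv_m (\<lambda>n. distr M borel (\<lambda>x. (T n x - expectation (T n)) / sqrt (variance (T n))))
    std_normal_distribution"
proof (rule levy_continuity)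
  show "real_distribution (distr M borel (\<lambda>x. (T n x - expectation (T n)) / sqrt (variance (T n))))" for n
    using T(1)[of n] by (intro real_distribution_distr) simp
  show "real_distribution std_normal_distribution" by (rule real_dist_normal_dist)
  fix \<theta> :: real
  define s where "s n = sqrt (variance (T n))" for n
  have s_inf: "filterlim s at_top sequentially"
    unfolding s_def by (rule filterlim_compose[OF sqrt_at_top var_inf])
  show "(\<lambda>n. char (distr M borel (\<lambda>x. (T n x - expectation (T n)) / sqrt (variance (T n)))) \<theta>)
      \<longlonglongrightarrow> char std_normal_distribution \<theta>"
    unfolding s_def[symmetric] char_std_normal_distribution
  proof (rule tendstoI)
    fix \<kappa> :: real assume \<kappa>: "0 < \<kappa>"
    \<comment> \<open>First fix the precision so that the errors not decreasing in \<open>n\<close>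
      stay below half of \<open>\<kappa>\<close>.\<close>
    have "((\<lambda>\<epsilon>. \<bar>\<theta>\<bar> * \<epsilon> + \<theta>\<^sup>2 / 2 * (\<epsilon>\<^sup>2 + 2 * \<epsilon>)) \<longlongrightarrow> \<bar>\<theta>\<bar> * 0 + \<theta>\<^sup>2 / 2 * (0\<^sup>2 + 2 * 0)) (at_right 0)"
      by (intro tendsto_intros)
    then have "\<forall>\<^sub>F \<epsilon> in at_right 0. \<bar>\<theta>\<bar> * \<epsilon> + \<theta>\<^sup>2 / 2 * (\<epsilon>\<^sup>2 + 2 * \<epsilon>) < \<kappa> / 2"
      using \<kappa> by (intro order_tendstoD) auto
    moreover have "\<forall>\<^sub>F \<epsilon> in at_right (0::real). 0 < \<epsilon>" by (simp add: eventually_at_right_less)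
    ultimately have "\<forall>\<^sub>F \<epsilon> in at_right (0::real). 0 < \<epsilon> \<and> \<bar>\<theta>\<bar> * \<epsilon> + \<theta>\<^sup>2 / 2 * (\<epsilon>\<^sup>2 + 2 * \<epsilon>) < \<kappa> / 2"
      by eventually_elim auto
    then obtain \<epsilon> where \<epsilon>: "0 < \<epsilon>" "\<bar>\<theta>\<bar> * \<epsilon> + \<theta>\<^sup>2 / 2 * (\<epsilon>\<^sup>2 + 2 * \<epsilon>) < \<kappa> / 2"
      using eventually_happens'[OF trivial_limit_at_right_real] by blast
    from approx[OF \<epsilon>(1)] obtain B C where BC: "0 \<le> B" "0 \<le> C" and
      ev: "\<forall>\<^sub>F n in sequentially. \<exists>J (Z :: nat \<Rightarrow> 'a \<Rightarrow> real).
      finite J \<and> indep_vars (\<lambda>_. borel) Z J \<and>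
      (\<forall>k\<in>J. integrable M (\<lambda>x. Z k x ^ 4) \<and> expectation (\<lambda>x. Z k x ^ 4) \<le> B) \<and>
      real (card J) \<le> C * variance (T n) \<and>
      variance (\<lambda>x. T n x - (\<Sum>k\<in>J. Z k x)) \<le> \<epsilon>\<^sup>2 * variance (T n)" by blast
    \<comment> \<open>The Lyapunov error: at most C s^2 blocks, each contributing terms of order
      s^(-3) and s^(-4).\<close>
    define K where "K n = C * (\<bar>\<theta>\<bar> ^ 3 * (1 + 16 * B) / 6) * inverse (s n) + C * (\<theta>\<^sup>2 * (1 + 16 * B) / 2)\<^sup>2 * (inverse (s n) * inverse (s n))" for n
    have inv: "(\<lambda>n. inverse (s n)) \<longlonglongrightarrow> 0"
      by (rule tendsto_inverse_0_at_top[OF s_inf])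
    have "K \<longlonglongrightarrow> C * (\<bar>\<theta>\<bar> ^ 3 * (1 + 16 * B) / 6) * 0 + C * (\<theta>\<^sup>2 * (1 + 16 * B) / 2)\<^sup>2 * (0 * 0)"
      unfolding K_def by (intro tendsto_intros inv)
    then have "\<forall>\<^sub>F n in sequentially. K n < \<kappa> / 2" using \<kappa> by (intro order_tendstoD) auto
    moreover have "\<forall>\<^sub>F n in sequentially. 0 < s n"
      using s_inf by (simp add: filterlim_at_top_dense)
    ultimately show "\<forall>\<^sub>F n in sequentially.
        dist (char (distr M borel (\<lambda>x. (T n x - expectation (T n)) / s n)) \<theta>) (complex_of_real (exp (- (\<theta>\<^sup>2) / 2))) < \<kappa>"
      using ev
    proof eventually_elim
      case (elim n)
      then obtain J and Z :: "nat \<Rightarrow> 'a \<Rightarrow> real" where JZ: "finite J" "indep_vars (\<lambda>_. borel) Z J"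
        "\<And>k. k \<in> J \<Longrightarrow> integrable M (\<lambda>x. Z k x ^ 4)" "\<And>k. k \<in> J \<Longrightarrow> expectation (\<lambda>x. Z k x ^ 4) \<le> B"
        "real (card J) \<le> C * variance (T n)"
        "variance (\<lambda>x. T n x - (\<Sum>k\<in>J. Z k x)) \<le> \<epsilon>\<^sup>2 * variance (T n)" by blast
      have s2: "variance (T n) = (s n)\<^sup>2" unfolding s_def by (simp add: variance_positive)
      let ?R = "\<bar>\<theta>\<bar> ^ 3 * (1 + 16 * B) / (6 * s n ^ 3) + (\<theta>\<^sup>2 * (1 + 16 * B) / (2 * (s n)\<^sup>2))\<^sup>2"
      have "cmod (char (distr M borel (\<lambda>x. (T n x - expectation (T n)) / s n)) \<theta> - complex_of_real (exp (- (\<theta>\<^sup>2 / 2))))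
        \<le> \<bar>\<theta>\<bar> * \<epsilon> + \<theta>\<^sup>2 / 2 * (\<epsilon>\<^sup>2 + 2 * \<epsilon>) + real (card J) * ?R"
        by (rule char_normalized_bound[where T = "T n" and s = "s n", OF T(1) T(2) elim(2) s2 JZ(1-4) \<epsilon>(1) _ BC(1)]) (use JZ(6) s2 in auto)
      also have "real (card J) * ?R \<le> C * (s n)\<^sup>2 * ?R"
        using JZ(5) s2 elim(2) BC(1) by (intro mult_right_mono) auto
      also have "C * (s n)\<^sup>2 * ?R = K n"
        using elim(2) unfolding K_def by (simp add: field_simps power2_eq_square power3_eq_cube)
      finally show ?case using elim(1) \<epsilon>(2) by (simp add: dist_norm)
    qed
  qed
qed

end

section \<open>Random weights and exponential tails\<close>

text \<open>The Cauchy-Schwarz inequality twice, first for the sum and then for the sum of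
  squares.\<close>

lemma sum_power4_le:
  fixes x :: "'i \<Rightarrow> real"
  shows "(\<Sum>i\<in>A. x i) ^ 4 \<le> real (card A) ^ 3 * (\<Sum>i\<in>A. x i ^ 4)"
proof -
  have "((\<Sum>i\<in>A. x i)\<^sup>2)\<^sup>2 \<le> ((\<Sum>i\<in>A. (x i)\<^sup>2) * card A)\<^sup>2"
    by (rule power_mono[OF sum_squared_le_sum_of_squares]) simp
  also have "\<dots> = (\<Sum>i\<in>A. (x i)\<^sup>2)\<^sup>2 * (real (card A))\<^sup>2" by (rule power_mult_distrib)
  also have "\<dots> \<le> ((\<Sum>i\<in>A. ((x i)\<^sup>2)\<^sup>2) * card A) * (real (card A))\<^sup>2"
    by (rule mult_right_mono[OF sum_squared_le_sum_of_squares]) simp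
  finally show ?thesis by (simp add: power2_eq_square power3_eq_cube eval_nat_numeral mult_ac)
qed

lemma depends_on_predI:
  assumes "\<And>w w'. (\<And>i. i \<in> A \<Longrightarrow> w i = w' i) \<Longrightarrow> p w \<Longrightarrow> p w'"
  shows "depends_on A p"
proof -
  have "p w = p w'" if "\<forall>i\<in>A. w i = w' i" for w w'
    using assms[of w w'] assms[of w' w] that by auto
  then show ?thesis unfolding depends_on_def by blast
qed

lemma passage_time_measurable:
  assumes "\<And>e. e \<in> E f \<Longrightarrow> W e \<in> borel_measurable M" "is_path f g"
  shows "(\<lambda>\<omega>. passage_time (\<lambda>e. W e \<omega>) g) \<in> borel_measurable M"
proof -
  have "(\<lambda>\<omega>. sum_list (map (\<lambda>e. W e \<omega>) es)) \<in> borel_measurable M" if "set es \<subseteq> E f" for es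
    using that by (induction es) (auto intro!: assms(1) borel_measurable_add)
  then show ?thesis using assms(2) unfolding passage_time_def is_path_def by blast
qed

text \<open>Vertices and lists of vertices are countable, so the nested infima run over countable
  families.\<close>

lemma T_pt_set_measurable:
  assumes "\<And>e. e \<in> E f \<Longrightarrow> W e \<in> borel_measurable M"
  shows "(\<lambda>\<omega>. T_pt_set f (\<lambda>e. W e \<omega>) x S) \<in> borel_measurable M"
  unfolding T_pt_set_def T_pt_pt_def
  by (intro borel_measurable_cINF_real passage_time_measurable[of f] assms) auto

lemma T_set_set_measurable:
  assumes "\<And>e. e \<in> E f \<Longrightarrow> W e \<in> borel_measurable M"
  shows "(\<lambda>\<omega>. T_set_set f (\<lambda>e. W e \<omega>) S S') \<in> borel_measurable M"
  unfolding T_set_set_def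
  by (intro borel_measurable_cINF_real T_pt_set_measurable assms) auto

lemma column_time_measurable:
  assumes "\<And>e. e \<in> E f \<Longrightarrow> W e \<in> borel_measurable M"
  shows "(\<lambda>\<omega>. column_time f a b (\<lambda>e. W e \<omega>)) \<in> borel_measurable M"
  unfolding column_time_def by (rule T_set_set_measurable) (rule assms)

lemma open_crossing_measurable:
  assumes "\<And>e. e \<in> E f \<Longrightarrow> W e \<in> borel_measurable M"
  shows "Measurable.pred M (\<lambda>\<omega>. open_crossing f u u' (\<lambda>e. W e \<omega>))"
proof -
  have "Measurable.pred M (\<lambda>\<omega>. walk f (c, h) (d, 0) g \<and> (c, h + 1) \<notin> V f \<and>
     (\<forall>v\<in>set g. u \<le> fst v \<and> fst v \<le> u') \<and> open_path (\<lambda>e. W e \<omega>) g)" for g c h d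
  proof (cases "walk f (c, h) (d, 0) g")
    case True
    then have "W e \<in> borel_measurable M" if "e \<in> set (path_edges g)" for e
      using that assms walkD(3) by blast
    then have "Measurable.pred M (\<lambda>\<omega>. \<forall>e\<in>set (path_edges g). W e \<omega> = 0)"
      by (intro pred_intros_finite) (auto intro!: borel_measurable_eq)
    then show ?thesis unfolding open_path_def by measurable
  qed simp
  then show ?thesis unfolding open_crossing_def by (intro pred_intros_countable)
qed

lemma passage_ball_measurable:
  assumes "\<And>e. e \<in> E f \<Longrightarrow> W e \<in> borel_measurable M"
  shows "Measurable.pred M (\<lambda>\<omega>. passage_ball f a b (\<lambda>e. W e \<omega>) \<rho> = U)"
proof -
  have "Measurable.pred M (\<lambda>\<omega>. walk f y x g \<and> fst y = a \<and> set (path_edges g) \<subseteq> slab f a b \<and>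
      passage_time (\<lambda>e. W e \<omega>) g \<le> \<rho>)" for x y g
  proof (cases "walk f y x g")
    case True
    then have [measurable]: "(\<lambda>\<omega>. passage_time (\<lambda>e. W e \<omega>) g) \<in> borel_measurable M"
      by (intro passage_time_measurable[of f] assms) (auto simp: walk_def)
    show ?thesis by measurable
  qed simp
  then have "Measurable.pred M (\<lambda>\<omega>. x \<in> passage_ball f a b (\<lambda>e. W e \<omega>) \<rho>)" for x
    unfolding passage_ball_def mem_Collect_eq by (intro pred_intros_countable)
  then have "Measurable.pred M (\<lambda>\<omega>. \<forall>x. x \<in> passage_ball f a b (\<lambda>e. W e \<omega>) \<rho> \<longleftrightarrow> x \<in> U)"
    by (intro pred_intros_countable pred_intros_logic) auto
  then show ?thesis unfolding set_eq_iff .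
qed

text \<open>\<open>F\<close> has no mass below 0 or on the interval from 0 (excluded) to
  \<open>\<delta>\<close>, so \<open>weight \<delta> x = x\<close> almost surely. The truncation
  makes nonnegativity and the gap hold everywhere, which removes null sets from the combinatorial
  arguments.\<close>

definition weight :: "real \<Rightarrow> real \<Rightarrow> real" where
  "weight \<delta> x = (if x \<le> 0 then 0 else max \<delta> x)"

text \<open>A coupling: Bernoulli weights as a function of the weights of law \<open>F\<close>, with
  the same open edges. The laws of \<open>t\<close> and of this family agree, and A1 to A3 involve
  only the law.\<close>

definition bern :: "real \<Rightarrow> real" where
  "bern x = (if x \<le> 0 then 0 else 1)"

lemma weight_measurable [measurable]: "weight \<delta> \<in> borel_measurable borel"
  unfolding weight_def[abs_def] by measurable

lemma bern_measurable [measurable]: "bern \<in> borel_measurable borel"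
  unfolding bern_def[abs_def] by measurable

lemma bern_01: "bern x \<in> {0, 1}" by (simp add: bern_def)
lemma bern_nonneg: "0 \<le> bern x" by (simp add: bern_def)
lemma bern_le_1: "bern x \<le> 1" by (simp add: bern_def)

lemma (in wedge) column_time_depends_on:
  assumes "\<And>x. 0 \<le> h x" "0 \<le> a" "a \<le> b"
  shows "depends_on (slab f a b) (\<lambda>w. column_time f a b (\<lambda>e. h (w e)))"
  unfolding depends_on_def by (auto intro!: column_time_cong assms)

lemma open_crossing_depends_on:
  "depends_on (slab f u (u' + 1)) (\<lambda>w. open_crossing f u u' (\<lambda>e. h (w e)))"
proof (rule depends_on_predI)
  fix w w' :: "edge \<Rightarrow> 'a"
  assume eq: "\<And>e. e \<in> slab f u (u' + 1) \<Longrightarrow> w e = w' e" and cr: "open_crossing f u u' (\<lambda>e. h (w e))"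
  show "open_crossing f u u' (\<lambda>e. h (w' e))"
  proof (rule open_crossing_mono[OF cr])
    fix e assume e: "e \<in> E f" "e \<subseteq> {u..u'} \<times> UNIV" "h (w e) = 0"
    obtain s t where "e = {s, t}" using e(1) E_obtain by metis
    then have "e \<in> slab f u (u' + 1)" using e by (cases s; cases t) (auto simp: slab_def left_end_pair)
    then show "h (w' e) = 0" using eq e(3) by simp
  qed
qed

section \<open>The coupled model on the product space\<close>

locale fpp_model = wedge f + iid_product lattice_edges \<nu> for f :: "real \<Rightarrow> real" and \<nu> :: "real measure" +
  fixes \<delta> :: real
  assumes delta_pos: "0 < \<delta>"
    and closed_prob: "measure \<nu> {..0} < 1"
    and moment: "integrable \<nu> (\<lambda>x. weight \<delta> x ^ 4)"
begin

lemma weight_nonneg: "0 \<le> weight \<delta> x"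
  using delta_pos unfolding weight_def by (auto simp: max_def)

lemma weight_ge_bern: "\<delta> * bern x \<le> weight \<delta> x" by (simp add: weight_def bern_def)

lemma slab_lattice: "slab f a b \<subseteq> lattice_edges" by (auto simp: slab_def E_def)

lemma E_coordinate_measurable: "e \<in> E f \<Longrightarrow> (\<lambda>w. w e) \<in> borel_measurable Q"
  by (rule coordinate_measurable) (simp add: E_def)

text \<open>\<open>C\<close> is the passage time with law \<open>F\<close>, \<open>N\<close> the
  Bernoulli one, in the same environment.\<close>

definition C :: "int \<Rightarrow> int \<Rightarrow> (edge \<Rightarrow> real) \<Rightarrow> real" where
  "C a b w = column_time f a b (\<lambda>e. weight \<delta> (w e))"

definition N :: "int \<Rightarrow> int \<Rightarrow> (edge \<Rightarrow> real) \<Rightarrow> real" where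
  "N a b w = column_time f a b (\<lambda>e. bern (w e))"

lemma C_measurable [measurable]: "C a b \<in> borel_measurable Q"
  unfolding C_def[abs_def]
  by (rule column_time_measurable[where W = "\<lambda>e w. weight \<delta> (w e)"])
     (rule measurable_compose[OF E_coordinate_measurable weight_measurable])

lemma N_measurable [measurable]: "N a b \<in> borel_measurable Q"
  unfolding N_def[abs_def]
  by (rule column_time_measurable[where W = "\<lambda>e w. bern (w e)"])
     (rule measurable_compose[OF E_coordinate_measurable bern_measurable])

lemma C_depends_on: "0 \<le> a \<Longrightarrow> a \<le> b \<Longrightarrow> depends_on (slab f a b) (C a b)"
  unfolding C_def[abs_def] by (rule column_time_depends_on[where h = "weight \<delta>"]) (simp_all add: weight_nonneg)

lemma C_nonneg: "0 \<le> a \<Longrightarrow> 0 \<le> b \<Longrightarrow> 0 \<le> C a b w"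
  unfolding C_def by (rule column_time_nonneg[where w = "\<lambda>e. weight \<delta> (w e)"]) (simp_all add: weight_nonneg)

lemma N_nonneg: "0 \<le> a \<Longrightarrow> 0 \<le> b \<Longrightarrow> 0 \<le> N a b w"
  unfolding N_def by (rule column_time_nonneg[where w = "\<lambda>e. bern (w e)"]) (simp_all add: bern_nonneg)

lemma C_superadd: "0 \<le> a \<Longrightarrow> a \<le> b \<Longrightarrow> b \<le> c \<Longrightarrow> C a b w + C b c w \<le> C a c w"
  unfolding C_def by (rule column_time_superadd[where w = "\<lambda>e. weight \<delta> (w e)"]) (simp_all add: weight_nonneg)

lemma N_superadd: "0 \<le> a \<Longrightarrow> a \<le> b \<Longrightarrow> b \<le> c \<Longrightarrow> N a b w + N b c w \<le> N a c w"
  unfolding N_def by (rule column_time_superadd[where w = "\<lambda>e. bern (w e)"]) (simp_all add: bern_nonneg)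

lemma C_mono_columns: "0 \<le> a \<Longrightarrow> a \<le> a' \<Longrightarrow> a' \<le> b' \<Longrightarrow> b' \<le> b \<Longrightarrow> C a' b' w \<le> C a b w"
  unfolding C_def by (rule column_time_mono_columns[where w = "\<lambda>e. weight \<delta> (w e)"]) (simp_all add: weight_nonneg)

lemma C_ge_N:
  assumes "0 \<le> a" "a \<le> b"
  shows "\<delta> * N a b w \<le> C a b w"
  unfolding C_def
proof (rule column_time_ge)
  fix x y g assume *: "fst x = a" "fst y = b" "walk f x y g"
  have "N a b w \<le> passage_time (\<lambda>e. bern (w e)) g"
    unfolding N_def by (rule column_time_le[where w = "\<lambda>e. bern (w e)", OF _ *(3,1,2)]) (rule bern_nonneg)
  then have "\<delta> * N a b w \<le> \<delta> * passage_time (\<lambda>e. bern (w e)) g" using delta_pos by simp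
  also have "\<dots> = passage_time (\<lambda>e. \<delta> * bern (w e)) g"
    unfolding passage_time_def by (simp add: sum_list_const_mult)
  also have "\<dots> \<le> passage_time (\<lambda>e. weight \<delta> (w e)) g"
    by (rule passage_time_mono) (rule weight_ge_bern)
  finally show "\<delta> * N a b w \<le> passage_time (\<lambda>e. weight \<delta> (w e)) g" .
qed (use assms in auto)

text \<open>Explore the ball of radius \<open>j\<close> around column \<open>a\<close>: the edges not touching it are still fresh, and
  the remaining passage time through them is at most that of a fresh slab.\<close>

lemma N_submultiplicative:
  assumes ab: "0 \<le> a" "a \<le> b"
  shows "Q.prob {w \<in> space Q. real (Suc j + k) \<le> N a b w}
    \<le> Q.prob {w \<in> space Q. real (Suc j) \<le> N a b w} * Q.prob {w \<in> space Q. real k \<le> N a b w}"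
proof (cases "k = 0")
  case True
  then have "{w \<in> space Q. real k \<le> N a b w} = space Q" using N_nonneg[of a b] ab by auto
  then show ?thesis using True by (simp add: Q.prob_space)
next
  case False
  define \<U> where "\<U> = {U. U \<subseteq> {v \<in> V f. a \<le> fst v \<and> fst v \<le> max a b} \<and> U \<inter> P b = {}}"
  let ?BL = "\<lambda>w. passage_ball f a b (\<lambda>e. bern (w e)) (real j)"
  define A where "A U w \<longleftrightarrow> ?BL w = U" for U w
  define Z where "Z U w \<longleftrightarrow> real k \<le> column_time f a b (\<lambda>e. if e \<inter> U = {} then bern (w e) else 0)" for U w
  have finU: "finite \<U>" unfolding \<U>_def
    by (rule finite_subset[OF _ finite_Pow_iff[THEN iffD2, OF finite_columns[of f a "max a b"]]]) auto
  have cm: "(\<lambda>w. bern (w e)) \<in> borel_measurable Q" if "e \<in> E f" for e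
    by (rule measurable_compose[OF E_coordinate_measurable[OF that] bern_measurable])
  have Am[measurable]: "Measurable.pred Q (A U)" for U unfolding A_def by (rule passage_ball_measurable) (rule cm)
  have [measurable]: "(\<lambda>w. column_time f a b (\<lambda>e. if e \<inter> U = {} then bern (w e) else 0)) \<in> borel_measurable Q" for U
    by (rule column_time_measurable) (use cm in auto)
  have Zm[measurable]: "Measurable.pred Q (Z U)" for U unfolding Z_def by measurable
  \<comment> \<open>The threshold is j + 1 + k: radius \<open>j\<close>, at most 1 for the edge
    leaving the ball, and \<open>k\<close> for the fresh edges.\<close>
  have sub: "{w \<in> space Q. real (Suc j + k) \<le> N a b w} \<subseteq> (\<Union>U\<in>\<U>. {w \<in> space Q. A U w \<and> Z U w})"
  proof
    fix w assume w: "w \<in> {w \<in> space Q. real (Suc j + k) \<le> N a b w}"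
    have "?BL w \<in> \<U>"
      using passage_ball_subset column_time_less_passage_ball[where w = "\<lambda>e. bern (w e)" and \<rho> = "real j", OF ab bern_nonneg] w False
      unfolding \<U>_def N_def by auto
    moreover have "Z (?BL w) w" unfolding Z_def
      by (rule column_time_restart[where w = "\<lambda>e. bern (w e)", OF ab bern_nonneg bern_le_1])
         (use w False in \<open>auto simp: N_def\<close>)
    ultimately show "w \<in> (\<Union>U\<in>\<U>. {w \<in> space Q. A U w \<and> Z U w})" using w by (auto simp: A_def)
  qed
  have AZ: "Q.prob {w \<in> space Q. A U w \<and> Z U w} \<le> Q.prob {w \<in> space Q. A U w} * Q.prob {w \<in> space Q. real k \<le> N a b w}"
    for U
  proof -
    have "Q.prob {w \<in> space Q. A U w \<and> Z U w} = Q.prob {w \<in> space Q. A U w} * Q.prob {w \<in> space Q. Z U w}"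
    proof (rule prob_Int_depends_on[where A = "{e \<in> slab f a b. e \<inter> U \<noteq> {}}" and B = "{e \<in> slab f a b. e \<inter> U = {}}"])
      show "depends_on {e \<in> slab f a b. e \<inter> U \<noteq> {}} (A U)"
      proof (rule depends_on_predI)
        fix w w' assume eq: "\<And>e. e \<in> {e \<in> slab f a b. e \<inter> U \<noteq> {}} \<Longrightarrow> w e = w' e" and Aw: "A U w"
        have "?BL w' = ?BL w"
          by (rule passage_ball_local[OF bern_nonneg bern_nonneg]) (use eq Aw in \<open>auto simp: A_def\<close>)
        then show "A U w'" using Aw by (simp add: A_def)
      qed
      show "depends_on {e \<in> slab f a b. e \<inter> U = {}} (Z U)"
        unfolding depends_on_def Z_def
        by (intro allI impI arg_cong[where f = "(\<le>) (real k)"], rule column_time_cong[OF ab]) (simp_all add: bern_nonneg)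
    qed (use slab_lattice in auto)
    also have "\<dots> \<le> Q.prob {w \<in> space Q. A U w} * Q.prob {w \<in> space Q. real k \<le> N a b w}"
    proof (intro mult_left_mono Q.finite_measure_mono)
      have "column_time f a b (\<lambda>e. if e \<inter> U = {} then bern (w e) else 0) \<le> N a b w" for w
        unfolding N_def by (rule column_time_mono[OF ab]) (simp_all add: bern_nonneg)
      then show "{w \<in> space Q. Z U w} \<subseteq> {w \<in> space Q. real k \<le> N a b w}"
        unfolding Z_def by (auto intro: order_trans)
    qed auto
    finally show ?thesis .
  qed
  have "Q.prob {w \<in> space Q. real (Suc j + k) \<le> N a b w} \<le> Q.prob (\<Union>U\<in>\<U>. {w \<in> space Q. A U w \<and> Z U w})"
    by (rule Q.finite_measure_mono[OF sub]) (intro sets.finite_UN finU, simp)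
  also have "\<dots> \<le> (\<Sum>U\<in>\<U>. Q.prob {w \<in> space Q. A U w \<and> Z U w})"
    by (rule Q.finite_measure_subadditive_finite[OF finU]) auto
  also have "\<dots> \<le> (\<Sum>U\<in>\<U>. Q.prob {w \<in> space Q. A U w}) * Q.prob {w \<in> space Q. real k \<le> N a b w}"
    unfolding sum_distrib_right by (rule sum_mono) (rule AZ)
  \<comment> \<open>The ball takes only one value, so these events are disjoint. Their union says
    that column \<open>b\<close> is not reached at cost \<open>j\<close>, which by integrality means
    \<open>N \<ge> Suc j\<close>.\<close>
  also have "(\<Sum>U\<in>\<U>. Q.prob {w \<in> space Q. A U w}) = Q.prob (\<Union>U\<in>\<U>. {w \<in> space Q. A U w})"
  proof (rule Q.finite_measure_finite_Union[symmetric, OF finU])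
    show "disjoint_family_on (\<lambda>U. {w \<in> space Q. A U w}) \<U>"
      unfolding disjoint_family_on_def A_def by auto
  qed auto
  also have "\<dots> \<le> Q.prob {w \<in> space Q. real (Suc j) \<le> N a b w}"
  proof (rule Q.finite_measure_mono)
    show "(\<Union>U\<in>\<U>. {w \<in> space Q. A U w}) \<subseteq> {w \<in> space Q. real (Suc j) \<le> N a b w}"
    proof
      fix w assume w: "w \<in> (\<Union>U\<in>\<U>. {w \<in> space Q. A U w})"
      then have "?BL w \<inter> P b = {}" unfolding A_def \<U>_def by auto
      then have "real (Suc j) \<le> N a b w"
        unfolding N_def by (intro passage_ball_column_time_ge[OF ab bern_01])
      then show "w \<in> {w \<in> space Q. real (Suc j) \<le> N a b w}" using w by auto
    qed
  qed simp
  finally show ?thesis by (simp add: mult_right_mono)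
qed

lemma N_tail:
  assumes ab: "0 \<le> a" "a \<le> b" and m: "0 < m" "Q.prob {w \<in> space Q. real m \<le> N a b w} \<le> 1 / 2"
  shows "Q.prob {w \<in> space Q. real (j * m) \<le> N a b w} \<le> (1 / 2) ^ j"
proof (induction j)
  case (Suc j)
  obtain m' where m': "m = Suc m'" using m(1) by (cases m) auto
  have "Q.prob {w \<in> space Q. real (Suc j * m) \<le> N a b w}
      \<le> Q.prob {w \<in> space Q. real m \<le> N a b w} * Q.prob {w \<in> space Q. real (j * m) \<le> N a b w}"
    using N_submultiplicative[OF ab, of m' "j * m"] unfolding m' by (simp only: mult_Suc)
  also have "\<dots> \<le> 1 / 2 * (1 / 2) ^ j" by (intro mult_mono m Suc.IH) auto
  finally show ?case by simp
qed simp

end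

section \<open>Moments of passage times\<close>

lemma summable_power4_half: "summable (\<lambda>j. real (Suc j) ^ 4 * (1 / 2) ^ j)"
proof (rule summable_comparison_test_ev)
  have "\<forall>\<^sub>F j in sequentially. (real j + 1) ^ 4 * (1 / 2) ^ j \<le> (3 / 4) ^ j" by real_asymp
  then show "\<forall>\<^sub>F j in sequentially. norm (real (Suc j) ^ 4 * (1 / 2) ^ j) \<le> (3 / 4) ^ j"
    by (simp add: add.commute)
  show "summable (\<lambda>j. (3 / 4 :: real) ^ j)" by (rule summable_geometric) simp
qed

context fpp_model
begin

lemma N_le_length:
  assumes "0 \<le> a" "a \<le> b"
  shows "N a b w \<le> real (nat (b - a))"
proof -
  have "N a (a + int (nat (b - a))) w \<le> (\<Sum>j<nat (b - a). bern (w (bottom_edge (a + int j))))"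
    unfolding N_def by (rule column_time_bottom) (simp_all add: assms bern_nonneg)
  also have "\<dots> \<le> (\<Sum>j<nat (b - a). 1)" by (intro sum_mono bern_le_1)
  finally show ?thesis using assms by simp
qed

text \<open>Sum over the level \<open>j\<close> of \<open>N / m\<close>: there \<open>N\<close> is
  at most (j + 1) m, on an event of probability at most 2^(-j) by \<open>N_tail\<close>. The length
  of the slab only makes the sum finite and does not enter the bound.\<close>

lemma N_moment4:
  assumes ab: "0 \<le> a" "a \<le> b" and m: "0 < m" "Q.prob {w \<in> space Q. real m \<le> N a b w} \<le> 1 / 2"
  shows "integrable Q (\<lambda>w. N a b w ^ 4)"
    and "Q.expectation (\<lambda>w. N a b w ^ 4) \<le> real m ^ 4 * (\<Sum>j. real (Suc j) ^ 4 * (1 / 2) ^ j)"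
proof -
  let ?n = "nat (b - a)"
  have N0: "0 \<le> N a b w" for w using N_nonneg ab by simp
  show i: "integrable Q (\<lambda>w. N a b w ^ 4)"
  proof (rule Q.integrable_const_bound[of _ "real ?n ^ 4"])
    show "AE w in Q. norm (N a b w ^ 4) \<le> real ?n ^ 4"
      using N_le_length[OF ab] N0 by (intro AE_I2) (simp add: power_mono)
  qed simp
  define G where "G j = {w \<in> space Q. real (j * m) \<le> N a b w}" for j
  have Gm[measurable]: "G j \<in> sets Q" for j unfolding G_def by simp
  have pt: "N a b w ^ 4 \<le> (\<Sum>j\<le>?n. (real (Suc j) * real m) ^ 4 * indicator (G j) w)" if w: "w \<in> space Q" for w
  proof -
    define j where "j = nat \<lfloor>N a b w / real m\<rfloor>"
    have j1: "real j \<le> N a b w / real m" "N a b w / real m < real j + 1"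
      unfolding j_def using N0[of w] by (auto simp: of_nat_nat)
    have jm: "real (j * m) \<le> N a b w" "N a b w \<le> real (Suc j) * real m"
      using j1 m(1) by (auto simp: field_simps)
    have "j \<le> j * m" using m(1) by (cases m) auto
    then have "real j \<le> real (j * m)" by (simp only: of_nat_le_iff)
    also have "\<dots> \<le> real ?n" using jm(1) N_le_length[OF ab, of w] by linarith
    finally have jn: "j \<le> ?n" by simp
    have "N a b w ^ 4 \<le> (real (Suc j) * real m) ^ 4" using jm(2) N0 by (rule power_mono)
    also have "\<dots> = (real (Suc j) * real m) ^ 4 * indicator (G j) w" using jm(1) w by (simp add: G_def)
    also have "\<dots> \<le> (\<Sum>j\<le>?n. (real (Suc j) * real m) ^ 4 * indicator (G j) w)"
      using jn by (intro member_le_sum) auto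
    finally show ?thesis .
  qed
  have "Q.expectation (\<lambda>w. N a b w ^ 4) \<le> Q.expectation (\<lambda>w. \<Sum>j\<le>?n. (real (Suc j) * real m) ^ 4 * indicator (G j) w)"
    by (intro integral_mono i pt Bochner_Integration.integrable_sum integrable_mult_right)
       (auto simp: integrable_real_indicator Q.emeasure_eq_measure)
  also have "\<dots> = (\<Sum>j\<le>?n. (real (Suc j) * real m) ^ 4 * Q.prob (G j))"
    by (subst Bochner_Integration.integral_sum) (auto simp: integrable_real_indicator Q.emeasure_eq_measure)
  also have "\<dots> \<le> (\<Sum>j\<le>?n. (real (Suc j) * real m) ^ 4 * (1 / 2) ^ j)"
    using N_tail[OF ab m] unfolding G_def by (intro sum_mono mult_left_mono) auto
  also have "\<dots> = real m ^ 4 * (\<Sum>j\<le>?n. real (Suc j) ^ 4 * (1 / 2) ^ j)"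
    by (simp add: sum_distrib_left power_mult_distrib mult_ac)
  also have "\<dots> \<le> real m ^ 4 * (\<Sum>j. real (Suc j) ^ 4 * (1 / 2) ^ j)"
    by (intro mult_left_mono sum_le_suminf summable_power4_half) auto
  finally show "Q.expectation (\<lambda>w. N a b w ^ 4) \<le> real m ^ 4 * (\<Sum>j. real (Suc j) ^ 4 * (1 / 2) ^ j)" .
qed

section \<open>From Bernoulli weights to weights of law \<open>F\<close>\<close>

definition closed_edges :: "int \<Rightarrow> int \<Rightarrow> (edge \<Rightarrow> real) \<Rightarrow> edge set" where
  "closed_edges a b w = {e \<in> slab f a b. 0 < w e}"

text \<open>A path which is optimal for the Bernoulli weights depends only on the set of closed edges, and
  conditionally on this set the weights of its closed edges are independent of its choice.\<close>

lemma optimal_closed_edges: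
  assumes ab: "0 \<le> a" "a \<le> b"
  shows "\<exists>L. set L \<subseteq> z \<and> (\<forall>w. closed_edges a b w = z \<longrightarrow>
    N a b w = real (length L) \<and> C a b w \<le> (\<Sum>i<length L. weight \<delta> (w (L ! i))))"
proof -
  define u where "u e = (if e \<in> z then 1 else 0 :: real)" for e
  have u01: "u e \<in> {0, 1}" for e by (simp add: u_def)
  obtain x y g where g: "fst x = a" "fst y = b" "walk f x y g" "set (path_edges g) \<subseteq> slab f a b"
    "column_time f a b u = real (length (filter (\<lambda>e. u e \<noteq> 0) (path_edges g)))"
    using column_time_attained[where w = u, OF ab u01] by blast
  \<comment> \<open>A list rather than a set: an edge traversed twice is counted twice, in
    \<open>N\<close> as well as in the bound for \<open>C\<close>.\<close>
  define L where "L = filter (\<lambda>e. u e \<noteq> 0) (path_edges g)"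
  have "N a b w = real (length L) \<and> C a b w \<le> (\<Sum>i<length L. weight \<delta> (w (L ! i)))"
    if z: "closed_edges a b w = z" for w
  proof
    have "N a b w = column_time f a b u" unfolding N_def
      by (rule column_time_cong[OF ab]) (use z in \<open>auto simp: bern_def u_def closed_edges_def\<close>)
    then show "N a b w = real (length L)" using g(5) L_def by simp
    have "C a b w \<le> passage_time (\<lambda>e. weight \<delta> (w e)) g"
      unfolding C_def by (rule column_time_le[where w = "\<lambda>e. weight \<delta> (w e)", OF _ g(3,1,2)]) (rule weight_nonneg)
    also have "\<dots> = sum_list (map (\<lambda>e. weight \<delta> (w e)) L)"
      unfolding passage_time_def L_def
      by (rule sum_list_map_filter[symmetric]) (use g(4) z in \<open>auto simp: u_def closed_edges_def weight_def split: if_splits\<close>)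
    also have "\<dots> = (\<Sum>i<length L. weight \<delta> (w (L ! i)))"
      by (simp add: sum_list_sum_nth atLeast0LessThan)
    finally show "C a b w \<le> (\<Sum>i<length L. weight \<delta> (w (L ! i)))" .
  qed
  moreover have "set L \<subseteq> z" by (auto simp: L_def u_def)
  ultimately show ?thesis by blast
qed

text \<open>Used with \<open>F = {}\<close> and with \<open>F = {e}\<close>; removing
  \<open>e\<close> yields a function independent of the weight of \<open>e\<close>.\<close>

lemma closed_edges_measurable [measurable]: "Measurable.pred Q (\<lambda>w. closed_edges a b w - F = z)"
proof -
  have cm[measurable]: "(\<lambda>w. w e) \<in> borel_measurable Q" if "e \<in> slab f a b" for e
    using that slab_subset_E E_coordinate_measurable by blast
  have "Measurable.pred Q (\<lambda>w. (0 < w e \<and> e \<notin> F) = (e \<in> z))" if "e \<in> slab f a b" for e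
    using cm[OF that] by measurable
  then have "Measurable.pred Q (\<lambda>w. z \<subseteq> slab f a b \<and> (\<forall>e\<in>slab f a b. (0 < w e \<and> e \<notin> F) = (e \<in> z)))"
    by (intro pred_intros_logic pred_intros_finite finite_slab) auto
  moreover have "closed_edges a b w - F = z \<longleftrightarrow> z \<subseteq> slab f a b \<and> (\<forall>e\<in>slab f a b. (0 < w e \<and> e \<notin> F) = (e \<in> z))" for w
    unfolding closed_edges_def by blast
  ultimately show ?thesis by simp
qed

text \<open>The fourth moment of an edge weight conditioned on the edge being closed; open edges
  contribute nothing to the integral.\<close>

definition \<kappa> :: real where "\<kappa> = integral\<^sup>L \<nu> (\<lambda>x. weight \<delta> x ^ 4) / (1 - measure \<nu> {..0})"

lemma kappa_nonneg: "0 \<le> \<kappa>"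
  unfolding \<kappa>_def using closed_prob by (intro divide_nonneg_pos) auto

text \<open>As \<open>e\<close> belongs to \<open>z\<close>, the event factors into \<open>e\<close>
  being closed and the other closed edges being those of \<open>z\<close> other than
  \<open>e\<close>. The second part is independent of the weight of \<open>e\<close>.\<close>

lemma closed_edge_moment:
  assumes e: "e \<in> z" "z \<subseteq> slab f a b"
  shows "integrable Q (\<lambda>w. of_bool (closed_edges a b w = z) * weight \<delta> (w e) ^ 4)"
    and "Q.expectation (\<lambda>w. of_bool (closed_edges a b w = z) * weight \<delta> (w e) ^ 4) =
      \<kappa> * Q.expectation (\<lambda>w. of_bool (closed_edges a b w = z))"
proof -
  interpret nu: prob_space \<nu> by (rule prob_nu)
  have eL: "e \<in> lattice_edges" "e \<in> slab f a b" using e slab_lattice by auto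
  note [measurable] = coordinate_measurable[OF eL(1)]
  define p where "p w = (of_bool (closed_edges a b w - {e} = z - {e}) :: real)" for w
  have pm: "integrable Q p" unfolding p_def
    by (rule Q.integrable_const_bound[of _ 1]) auto
  have pd: "depends_on (slab f a b - {e}) p"
  proof -
    have "closed_edges a b w - {e} = closed_edges a b w' - {e}" if "\<forall>i\<in>slab f a b - {e}. w i = w' i" for w w'
    proof (rule set_eqI)
      fix x
      show "x \<in> closed_edges a b w - {e} \<longleftrightarrow> x \<in> closed_edges a b w' - {e}"
        using that[rule_format, of x] unfolding closed_edges_def by (cases "x \<in> slab f a b"; cases "x = e") simp_all
    qed
    then show ?thesis unfolding depends_on_def p_def by metis
  qed
  have nu_eq: "integral\<^sup>L Q (\<lambda>w. h (w e)) = integral\<^sup>L \<nu> h" "integrable Q (\<lambda>w. h (w e)) \<longleftrightarrow> integrable \<nu> h"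
    if "h \<in> borel_measurable borel" for h :: "real \<Rightarrow> real"
  proof -
    have m: "(\<lambda>w. w e) \<in> measurable Q \<nu>" "h \<in> borel_measurable \<nu>"
      using coordinate_measurable[OF eL(1)] that measurable_cong_sets[OF refl sets_nu] measurable_cong_sets[OF sets_nu refl]
      by blast+
    show "integral\<^sup>L Q (\<lambda>w. h (w e)) = integral\<^sup>L \<nu> h"
      using integral_distr[OF m] distr_coordinate[OF eL(1)] by simp
    show "integrable Q (\<lambda>w. h (w e)) \<longleftrightarrow> integrable \<nu> h"
      using integrable_distr_eq[OF m] distr_coordinate[OF eL(1)] by simp
  qed
  have wi: "integrable Q (\<lambda>w. weight \<delta> (w e) ^ 4)"
    using nu_eq(2)[of "\<lambda>x. weight \<delta> x ^ 4"] moment by simp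
  have wE: "Q.expectation (\<lambda>w. weight \<delta> (w e) ^ 4) = integral\<^sup>L \<nu> (\<lambda>x. weight \<delta> x ^ 4)"
    using nu_eq(1)[of "\<lambda>x. weight \<delta> x ^ 4"] by simp
  have bi: "integrable Q (\<lambda>w. of_bool (0 < w e) :: real)" by (rule Q.integrable_const_bound[of _ 1]) auto
  have "Q.expectation (\<lambda>w. of_bool (0 < w e) :: real) = integral\<^sup>L \<nu> (\<lambda>x. of_bool (0 < x))"
    by (rule nu_eq(1)[of "\<lambda>x. of_bool (0 < x)"]) measurable
  also have "\<dots> = integral\<^sup>L \<nu> (indicator (space \<nu> - {..0}))"
    by (intro Bochner_Integration.integral_cong refl) (auto simp: indicator_def space_nu)
  also have "\<dots> = measure \<nu> (space \<nu> - {..0})" by (simp add: space_nu)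
  also have "\<dots> = 1 - measure \<nu> {..0}" by (rule nu.prob_compl) (simp add: sets_nu)
  finally have bE: "Q.expectation (\<lambda>w. of_bool (0 < w e) :: real) = 1 - measure \<nu> {..0}" .
  have dep: "depends_on {e} (\<lambda>w. weight \<delta> (w e) ^ 4)" "depends_on {e} (\<lambda>w. of_bool (0 < w e) :: real)"
    unfolding depends_on_def by auto
  have S: "slab f a b - {e} \<subseteq> lattice_edges" "{e} \<subseteq> lattice_edges" "(slab f a b - {e}) \<inter> {e} = {}"
    using slab_lattice eL by auto
  have iff: "closed_edges a b w = z \<longleftrightarrow> closed_edges a b w - {e} = z - {e} \<and> 0 < w e" for w
    using e eL(2) unfolding closed_edges_def by blast
  have eq1: "of_bool (closed_edges a b w = z) * weight \<delta> (w e) ^ 4 = p w * weight \<delta> (w e) ^ 4" for w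
    unfolding p_def iff[of w] by (cases "0 < w e") (auto simp: weight_def)
  have eq2: "of_bool (closed_edges a b w = z) = p w * of_bool (0 < w e)" for w
    unfolding p_def iff[of w] by simp
  show "integrable Q (\<lambda>w. of_bool (closed_edges a b w = z) * weight \<delta> (w e) ^ 4)"
    unfolding eq1 by (rule expectation_mult_depends_on(2)[OF pm wi pd dep(1) S])
  have "Q.expectation (\<lambda>w. of_bool (closed_edges a b w = z) * weight \<delta> (w e) ^ 4) =
      Q.expectation p * integral\<^sup>L \<nu> (\<lambda>x. weight \<delta> x ^ 4)"
    unfolding eq1 expectation_mult_depends_on(1)[OF pm wi pd dep(1) S] wE ..
  moreover have "Q.expectation (\<lambda>w. of_bool (closed_edges a b w = z)) = Q.expectation p * (1 - measure \<nu> {..0})"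
    unfolding eq2 expectation_mult_depends_on(1)[OF pm bi pd dep(2) S] bE ..
  ultimately show "Q.expectation (\<lambda>w. of_bool (closed_edges a b w = z) * weight \<delta> (w e) ^ 4) =
      \<kappa> * Q.expectation (\<lambda>w. of_bool (closed_edges a b w = z))"
    using closed_prob unfolding \<kappa>_def by simp
qed

text \<open>Decompose according to the set \<open>z\<close> of closed edges. On each part
  \<open>C\<close> is at most a sum of \<open>N\<close> weights, whose fourth power is at most N^3
  times the sum of fourth powers, and each of these N terms contributes
  \<open>\<kappa>\<close>.\<close>

lemma C_moment4:
  assumes ab: "0 \<le> a" "a \<le> b"
  shows "integrable Q (\<lambda>w. C a b w ^ 4)"
    and "Q.expectation (\<lambda>w. C a b w ^ 4) \<le> \<kappa> * Q.expectation (\<lambda>w. N a b w ^ 4)"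
proof -
  let ?Z = "Pow (slab f a b)"
  have finZ: "finite ?Z" using finite_slab by simp
  obtain L where L: "\<And>z. set (L z) \<subseteq> z" "\<And>z w. closed_edges a b w = z \<Longrightarrow> N a b w = real (length (L z))"
    "\<And>z w. closed_edges a b w = z \<Longrightarrow> C a b w \<le> (\<Sum>i<length (L z). weight \<delta> (w (L z ! i)))"
    using optimal_closed_edges[OF ab] by metis
  let ?p = "\<lambda>z w. of_bool (closed_edges a b w = z) :: real"
  let ?F = "\<lambda>w. \<Sum>z\<in>?Z. real (length (L z)) ^ 3 * (\<Sum>i<length (L z). ?p z w * weight \<delta> (w (L z ! i)) ^ 4)"
  have C0: "0 \<le> C a b w" for w using C_nonneg ab by simp
  have zin: "closed_edges a b w \<in> ?Z" for w unfolding closed_edges_def by blast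
  have single: "(\<Sum>z\<in>?Z. ?p z w * h z) = h (closed_edges a b w)" for w and h :: "edge set \<Rightarrow> real"
  proof -
    have "(\<Sum>z\<in>?Z. ?p z w * h z) = (\<Sum>z\<in>?Z. if z = closed_edges a b w then h z else 0)"
      by (intro sum.cong) auto
    then show ?thesis using zin[of w] finZ by (simp add: sum.delta)
  qed
  have Cle: "C a b w ^ 4 \<le> ?F w" for w
  proof -
    let ?z = "closed_edges a b w"
    have "C a b w ^ 4 \<le> (\<Sum>i<length (L ?z). weight \<delta> (w (L ?z ! i))) ^ 4"
      using L(3)[of w ?z] C0 by (intro power_mono) auto
    also have "\<dots> \<le> real (card {..<length (L ?z)}) ^ 3 * (\<Sum>i<length (L ?z). weight \<delta> (w (L ?z ! i)) ^ 4)"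
      by (rule sum_power4_le)
    also have "\<dots> = (\<Sum>z\<in>?Z. ?p z w * (real (length (L z)) ^ 3 * (\<Sum>i<length (L z). weight \<delta> (w (L z ! i)) ^ 4)))"
      unfolding single by simp
    also have "\<dots> = ?F w"
      by (intro sum.cong refl) (simp only: sum_distrib_left[symmetric] mult.left_commute)
    finally show ?thesis .
  qed
  have N4: "N a b w ^ 4 = (\<Sum>z\<in>?Z. ?p z w * real (length (L z)) ^ 4)" for w
    unfolding single using L(2)[of w] by simp
  have mem: "L z ! i \<in> z" if "i < length (L z)" for z i using L(1) that nth_mem by blast
  have int: "integrable Q (\<lambda>w. ?p z w * weight \<delta> (w (L z ! i)) ^ 4)" if "z \<in> ?Z" "i < length (L z)" for z i
    using closed_edge_moment(1)[OF mem[OF that(2)], of a b] that by simp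
  have Fint: "integrable Q ?F"
    by (intro Bochner_Integration.integrable_sum integrable_mult_right int) auto
  show Cint: "integrable Q (\<lambda>w. C a b w ^ 4)"
  proof (rule Bochner_Integration.integrable_bound[OF Fint])
    have "norm (C a b w ^ 4) \<le> norm (?F w)" for w
    proof -
      have "norm (C a b w ^ 4) = C a b w ^ 4" using C0 by simp
      also have "\<dots> \<le> norm (?F w)" using Cle[of w] abs_ge_self unfolding real_norm_def by (rule order_trans)
      finally show ?thesis .
    qed
    then show "AE w in Q. norm (C a b w ^ 4) \<le> norm (?F w)" by simp
  qed simp
  have pint: "integrable Q (?p z)" for z
    using closed_edges_measurable[of a b "{}" z] by (intro Q.integrable_const_bound[of _ 1]) auto
  have "Q.expectation (\<lambda>w. C a b w ^ 4) \<le> Q.expectation ?F"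
    by (intro integral_mono Cint Fint Cle)
  also have "\<dots> = (\<Sum>z\<in>?Z. real (length (L z)) ^ 3 * (\<Sum>i<length (L z). Q.expectation (\<lambda>w. ?p z w * weight \<delta> (w (L z ! i)) ^ 4)))"
  proof (subst Bochner_Integration.integral_sum)
    have inti: "integrable Q (\<lambda>w. \<Sum>i<length (L z). ?p z w * weight \<delta> (w (L z ! i)) ^ 4)" if "z \<in> ?Z" for z
      by (rule Bochner_Integration.integrable_sum) (rule int[OF that], simp)
    then show "integrable Q (\<lambda>w. real (length (L z)) ^ 3 * (\<Sum>i<length (L z). ?p z w * weight \<delta> (w (L z ! i)) ^ 4))"
      if "z \<in> ?Z" for z using that by (intro integrable_mult_right)
    have "Q.expectation (\<lambda>w. \<Sum>i<length (L z). ?p z w * weight \<delta> (w (L z ! i)) ^ 4) =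
      (\<Sum>i<length (L z). Q.expectation (\<lambda>w. ?p z w * weight \<delta> (w (L z ! i)) ^ 4))" if "z \<in> ?Z" for z
      by (rule Bochner_Integration.integral_sum) (rule int[OF that], simp)
    then show "(\<Sum>z\<in>?Z. Q.expectation (\<lambda>w. real (length (L z)) ^ 3 * (\<Sum>i<length (L z). ?p z w * weight \<delta> (w (L z ! i)) ^ 4))) =
      (\<Sum>z\<in>?Z. real (length (L z)) ^ 3 * (\<Sum>i<length (L z). Q.expectation (\<lambda>w. ?p z w * weight \<delta> (w (L z ! i)) ^ 4)))"
      by (intro sum.cong refl) (simp only: integral_mult_right_zero)
  qed
  also have "\<dots> = (\<Sum>z\<in>?Z. real (length (L z)) ^ 3 * (\<Sum>i<length (L z). \<kappa> * Q.expectation (?p z)))"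
    using closed_edge_moment(2)[OF mem, of _ _ a b] by (intro sum.cong refl arg_cong2[where f = "(*)"]) auto
  also have "\<dots> = \<kappa> * (\<Sum>z\<in>?Z. Q.expectation (?p z) * real (length (L z)) ^ 4)"
    unfolding sum_distrib_left by (intro sum.cong refl) (simp add: eval_nat_numeral mult_ac)
  also have "(\<Sum>z\<in>?Z. Q.expectation (?p z) * real (length (L z)) ^ 4) = Q.expectation (\<lambda>w. N a b w ^ 4)"
    unfolding N4 by (subst Bochner_Integration.integral_sum) (auto intro: pint)
  finally show "Q.expectation (\<lambda>w. C a b w ^ 4) \<le> \<kappa> * Q.expectation (\<lambda>w. N a b w ^ 4)" .
qed

text \<open>By Markov's inequality twice the mean is a level that \<open>N\<close> reaches with
  probability at most 1/2, as \<open>N_tail\<close> requires.\<close>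

lemma C_moment4_le:
  assumes ab: "0 \<le> a" "a \<le> b" and K: "0 < m" "2 * Q.expectation (N a b) \<le> real m"
  shows "Q.expectation (\<lambda>w. C a b w ^ 4) \<le> \<kappa> * (\<Sum>j. real (Suc j) ^ 4 * (1 / 2) ^ j) * real m ^ 4"
proof -
  have Nint: "integrable Q (N a b)"
    by (rule Q.integrable_const_bound[of _ "real (nat (b - a))"]) (use N_le_length[OF ab] N_nonneg ab in auto)
  have "Q.prob {w \<in> space Q. real m \<le> N a b w} \<le> Q.expectation (N a b) / real m"
    by (rule integral_Markov_inequality_measure[where u = "N a b" and A = "{}"]) (use Nint K N_nonneg ab in auto)
  also have "\<dots> \<le> 1 / 2" using K by (simp add: field_simps)
  finally have "Q.prob {w \<in> space Q. real m \<le> N a b w} \<le> 1 / 2" .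
  note N4 = N_moment4(2)[OF ab K(1) this]
  have "Q.expectation (\<lambda>w. C a b w ^ 4) \<le> \<kappa> * Q.expectation (\<lambda>w. N a b w ^ 4)" by (rule C_moment4(2)[OF ab])
  also have "\<dots> \<le> \<kappa> * (real m ^ 4 * (\<Sum>j. real (Suc j) ^ 4 * (1 / 2) ^ j))"
    by (rule mult_left_mono[OF N4 kappa_nonneg])
  finally show ?thesis by (simp only: mult_ac)
qed

end

section \<open>Crossings near a block\<close>

text \<open>The assumptions in the form in which they are used: \<open>c\<close> and
  \<open>i0\<close> come from A1, \<open>block_time\<close> from A3, and \<open>K\<close> from A2,
  enlarged so as to cover also the finitely many increments that the limsup leaves free.\<close>

locale fpp_blocks = fpp_model +
  fixes r :: "nat \<Rightarrow> int" and c :: real and i0 K :: nat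
  assumes r_0: "r 0 = 0" and r_strict: "strict_mono r"
    and c: "0 < c" "c < 1"
    and crossing_prob: "\<And>i. i0 \<le> i \<Longrightarrow>
      c \<le> Q.prob {w \<in> space Q. open_crossing f (r i) (r (Suc i)) (\<lambda>e. weight \<delta> (w e))}"
    and K: "0 < K" "\<And>i. Q.expectation (N 0 (r (Suc i))) - Q.expectation (N 0 (r i)) \<le> real K"
    and block_time: "\<And>m. 0 \<le> m \<Longrightarrow> \<exists>\<epsilon>>0. \<exists>i1. \<forall>i\<ge>i1.
      \<epsilon> \<le> Q.prob {w \<in> space Q. m \<le> N (r i) (r (Suc i)) w}"
begin

lemma r_le: "a \<le> b \<Longrightarrow> r a \<le> r b" using r_strict by (simp add: strict_mono_less_eq)
lemma r_less: "a < b \<Longrightarrow> r a + 1 \<le> r b" using r_strict strict_mono_less[of r a b] by simp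
lemma r_nonneg: "0 \<le> r a" using r_le[of 0 a] by (simp add: r_0)

definition cross :: "nat \<Rightarrow> (edge \<Rightarrow> real) \<Rightarrow> bool" where
  "cross i w \<longleftrightarrow> open_crossing f (r i) (r (Suc i)) (\<lambda>e. weight \<delta> (w e))"

lemma cross_measurable [measurable]: "Measurable.pred Q (cross i)"
  unfolding cross_def[abs_def]
  by (rule open_crossing_measurable[where W = "\<lambda>e w. weight \<delta> (w e)"])
     (rule measurable_compose[OF E_coordinate_measurable weight_measurable])

lemma cross_depends_on: "depends_on (slab f (r i) (r (Suc i) + 1)) (cross i)"
  unfolding cross_def[abs_def] by (rule open_crossing_depends_on)

lemma cross_exchange:
  assumes "cross j w" "0 \<le> a" "a \<le> r j" "0 \<le> a'" "a' \<le> r j" "r (Suc j) \<le> b" "r (Suc j) \<le> b'"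
  shows "C a b w + C a' b' w = C a b' w + C a' b w"
  unfolding C_def by (rule column_time_exchange[OF assms(1)[unfolded cross_def] assms(2-7)]) (rule weight_nonneg)

lemma cross_le:
  assumes "cross j w" "0 \<le> a" "a \<le> r j" "r (Suc j) \<le> b"
  shows "C a b w \<le> C a (r (Suc j)) w + C (r j) b w"
  unfolding C_def
  by (rule column_time_crossing_le[OF assms(1)[unfolded cross_def] assms(2,3) _ assms(4)])
     (simp_all add: weight_nonneg r_le)

lemma N_integrable: "0 \<le> a \<Longrightarrow> a \<le> b \<Longrightarrow> integrable Q (N a b)"
  by (rule Q.integrable_const_bound[of _ "real (nat (b - a))"]) (use N_le_length N_nonneg in auto)

text \<open>A2 bounds increments of the mean time from the origin. By superadditivity such an
  increment dominates the mean time across the slab.\<close>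

lemma N_expectation_le:
  assumes "a \<le> b"
  shows "Q.expectation (N (r a) (r b)) \<le> real (K * (b - a))"
proof -
  have "Q.expectation (N 0 (r (a + k))) - Q.expectation (N 0 (r a)) \<le> real (K * k)" for k
  proof (induction k)
    case (Suc k)
    then show ?case using K(2)[of "a + k"] by (simp add: algebra_simps)
  qed simp
  from this[of "b - a"] have "Q.expectation (N 0 (r b)) - Q.expectation (N 0 (r a)) \<le> real (K * (b - a))"
    using assms by simp
  moreover have "Q.expectation (\<lambda>w. N 0 (r a) w + N (r a) (r b) w) \<le> Q.expectation (N 0 (r b))"
    using assms r_nonneg r_le by (intro integral_mono Bochner_Integration.integrable_add N_integrable N_superadd) auto
  moreover have "Q.expectation (\<lambda>w. N 0 (r a) w + N (r a) (r b) w) = Q.expectation (N 0 (r a)) + Q.expectation (N (r a) (r b))"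
    using assms r_nonneg r_le by (intro Bochner_Integration.integral_add N_integrable) auto
  ultimately show ?thesis by simp
qed

text \<open>The factor \<open>2 * real K\<close> is the level per region at which Markov's
  inequality is applied in \<open>C_block_moment4\<close>.\<close>

definition M4 :: real where
  "M4 = \<kappa> * (\<Sum>j. real (Suc j) ^ 4 * (1 / 2) ^ j) * (2 * real K) ^ 4"

lemma M4_nonneg: "0 \<le> M4"
  unfolding M4_def by (intro mult_nonneg_nonneg kappa_nonneg suminf_nonneg summable_power4_half) auto

lemma C_block_moment4:
  assumes "a \<le> b"
  shows "Q.expectation (\<lambda>w. C (r a) (r b) w ^ 4) \<le> M4 * real (b - a) ^ 4"
proof (cases "a = b")
  case True
  \<comment> \<open>Superadditivity gives 2 C \<le> C. This case is separate because the level in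
    \<open>C_moment4_le\<close> must be positive.\<close>
  have "C (r a) (r a) w = 0" for w
    using C_superadd[of "r a" "r a" "r a" w] C_nonneg[of "r a" "r a" w] r_nonneg[of a] by simp
  then show ?thesis using True by simp
next
  case False
  then have "0 < 2 * K * (b - a)" using K assms by simp
  then have "Q.expectation (\<lambda>w. C (r a) (r b) w ^ 4) \<le>
      \<kappa> * (\<Sum>j. real (Suc j) ^ 4 * (1 / 2) ^ j) * real (2 * K * (b - a)) ^ 4"
    using N_expectation_le[OF assms] r_nonneg r_le[OF assms]
    by (intro C_moment4_le) (auto simp: mult.assoc)
  then show ?thesis unfolding M4_def by (simp add: power_mult_distrib mult_ac)
qed

lemma C_square_integrable: "0 \<le> a \<Longrightarrow> a \<le> b \<Longrightarrow> integrable Q (\<lambda>w. (C a b w)\<^sup>2)"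
  by (rule Q.power4_integrable_square(1)) (auto intro: C_moment4)

lemma C_integrable: "0 \<le> a \<Longrightarrow> a \<le> b \<Longrightarrow> integrable Q (C a b)"
  by (rule Q.power4_integrable_square(2)) (auto intro: C_moment4)

text \<open>A crossing of region \<open>i\<close> may use vertical edges of its last column, which
  belong to the next slab. Crossings of neighbouring regions are thus dependent, and only every
  second region is tested.\<close>

lemma no_even_crossing:
  assumes "i0 \<le> a"
  shows "Q.prob {w \<in> space Q. \<forall>j<k. \<not> cross (a + 2 * j) w} \<le> (1 - c) ^ k"
proof (induction k)
  case (Suc k)
  let ?b = "a + 2 * k"
  have eq: "{w \<in> space Q. \<forall>j<Suc k. \<not> cross (a + 2 * j) w} =
    {w \<in> space Q. (\<forall>j<k. \<not> cross (a + 2 * j) w) \<and> \<not> cross ?b w}" by (auto simp: less_Suc_eq)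
  have "Q.prob {w \<in> space Q. \<forall>j<Suc k. \<not> cross (a + 2 * j) w} =
    Q.prob {w \<in> space Q. \<forall>j<k. \<not> cross (a + 2 * j) w} * Q.prob {w \<in> space Q. \<not> cross ?b w}"
    unfolding eq
  proof (rule prob_Int_depends_on[where A = "slab f (r a) (r ?b)" and B = "slab f (r ?b) (r (Suc ?b) + 1)"])
    have "depends_on (slab f (r a) (r ?b)) (cross (a + 2 * j))" if "j < k" for j
      by (rule depends_on_mono[OF cross_depends_on slab_mono])
         (use that r_le[of a "a + 2 * j"] r_less[of "Suc (a + 2 * j)" "a + 2 * k"] in auto)
    then show "depends_on (slab f (r a) (r ?b)) (\<lambda>w. \<forall>j<k. \<not> cross (a + 2 * j) w)"
      unfolding depends_on_def by metis
    show "depends_on (slab f (r ?b) (r (Suc ?b) + 1)) (\<lambda>w. \<not> cross ?b w)"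
      by (rule depends_on_compose[OF cross_depends_on])
    show "slab f (r a) (r ?b) \<inter> slab f (r ?b) (r (Suc ?b) + 1) = {}" by (auto simp: slab_def)
  qed (use slab_lattice in auto)
  also have "\<dots> \<le> (1 - c) ^ k * (1 - c)"
  proof (intro mult_mono Suc.IH)
    have "{w \<in> space Q. \<not> cross ?b w} = space Q - {w \<in> space Q. cross ?b w}" by auto
    then have "Q.prob {w \<in> space Q. \<not> cross ?b w} = 1 - Q.prob {w \<in> space Q. cross ?b w}"
      by (simp add: Q.prob_compl)
    then show "Q.prob {w \<in> space Q. \<not> cross ?b w} \<le> 1 - c"
      using crossing_prob[of ?b] assms unfolding cross_def by simp
  qed (use c in auto)
  finally show ?case by (simp add: mult.commute)
qed simp

lemma no_crossing:
  assumes "m + i0 + a \<le> b \<or> (m + a \<le> b \<and> i0 \<le> a)"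
  shows "Q.prob {w \<in> space Q. \<forall>j\<in>{a..<b}. \<not> cross j w} \<le> (1 - c) ^ (m div 2)"
proof -
  let ?a = "max a i0"
  have "?a + m \<le> b" using assms by auto
  then have "?a + 2 * j \<in> {a..<b}" if "j < m div 2" for j using that by auto
  then have "{w \<in> space Q. \<forall>j\<in>{a..<b}. \<not> cross j w} \<subseteq> {w \<in> space Q. \<forall>j<m div 2. \<not> cross (?a + 2 * j) w}"
    by blast
  then have "Q.prob {w \<in> space Q. \<forall>j\<in>{a..<b}. \<not> cross j w} \<le> Q.prob {w \<in> space Q. \<forall>j<m div 2. \<not> cross (?a + 2 * j) w}"
    by (intro Q.finite_measure_mono) auto
  also have "\<dots> \<le> (1 - c) ^ (m div 2)" by (rule no_even_crossing) simp
  finally show ?thesis .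
qed

text \<open>Block \<open>i\<close> uses the vertical edges of column \<open>r i\<close>, so only crossings of the regions
  \<open>j \<le> i - 2\<close> and \<open>j \<ge> i + 1\<close> are unaffected by it. Reaching column \<open>0\<close>, or the last of the
  \<open>n\<close> regions, is as good as finding a crossing.\<close>

definition good :: "nat \<Rightarrow> nat \<Rightarrow> nat \<Rightarrow> (edge \<Rightarrow> real) \<Rightarrow> bool" where
  "good n i d w \<longleftrightarrow> (i \<le> d \<or> (\<exists>j\<in>{i - d..<i - 1}. cross j w)) \<and> (n \<le> i + d \<or> (\<exists>j\<in>{Suc i..<Suc i + d}. cross j w))"

definition bad :: "nat \<Rightarrow> nat \<Rightarrow> nat \<Rightarrow> (edge \<Rightarrow> real) \<Rightarrow> bool" where
  "bad n i d w \<longleftrightarrow> d = 0 \<or> \<not> good n i (d - 1) w"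

text \<open>The time across the window of radius \<open>d\<close> around region \<open>i\<close>: if
  \<open>d\<close> is good, this bounds the influence of the region. Truncated subtraction stops the
  window at column 0.\<close>

definition Y :: "nat \<Rightarrow> nat \<Rightarrow> (edge \<Rightarrow> real) \<Rightarrow> real" where
  "Y i d = C (r (i - d)) (r (Suc (i + d)))"

lemma good_measurable [measurable]: "Measurable.pred Q (good n i d)"
  unfolding good_def[abs_def] by measurable

lemma bad_measurable [measurable]: "Measurable.pred Q (bad n i d)"
  unfolding bad_def[abs_def] by measurable

lemma Y_measurable [measurable]: "Y i d \<in> borel_measurable Q" unfolding Y_def by simp

text \<open>Of the \<open>d - 1\<close> regions on the left and the \<open>d\<close> on the right,
  up to \<open>i0\<close> may have too small an index, and half of the others are tested; the factor
  2 is for the two sides.\<close>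

lemma prob_not_good: "Q.prob {w \<in> space Q. \<not> good n i d w} \<le> 2 * (1 - c) ^ ((d - 1 - i0) div 2)"
proof -
  have l: "Q.prob {w \<in> space Q. d < i \<and> (\<forall>j\<in>{i - d..<i - 1}. \<not> cross j w)} \<le> (1 - c) ^ ((d - 1 - i0) div 2)"
  proof (cases "d < i \<and> 1 + i0 \<le> d")
    case True
    then show ?thesis using no_crossing[of "d - 1 - i0" "i - d" "i - 1"] by simp
  next
    case False
    then show ?thesis using c by (cases "d < i") auto
  qed
  have right: "Q.prob {w \<in> space Q. \<forall>j\<in>{Suc i..<Suc i + d}. \<not> cross j w} \<le> (1 - c) ^ ((d - 1 - i0) div 2)"
    using no_crossing[of "d - 1 - i0" "Suc i" "Suc i + d"] c by (cases "1 + i0 \<le> d") auto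
  have "Q.prob {w \<in> space Q. \<not> good n i d w} \<le>
    Q.prob ({w \<in> space Q. d < i \<and> (\<forall>j\<in>{i - d..<i - 1}. \<not> cross j w)} \<union> {w \<in> space Q. \<forall>j\<in>{Suc i..<Suc i + d}. \<not> cross j w})"
    by (rule Q.finite_measure_mono) (auto simp: good_def)
  also have "\<dots> \<le> Q.prob {w \<in> space Q. d < i \<and> (\<forall>j\<in>{i - d..<i - 1}. \<not> cross j w)} +
      Q.prob {w \<in> space Q. \<forall>j\<in>{Suc i..<Suc i + d}. \<not> cross j w}"
    by (rule measure_Un_le) auto
  finally show ?thesis using l right by simp
qed

text \<open>The square root undoes the halving of the exponent caused by testing every second
  region.\<close>

definition q :: real where "q = sqrt (1 - c)"

lemma q: "0 < q" "q < 1" "q\<^sup>2 = 1 - c" using c by (auto simp: q_def)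

lemma prob_bad: "Q.prob {w \<in> space Q. bad n i d w} \<le> 2 / q ^ (i0 + 3) * q ^ d"
proof (cases d)
  case 0
  have "q ^ (i0 + 3) \<le> 1" using q by (intro power_le_one) auto
  then have "1 \<le> 2 / q ^ (i0 + 3)" using q by (simp add: pos_le_divide_eq)
  then show ?thesis using 0 order_trans[OF Q.prob_le_1] by simp
next
  case (Suc d')
  have "Q.prob {w \<in> space Q. bad n i d w} \<le> 2 * (1 - c) ^ ((d' - 1 - i0) div 2)"
    using prob_not_good[of n i d'] by (simp add: bad_def Suc)
  also have "(1 - c) ^ ((d' - 1 - i0) div 2) = q ^ (2 * ((d' - 1 - i0) div 2))"
    by (simp add: power_mult q)
  \<comment> \<open>The exponent \<open>i0 + 3\<close> compensates for \<open>i0\<close>, for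
    \<open>d' = d - 1\<close>, for the 1 subtracted from \<open>d'\<close>, and for
    rounding.\<close>
  also have "2 * \<dots> \<le> 2 / q ^ (i0 + 3) * q ^ d"
  proof -
    have "q ^ (2 * ((d' - 1 - i0) div 2)) * q ^ (i0 + 3) = q ^ (2 * ((d' - 1 - i0) div 2) + (i0 + 3))"
      by (simp add: power_add)
    also have "\<dots> \<le> q ^ d" using q Suc by (intro power_decreasing) auto
    finally show ?thesis using q by (simp add: field_simps)
  qed
  finally show ?thesis by simp
qed

lemma Y_moment4:
  shows "integrable Q (\<lambda>w. Y i d w ^ 4)" "Q.expectation (\<lambda>w. Y i d w ^ 4) \<le> M4 * (2 * real d + 1) ^ 4"
proof -
  have le: "i - d \<le> Suc (i + d)" by simp
  show "integrable Q (\<lambda>w. Y i d w ^ 4)" unfolding Y_def by (rule C_moment4(1)) (simp_all add: r_nonneg r_le)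
  have "Q.expectation (\<lambda>w. Y i d w ^ 4) \<le> M4 * real (Suc (i + d) - (i - d)) ^ 4"
    unfolding Y_def by (rule C_block_moment4[OF le])
  also have "\<dots> \<le> M4 * (2 * real d + 1) ^ 4"
    by (intro mult_left_mono power_mono M4_nonneg) auto
  finally show "Q.expectation (\<lambda>w. Y i d w ^ 4) \<le> M4 * (2 * real d + 1) ^ 4" .
qed

lemma bad_Y_integrable: "integrable Q (\<lambda>w. of_bool (bad n i d w) * (Y i d w)\<^sup>2)"
  by (rule Bochner_Integration.integrable_bound[OF Q.power4_integrable_square(1)[OF Y_measurable Y_moment4(1)]]) auto

text \<open>Instead of Cauchy-Schwarz, the second moment is split at a level \<open>l\<close>
  between the probability of the bad event and the fourth moment. The successive roots
  \<open>\<rho>\<close> and \<open>\<sigma>\<close> of \<open>q\<close> leave room for the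
  optimisation and for the polynomial factor in \<open>d\<close>.\<close>

lemma bad_Y_moment:
  obtains \<sigma> B where "0 < \<sigma>" "\<sigma> < 1" "0 \<le> B"
    "\<And>n i d. Q.expectation (\<lambda>w. of_bool (bad n i d w) * (Y i d w)\<^sup>2) \<le> B * \<sigma> ^ d"
proof -
  define \<rho> where "\<rho> = sqrt q"
  define \<sigma> where "\<sigma> = sqrt \<rho>"
  have \<rho>: "0 < \<rho>" "\<rho> < 1" "\<rho>\<^sup>2 = q" using q by (auto simp: \<rho>_def)
  have \<sigma>: "0 < \<sigma>" "\<sigma> < 1" "\<sigma>\<^sup>2 = \<rho>" using \<rho> by (auto simp: \<sigma>_def)
  have "(\<lambda>d. (2 * real d + 1)\<^sup>2 * \<sigma> ^ d) \<longlonglongrightarrow> 0" using \<sigma> by real_asymp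
  then have "Bseq (\<lambda>d. (2 * real d + 1)\<^sup>2 * \<sigma> ^ d)" by (intro convergent_imp_Bseq convergentI)
  then obtain B' where B': "\<And>d. norm ((2 * real d + 1)\<^sup>2 * \<sigma> ^ d) \<le> B'" unfolding Bseq_def by blast
  have B'0: "0 \<le> B'" using B'[of 0] by (smt (verit) norm_ge_zero)
  define A where "A = 2 / q ^ (i0 + 3)"
  have A0: "0 \<le> A" using q by (simp add: A_def)
  have "Q.expectation (\<lambda>w. of_bool (bad n i d w) * (Y i d w)\<^sup>2) \<le> (B' * (A + M4)) * \<sigma> ^ d" for n i d
  proof -
    \<comment> \<open>Chosen so that both terms become multiples of (2 d + 1)^2
      \<open>\<rho>\<close>^d.\<close>
    define l where "l = (2 * real d + 1)\<^sup>2 / \<rho> ^ d"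
    have l: "0 < l" using \<rho> by (simp add: l_def add_nonneg_pos zero_less_power)
    have bi: "integrable Q (\<lambda>w. of_bool (bad n i d w) :: real)" by (rule Q.integrable_const_bound[of _ 1]) auto
    have "Q.expectation (\<lambda>w. of_bool (bad n i d w) * (Y i d w)\<^sup>2)
        \<le> Q.expectation (\<lambda>w. l * of_bool (bad n i d w) + Y i d w ^ 4 / l)"
    proof (rule integral_mono[OF bad_Y_integrable])
      show "integrable Q (\<lambda>w. l * of_bool (bad n i d w) + Y i d w ^ 4 / l)"
        using bi Y_moment4(1) by simp
      fix w
      show "of_bool (bad n i d w) * (Y i d w)\<^sup>2 \<le> l * of_bool (bad n i d w) + Y i d w ^ 4 / l"
      proof (cases "bad n i d w")
        case True
        have "0 \<le> (l - (Y i d w)\<^sup>2)\<^sup>2 + l\<^sup>2 + (Y i d w)^4" by simp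
        then have "l * (Y i d w)\<^sup>2 \<le> l * l + Y i d w ^ 4" by (simp add: power2_eq_square eval_nat_numeral algebra_simps)
        then show ?thesis using True l by (simp add: field_simps)
      qed (use l in simp)
    qed
    also have "\<dots> = l * Q.expectation (\<lambda>w. of_bool (bad n i d w)) + Q.expectation (\<lambda>w. Y i d w ^ 4) / l"
      using bi Y_moment4(1) by simp
    also have "Q.expectation (\<lambda>w. of_bool (bad n i d w)) = Q.prob {w \<in> space Q. bad n i d w}"
    proof -
      have "Q.expectation (\<lambda>w. of_bool (bad n i d w) :: real) = Q.expectation (indicator {w \<in> space Q. bad n i d w})"
        by (intro Bochner_Integration.integral_cong refl) (auto simp: indicator_def)
      then show ?thesis by simp
    qed
    also have "l * Q.prob {w \<in> space Q. bad n i d w} + Q.expectation (\<lambda>w. Y i d w ^ 4) / l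
        \<le> l * (A * q ^ d) + M4 * (2 * real d + 1) ^ 4 / l"
      using l prob_bad[of n i d] Y_moment4(2)[of i d] unfolding A_def
      by (intro add_mono mult_left_mono divide_right_mono) auto
    also have "\<dots> = (2 * real d + 1)\<^sup>2 * \<rho> ^ d * (A + M4)"
    proof -
      have "q ^ d = \<rho> ^ d * \<rho> ^ d" unfolding \<rho>(3)[symmetric] by (simp add: power2_eq_square power_mult_distrib)
      moreover have "(2 * real d + 1) ^ 4 = (2 * real d + 1)\<^sup>2 * (2 * real d + 1)\<^sup>2" by (simp add: power_add[symmetric])
      moreover have "(2 * real d + 1)\<^sup>2 \<noteq> 0" "\<rho> ^ d \<noteq> 0" using \<rho> by auto
      moreover have "x / y * (A * (y * y)) + M4 * (x * x) / (x / y) = x * y * (A + M4)"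
        if "x \<noteq> 0" "y \<noteq> 0" for x y :: real using that by (simp add: field_simps)
      ultimately show ?thesis unfolding l_def by metis
    qed
    also have "\<rho> ^ d = \<sigma> ^ d * \<sigma> ^ d" unfolding \<sigma>(3)[symmetric] by (simp add: power2_eq_square power_mult_distrib)
    also have "(2 * real d + 1)\<^sup>2 * (\<sigma> ^ d * \<sigma> ^ d) * (A + M4) = ((2 * real d + 1)\<^sup>2 * \<sigma> ^ d) * ((A + M4) * \<sigma> ^ d)"
      by (simp add: mult_ac)
    also have "\<dots> \<le> B' * ((A + M4) * \<sigma> ^ d)"
    proof (rule mult_right_mono)
      show "(2 * real d + 1)\<^sup>2 * \<sigma> ^ d \<le> B'" using B'[of d] by (simp add: abs_le_iff)
      show "0 \<le> (A + M4) * \<sigma> ^ d" using A0 M4_nonneg \<sigma> by simp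
    qed
    finally show ?thesis by (simp add: mult_ac)
  qed
  then show thesis using that[of \<sigma> "B' * (A + M4)"] \<sigma> B'0 A0 M4_nonneg by simp
qed

end

section \<open>Variance estimates\<close>

lemma sum_lessThan_add:
  fixes g :: "nat \<Rightarrow> 'b::comm_monoid_add"
  shows "(\<Sum>i<a + b. g i) = (\<Sum>i<a. g i) + (\<Sum>t<b. g (a + t))"
  by (induction b) (simp_all add: add.assoc)

lemma sum_periodic:
  fixes g :: "nat \<Rightarrow> real"
  shows "(\<Sum>i<m * L. g (i mod L)) = real m * (\<Sum>t<L. g t)"
proof (induction m)
  case (Suc m)
  have "(\<Sum>i<Suc m * L. g (i mod L)) = (\<Sum>i<m * L. g (i mod L)) + (\<Sum>t<L. g ((m * L + t) mod L))"
    using sum_lessThan_add[of "\<lambda>i. g (i mod L)" "m * L" L] by (simp add: add.commute)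
  also have "(\<Sum>t<L. g ((m * L + t) mod L)) = (\<Sum>t<L. g t)" by (intro sum.cong) auto
  finally show ?case using Suc.IH by (simp add: algebra_simps)
qed simp

lemma sum_power_le:
  fixes \<sigma> :: real
  assumes "0 < \<sigma>" "\<sigma> < 1"
  shows "(\<Sum>d=l..n. \<sigma> ^ d) \<le> \<sigma> ^ l / (1 - \<sigma>)" "(\<Sum>d<n. \<sigma> ^ d) \<le> 1 / (1 - \<sigma>)"
proof -
  show "(\<Sum>d=l..n. \<sigma> ^ d) \<le> \<sigma> ^ l / (1 - \<sigma>)"
    using assms by (auto simp: sum_gp intro!: divide_right_mono)
  show "(\<Sum>d<n. \<sigma> ^ d) \<le> 1 / (1 - \<sigma>)"
    using assms by (auto simp: sum_gp_strict intro!: divide_right_mono)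
qed

context fpp_blocks
begin

text \<open>Provides the comparison functions \<open>h\<close> of \<open>efron_stein\<close>. The
  value 0 opens all edges of the region, so crossings survive and the change of a passage time has a
  sign.\<close>

definition erase :: "nat \<Rightarrow> (edge \<Rightarrow> real) \<Rightarrow> edge \<Rightarrow> real" where
  "erase i w e = (if e \<in> slab f (r i) (r (Suc i)) then 0 else w e)"

lemma erase_measurable: "erase i \<in> measurable Q Q"
proof -
  have *: "(\<lambda>w. if e \<in> slab f (r i) (r (Suc i)) then 0 else w e) \<in> measurable Q \<nu>" if "e \<in> lattice_edges" for e
    using that unfolding Q_def by (cases "e \<in> slab f (r i) (r (Suc i))") (simp_all add: space_nu)
  have "(\<lambda>w. \<lambda>e\<in>lattice_edges. if e \<in> slab f (r i) (r (Suc i)) then 0 else w e) \<in> measurable Q Q"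
    by (subst (2) Q_def, rule measurable_restrict) (rule *)
  moreover have "(\<lambda>e\<in>lattice_edges. if e \<in> slab f (r i) (r (Suc i)) then 0 else w e) = erase i w"
    if "w \<in> space Q" for w
    using that slab_lattice unfolding Q_def space_PiM PiE_def extensional_def
    by (intro ext) (auto simp: erase_def)
  ultimately show ?thesis by (simp cong: measurable_cong)
qed

lemma erase_depends_on: "depends_on (- slab f (r i) (r (Suc i))) (\<lambda>w. g (erase i w))"
  unfolding depends_on_def by (intro allI impI arg_cong[where f = g]) (auto simp: erase_def)

lemma C_erase_le: "0 \<le> a \<Longrightarrow> a \<le> b \<Longrightarrow> C a b (erase i w) \<le> C a b w"
  unfolding C_def
  by (rule column_time_mono) (use weight_nonneg in \<open>auto simp: erase_def weight_def\<close>)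

lemma C_erase_eq:
  assumes "0 \<le> a" "a \<le> b" "b \<le> r i \<or> r (Suc i) \<le> a"
  shows "C a b (erase i w) = C a b w"
  by (rule depends_onD[OF C_depends_on[OF assms(1,2)]]) (use assms(3) in \<open>auto simp: erase_def slab_def\<close>)

lemma cross_erase: "cross j w \<Longrightarrow> cross j (erase i w)"
proof -
  have *: "weight \<delta> 0 = 0" by (simp add: weight_def)
  assume "cross j w"
  then show "cross j (erase i w)"
    unfolding cross_def by (rule open_crossing_mono) (simp add: erase_def *)
qed

text \<open>Go optimally towards column \<open>r i\<close>, change at the open crossing, and
  continue on an optimal route from the start of the window. If no usable crossing lies beyond
  column \<open>r s\<close>, the window already contains that column and monotonicity
  suffices.\<close>

lemma good_left:
  assumes "good n i d w" "s \<le> i" "r i \<le> y"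
  shows "C (r s) y w \<le> C (r s) (r i) w + C (r (i - d)) y w"
proof -
  have C0: "0 \<le> C (r s) (r i) w" by (simp add: C_nonneg r_nonneg)
  have le: "C (r s) y w \<le> C (r (i - d)) y w" if "i - d \<le> s"
    using that assms r_le[of s i] by (intro C_mono_columns) (auto simp: r_nonneg intro: r_le)
  from assms(1) consider "i \<le> d" | j where "j \<in> {i - d..<i - 1}" "cross j w" unfolding good_def by auto
  then show ?thesis
  proof cases
    case 1
    then show ?thesis using le C0 by simp
  next
    case 2
    show ?thesis
    proof (cases "s \<le> j")
      case True
      have "r (Suc j) \<le> r i" using 2 by (intro r_le) auto
      then have "C (r s) y w \<le> C (r s) (r (Suc j)) w + C (r j) y w"
        using cross_le[OF 2(2), of "r s" y] r_le[OF True] assms(3) r_nonneg by simp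
      also have "C (r s) (r (Suc j)) w \<le> C (r s) (r i) w"
        using True 2 by (intro C_mono_columns) (auto simp: r_nonneg intro: r_le)
      also have "C (r j) y w \<le> C (r (i - d)) y w"
      proof (intro C_mono_columns)
        have "r j \<le> r i" using 2 by (intro r_le) auto
        then show "r j \<le> y" using assms(3) by simp
      qed (use 2 in \<open>auto simp: r_nonneg intro: r_le\<close>)
      finally show ?thesis by simp
    next
      case False
      then have "C (r s) y w \<le> C (r (i - d)) y w" using 2 by (intro le) auto
      then show ?thesis using C0 by simp
    qed
  qed
qed

lemma good_right:
  assumes "good n i d w" "0 \<le> x" "x \<le> r i" "r (Suc i) \<le> y" "y \<le> r (Suc n)"
  shows "C x y w \<le> C x (r (Suc (i + d))) w + C (r (Suc i)) y w"
proof -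
  have xy: "x \<le> y" using assms r_le[of i "Suc i"] by simp
  have C0: "0 \<le> C (r (Suc i)) y w" using assms xy by (simp add: C_nonneg r_nonneg)
  have le: "C x y w \<le> C x (r (Suc (i + d))) w" if "y \<le> r (Suc (i + d))"
    using that assms xy by (intro C_mono_columns) auto
  from assms(1) consider "n \<le> i + d" | j where "j \<in> {Suc i..<Suc i + d}" "cross j w" unfolding good_def by auto
  then show ?thesis
  proof cases
    case 1
    then have "r (Suc n) \<le> r (Suc (i + d))" by (intro r_le) simp
    then show ?thesis using le C0 assms by simp
  next
    case 2
    have jd: "r (Suc j) \<le> r (Suc (i + d))" using 2 by (intro r_le) auto
    have xj: "x \<le> r j" using assms(3) r_le[of i j] 2 by auto
    show ?thesis
    proof (cases "r (Suc j) \<le> y")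
      case True
      have "C x y w \<le> C x (r (Suc j)) w + C (r j) y w"
        using cross_le[OF 2(2), of x y] xj assms(2) True by simp
      also have "C x (r (Suc j)) w \<le> C x (r (Suc (i + d))) w"
        using jd xj r_le[of j "Suc j"] assms(2) by (intro C_mono_columns) auto
      also have "C (r j) y w \<le> C (r (Suc i)) y w"
        using 2 True r_le[of j "Suc j"] by (intro C_mono_columns) (auto simp: r_nonneg intro: r_le)
      finally show ?thesis by simp
    next
      case False
      then show ?thesis using le jd C0 by simp
    qed
  qed
qed

text \<open>Joining optimal routes on both sides of region \<open>i\<close> costs at most the time
  across the window between the crossings: apply \<open>good_left\<close>, then
  \<open>good_right\<close> inside the window.\<close>

lemma junction_le:
  assumes "good n i d w" "s \<le> i" "r (Suc i) \<le> y" "y \<le> r (Suc n)"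
  shows "C (r s) y w - C (r s) (r i) w - C (r (Suc i)) y w \<le> Y i d w"
proof -
  have "C (r s) y w \<le> C (r s) (r i) w + C (r (i - d)) y w"
    using assms r_le[of i "Suc i"] by (intro good_left[OF assms(1,2)]) simp
  moreover have "C (r (i - d)) y w \<le> C (r (i - d)) (r (Suc (i + d))) w + C (r (Suc i)) y w"
    using assms by (intro good_right[OF assms(1)]) (auto simp: r_nonneg intro: r_le)
  ultimately show ?thesis unfolding Y_def by linarith
qed

text \<open>By superadditivity the erased time is at least the sum of the times on both sides of
  region \<open>i\<close>, which erasing leaves unchanged; \<open>junction_le\<close> bounds the
  rest. If \<open>y\<close> falls inside the region, only the left side exists.\<close>

lemma erase_diff_le:
  assumes "good n i d w" "s \<le> i" "r i \<le> y" "y \<le> r (Suc n)"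
  shows "C (r s) y w - C (r s) y (erase i w) \<le> Y i d w"
proof -
  have s: "0 \<le> r s" "r s \<le> r i" using assms(2) by (auto simp: r_nonneg intro: r_le)
  have e1: "C (r s) (r i) (erase i w) = C (r s) (r i) w" using s by (intro C_erase_eq) auto
  have e2: "C (r s) (r i) (erase i w) + C (r i) y (erase i w) \<le> C (r s) y (erase i w)"
    using s assms(3) by (intro C_superadd) auto
  show ?thesis
  proof (cases "r (Suc i) \<le> y")
    case True
    have "C (r (Suc i)) y (erase i w) = C (r (Suc i)) y w"
      using True by (intro C_erase_eq) (auto simp: r_nonneg)
    moreover have "C (r (Suc i)) y (erase i w) \<le> C (r i) y (erase i w)"
      using True by (intro C_mono_columns) (auto simp: r_nonneg intro: r_le)
    ultimately show ?thesis using junction_le[OF assms(1,2) True assms(4)] e1 e2 by linarith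
  next
    case False
    have "C (r (i - d)) y w \<le> Y i d w" unfolding Y_def
      using False assms(3) r_le[of "i - d" i] r_le[of "Suc i" "Suc (i + d)"]
      by (intro C_mono_columns) (auto simp: r_nonneg)
    moreover have "0 \<le> C (r i) y (erase i w)" using assms(3) r_nonneg[of i] by (intro C_nonneg) auto
    ultimately show ?thesis using good_left[OF assms(1-3)] e1 e2 by linarith
  qed
qed

text \<open>If both crossings lie within the group, the exchange identity rewrites the difference
  through times entirely to the left or entirely to the right of region \<open>i\<close>. None of
  these sees the region.\<close>

lemma erase_diff_local:
  assumes g: "good n i d w" and "s \<le> i" "d \<le> i - s" "i + d < e" "e \<le> n" "r n \<le> y"
  shows "C 0 y w - C (r s) (r e) w = C 0 y (erase i w) - C (r s) (r e) (erase i w)"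
proof -
  have y: "r e \<le> y" "r i \<le> y" "r (Suc i) \<le> r e" "r (Suc i) \<le> y" "r s \<le> r i" "r i \<le> r e"
    using assms r_le[of e n] r_le[of i n] r_le[of "Suc i" e] r_le[of s i] r_le[of i e] by auto
  \<comment> \<open>Stated for every \<open>v\<close> that keeps the crossings of \<open>w\<close>,
    since it is applied to \<open>w\<close> itself and to its erased version.\<close>
  have left: "C 0 y v - C (r s) y v = C 0 (r i) v - C (r s) (r i) v"
    if v: "\<And>j. cross j w \<Longrightarrow> cross j v" for v
  proof -
    from g consider "i \<le> d" | j where "j \<in> {i - d..<i - 1}" "cross j w" unfolding good_def by auto
    then show ?thesis
    proof cases
      case 1
      then have "s = 0" using assms(2,3) by auto
      then show ?thesis by (simp add: r_0)
    next
      case 2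
      have "r s \<le> r j" "r (Suc j) \<le> r i" using 2 assms(2,3) by (auto intro!: r_le)
      then have "C 0 y v + C (r s) (r i) v = C 0 (r i) v + C (r s) y v"
        using y r_nonneg by (intro cross_exchange[OF v[OF 2(2)]]) auto
      then show ?thesis by simp
    qed
  qed
  have right: "C (r s) y v - C (r s) (r e) v = C (r (Suc i)) y v - C (r (Suc i)) (r e) v"
    if v: "\<And>j. cross j w \<Longrightarrow> cross j v" for v
  proof -
    from g assms obtain j where j: "j \<in> {Suc i..<Suc i + d}" "cross j w" unfolding good_def by auto
    have "r s \<le> r j" "r (Suc i) \<le> r j" "r (Suc j) \<le> r e" using j assms by (auto intro!: r_le)
    then have "C (r s) y v + C (r (Suc i)) (r e) v = C (r s) (r e) v + C (r (Suc i)) y v"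
      using y r_nonneg by (intro cross_exchange[OF v[OF j(2)]]) auto
    then show ?thesis by simp
  qed
  have "C 0 (r i) (erase i w) = C 0 (r i) w" "C (r s) (r i) (erase i w) = C (r s) (r i) w"
    "C (r (Suc i)) y (erase i w) = C (r (Suc i)) y w" "C (r (Suc i)) (r e) (erase i w) = C (r (Suc i)) (r e) w"
    using y r_nonneg by (auto intro!: C_erase_eq)
  moreover have "C 0 y (erase i w) - C (r s) y (erase i w) = C 0 (r i) (erase i w) - C (r s) (r i) (erase i w)"
    by (rule left) (rule cross_erase)
  moreover have "C (r s) y (erase i w) - C (r s) (r e) (erase i w) = C (r (Suc i)) y (erase i w) - C (r (Suc i)) (r e) (erase i w)"
    by (rule right) (rule cross_erase)
  ultimately show ?thesis using left[of w] right[of w] by linarith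
qed

text \<open>Only the \<open>m\<close> complete groups are subtracted; the remainder up to
  \<open>y\<close> is paid for by the second term in \<open>variance_D_le\<close>.\<close>

definition D :: "nat \<Rightarrow> nat \<Rightarrow> int \<Rightarrow> (edge \<Rightarrow> real) \<Rightarrow> real" where
  "D L m y w = C 0 y w - (\<Sum>k<m. C (r (k * L)) (r (Suc k * L)) w)"

text \<open>Radius \<open>n\<close> is always good, as it reaches both ends; a least good radius is
  bad by minimality.\<close>

lemma exists_good:
  assumes "i \<le> n"
  obtains d where "d \<le> n" "good n i d w" "bad n i d w" "\<And>d'. good n i d' w \<Longrightarrow> d \<le> d'"
proof -
  have g: "good n i n w" using assms by (simp add: good_def)
  define d where "d = (LEAST d. good n i d w)"
  have "good n i d w" unfolding d_def by (rule LeastI[of "\<lambda>d. good n i d w", OF g])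
  moreover have least: "d \<le> d'" if "good n i d' w" for d' unfolding d_def by (rule Least_le[of "\<lambda>d. good n i d w", OF that])
  moreover have "bad n i d w" unfolding bad_def using least[of "d - 1"] by (cases d) auto
  ultimately show thesis using that least[OF g] by blast
qed

text \<open>The least good radius is random; summing over all admissible radii gives a bound whose
  expectation can be taken term by term.\<close>

lemma bad_Y_member:
  assumes "l \<le> d" "d \<le> n" "bad n i d w" "\<bar>z\<bar> \<le> Y i d w"
  shows "z\<^sup>2 \<le> (\<Sum>d=l..n. of_bool (bad n i d w) * (Y i d w)\<^sup>2)"
proof -
  have "z\<^sup>2 \<le> of_bool (bad n i d w) * (Y i d w)\<^sup>2"
    using assms(3,4) by (simp add: abs_le_square_iff[symmetric])
  also have "\<dots> \<le> (\<Sum>d=l..n. of_bool (bad n i d w) * (Y i d w)\<^sup>2)"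
    using assms by (intro member_le_sum) auto
  finally show ?thesis .
qed

text \<open>The least radius at which the window may leave the group of region \<open>i\<close>; a
  smaller good radius has no effect on \<open>D\<close>. Outside the complete groups nothing is
  compensated, hence 0.\<close>

definition depth :: "nat \<Rightarrow> nat \<Rightarrow> nat \<Rightarrow> nat" where
  "depth L m i = (if i < m * L then Suc (min (i mod L) (L - 1 - i mod L)) else 0)"

text \<open>A good radius below \<open>depth\<close> gives no change, by
  \<open>erase_diff_local\<close>. Otherwise the total time and the time of the group both drop by
  an amount between 0 and \<open>Y\<close>, so their difference is at most \<open>Y\<close> in
  absolute value.\<close>

lemma D_erase_le:
  assumes L: "0 < L" "m * L \<le> n" and y: "r n \<le> y" "y \<le> r (Suc n)" and i: "i \<le> n"
  shows "(D L m y w - D L m y (erase i w))\<^sup>2 \<le> (\<Sum>d=depth L m i..n. of_bool (bad n i d w) * (Y i d w)\<^sup>2)"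
proof -
  obtain d where d: "d \<le> n" "good n i d w" "bad n i d w" by (rule exists_good[OF i])
  let ?Z = "\<lambda>k. C (r (k * L)) (r (Suc k * L))"
  have y0: "r i \<le> y" "0 \<le> y" using y r_le[OF i] r_nonneg[of n] by auto
  have T: "0 \<le> C 0 y w - C 0 y (erase i w)" "C 0 y w - C 0 y (erase i w) \<le> Y i d w"
    using C_erase_le[of 0 y i w] y0 erase_diff_le[OF d(2) _ y0(1) y(2), of 0] by (auto simp: r_0)
  show ?thesis
  proof (cases "i < m * L")
    case False
    have "?Z k (erase i w) = ?Z k w" if "k < m" for k
    proof (rule C_erase_eq)
      have "Suc k * L \<le> m * L" using that by (intro mult_le_mono1) simp
      then show "r (Suc k * L) \<le> r i \<or> r (Suc i) \<le> r (k * L)" using False by (intro disjI1 r_le) simp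
    qed (auto simp: r_nonneg intro: r_le)
    then have "D L m y w - D L m y (erase i w) = C 0 y w - C 0 y (erase i w)"
      unfolding D_def by simp
    then show ?thesis using T d False by (intro bad_Y_member[OF _ d(1,3)]) (auto simp: depth_def)
  next
    case True
    define k where "k = i div L"
    let ?s = "k * L" and ?e = "Suc k * L"
    have k: "k < m" unfolding k_def using True L(1) by (simp add: less_mult_imp_div_less)
    have imod: "i = ?s + i mod L" "i mod L < L" unfolding k_def using L(1) by auto
    have si: "?s \<le> i" "i < ?e" using imod by (linarith, simp)
    have "?e \<le> m * L" using k by (intro mult_le_mono1) simp
    then have en: "?e \<le> n" using L(2) by simp
    have other: "?Z l (erase i w) = ?Z l w" if "l \<noteq> k" for l
    proof (rule C_erase_eq)
      show "r (Suc l * L) \<le> r i \<or> r (Suc i) \<le> r (l * L)"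
      proof (cases "l < k")
        case True
        then have "Suc l * L \<le> k * L" by (intro mult_le_mono1) simp
        then show ?thesis using si by (intro disjI1 r_le) simp
      next
        case False
        then have "Suc k * L \<le> l * L" using that by (intro mult_le_mono1) simp
        then show ?thesis using si by (intro disjI2 r_le) simp
      qed
    qed (auto simp: r_nonneg intro: r_le)
    have split: "(\<Sum>l<m. ?Z l v) = ?Z k v + (\<Sum>l\<in>{..<m} - {k}. ?Z l v)" for v
      using k by (simp add: sum.remove)
    have "(\<Sum>l\<in>{..<m} - {k}. ?Z l (erase i w)) = (\<Sum>l\<in>{..<m} - {k}. ?Z l w)"
      using other by (intro sum.cong) auto
    then have Deq: "D L m y w - D L m y (erase i w) = (C 0 y w - C 0 y (erase i w)) - (?Z k w - ?Z k (erase i w))"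
      unfolding D_def split by simp
    show ?thesis
    proof (cases "depth L m i \<le> d")
      case True
      have le: "r ?s \<le> r ?e" "r i \<le> r ?e" "r ?e \<le> r (Suc n)"
        by (rule r_le; use si en in simp)+
      have Z: "0 \<le> ?Z k w - ?Z k (erase i w)" "?Z k w - ?Z k (erase i w) \<le> Y i d w"
        using C_erase_le[OF r_nonneg le(1), of i w] erase_diff_le[OF d(2) si(1) le(2,3)] by linarith+
      show ?thesis using T Z Deq by (intro bad_Y_member[OF True d(1,3)]) linarith
    next
      case False
      then have "d \<le> i mod L" "d \<le> L - 1 - i mod L" using \<open>i < m * L\<close> by (auto simp: depth_def)
      then have "d \<le> i - ?s" "i + d < ?e" using imod by auto
      then have "C 0 y w - ?Z k w = C 0 y (erase i w) - ?Z k (erase i w)"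
        using erase_diff_local[OF d(2) si(1) _ _ en y(1)] by blast
      then have "D L m y w - D L m y (erase i w) = 0" using Deq by linarith
      then show ?thesis by (simp add: sum_nonneg)
    qed
  qed
qed

lemma D_measurable [measurable]: "D L m y \<in> borel_measurable Q"
  unfolding D_def[abs_def] by measurable

lemma C_erase_square_integrable:
  assumes "0 \<le> a" "a \<le> b"
  shows "integrable Q (\<lambda>w. (C a b (erase i w))\<^sup>2)"
proof (rule Bochner_Integration.integrable_bound[OF C_square_integrable[OF assms]])
  have "norm ((C a b (erase i w))\<^sup>2) \<le> norm ((C a b w)\<^sup>2)" for w
    using C_erase_le[OF assms, of i w] C_nonneg[of a b "erase i w"] assms by (simp add: power_mono)
  then show "AE w in Q. norm ((C a b (erase i w))\<^sup>2) \<le> norm ((C a b w)\<^sup>2)" by simp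
qed (use erase_measurable in measurable)

lemma D_square_integrable:
  assumes "0 \<le> y"
  shows "integrable Q (\<lambda>w. (D L m y w)\<^sup>2)" "integrable Q (\<lambda>w. (D L m y (erase i w))\<^sup>2)"
proof -
  have k: "r (k * L) \<le> r (Suc k * L)" for k by (intro r_le) simp
  show "integrable Q (\<lambda>w. (D L m y w)\<^sup>2)" unfolding D_def
    by (intro Q.square_integrable_diff Q.square_integrable_sum C_square_integrable borel_measurable_sum C_measurable)
       (use assms k r_nonneg in auto)
  have [measurable]: "(\<lambda>w. C a b (erase i w)) \<in> borel_measurable Q" for a b
    using measurable_compose[OF erase_measurable C_measurable] .
  show "integrable Q (\<lambda>w. (D L m y (erase i w))\<^sup>2)" unfolding D_def
    by (intro Q.square_integrable_diff Q.square_integrable_sum C_erase_square_integrable borel_measurable_sum)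
       (use assms k r_nonneg in auto)
qed

lemma disjoint_blocks: "disjoint_family_on (\<lambda>k. slab f (r (k * L)) (r (Suc k * L))) A"
proof -
  have "slab f (r (k * L)) (r (Suc k * L)) \<inter> slab f (r (l * L)) (r (Suc l * L)) = {}" if "k < l" for k l
  proof -
    have "Suc k * L \<le> l * L" using that by (intro mult_le_mono1) simp
    then have "r (Suc k * L) \<le> r (l * L)" by (rule r_le)
    then show ?thesis by (auto simp: slab_def)
  qed
  then show ?thesis unfolding disjoint_family_on_def by (metis Int_commute linorder_neqE_nat)
qed

text \<open>By \<open>efron_stein\<close> region \<open>i\<close> contributes at most 2 B
  \<open>\<sigma>\<close>^depth / (1 - \<open>\<sigma>\<close>). Depth counts from both ends of a
  group, so each group contributes two geometric series, while each remaining region has depth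
  0.\<close>

lemma variance_D_le:
  assumes "0 < \<sigma>" "\<sigma> < 1" "0 \<le> B"
    and B: "\<And>n i d. Q.expectation (\<lambda>w. of_bool (bad n i d w) * (Y i d w)\<^sup>2) \<le> B * \<sigma> ^ d"
    and L: "0 < L" "m * L \<le> n" and y: "r n \<le> y" "y \<le> r (Suc n)"
  shows "Q.variance (D L m y) \<le> 4 * B / (1 - \<sigma>)\<^sup>2 * real m + 2 * B / (1 - \<sigma>) * real (Suc n - m * L)"
proof -
  have y0: "0 \<le> y" using y r_nonneg[of n] by simp
  have "Q.variance (D L m y) \<le> 2 * (\<Sum>i<Suc n. Q.expectation (\<lambda>w. (D L m y w - D L m y (erase i w))\<^sup>2))"
  proof (rule efron_stein[where B = "\<lambda>i. slab f (r i) (r (Suc i))"])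
    have "depends_on (slab f 0 (r (Suc n))) (D L m y)"
    proof -
      have dd: "C 0 y w = C 0 y w'" "(\<Sum>k<m. C (r (k * L)) (r (Suc k * L)) w) = (\<Sum>k<m. C (r (k * L)) (r (Suc k * L)) w')"
        if eq: "\<forall>e\<in>slab f 0 (r (Suc n)). w e = w' e" for w w'
      proof -
        show "C 0 y w = C 0 y w'"
          by (rule depends_onD[OF depends_on_mono[OF C_depends_on slab_mono[OF order_refl y(2)]]]) (use y0 eq in auto)
        show "(\<Sum>k<m. C (r (k * L)) (r (Suc k * L)) w) = (\<Sum>k<m. C (r (k * L)) (r (Suc k * L)) w')"
        proof (rule sum.cong[OF refl])
          fix k assume "k \<in> {..<m}"
          then have "Suc k * L \<le> m * L" by (intro mult_le_mono1) simp
          then have "r (Suc k * L) \<le> r (Suc n)" using L by (intro r_le) simp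
          then have sub: "slab f (r (k * L)) (r (Suc k * L)) \<subseteq> slab f 0 (r (Suc n))"
            by (rule slab_mono[OF r_nonneg])
          show "C (r (k * L)) (r (Suc k * L)) w = C (r (k * L)) (r (Suc k * L)) w'"
            by (rule depends_onD[OF C_depends_on[OF r_nonneg]]) (use eq sub in \<open>auto intro: r_le\<close>)
        qed
      qed
      show ?thesis unfolding depends_on_def D_def
        by (intro allI impI arg_cong2[where f = "(-)"]) (erule dd)+
    qed
    moreover have "(\<Union>i<Suc n. slab f (r i) (r (Suc i))) = slab f 0 (r (Suc n))"
    proof -
      have "(\<Union>i<k. slab f (r i) (r (Suc i))) = slab f 0 (r k)" for k
      proof (induction k)
        case (Suc k)
        have "slab f 0 (r (Suc k)) = slab f 0 (r k) \<union> slab f (r k) (r (Suc k))"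
          using r_le[of k "Suc k"] r_nonneg[of k] by (auto simp: slab_def)
        then show ?case using Suc by (auto simp: lessThan_Suc)
      qed (auto simp: r_0 slab_def)
      then show ?thesis .
    qed
    ultimately show "depends_on (\<Union>i<Suc n. slab f (r i) (r (Suc i))) (D L m y)" by simp
    show "disjoint_family_on (\<lambda>i. slab f (r i) (r (Suc i))) {..<Suc n}" using disjoint_blocks[of 1] by simp
    show "(\<lambda>w. D L m y (erase i w)) \<in> borel_measurable Q" for i
      using measurable_compose[OF erase_measurable D_measurable] .
  qed (use y0 D_square_integrable slab_lattice erase_depends_on in auto)
  also have "(\<Sum>i<Suc n. Q.expectation (\<lambda>w. (D L m y w - D L m y (erase i w))\<^sup>2)) \<le> (\<Sum>i<Suc n. B / (1 - \<sigma>) * \<sigma> ^ depth L m i)"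
  proof (rule sum_mono)
    fix i assume "i \<in> {..<Suc n}"
    then have i: "i \<le> n" by simp
    have "Q.expectation (\<lambda>w. (D L m y w - D L m y (erase i w))\<^sup>2) \<le>
        Q.expectation (\<lambda>w. \<Sum>d=depth L m i..n. of_bool (bad n i d w) * (Y i d w)\<^sup>2)"
    proof (rule integral_mono)
      show "integrable Q (\<lambda>w. (D L m y w - D L m y (erase i w))\<^sup>2)"
        using y0 D_square_integrable measurable_compose[OF erase_measurable D_measurable]
        by (intro Q.square_integrable_diff) auto
      show "integrable Q (\<lambda>w. \<Sum>d=depth L m i..n. of_bool (bad n i d w) * (Y i d w)\<^sup>2)"
        by (intro Bochner_Integration.integrable_sum bad_Y_integrable)
    qed (rule D_erase_le[OF L y i])
    also have "\<dots> = (\<Sum>d=depth L m i..n. Q.expectation (\<lambda>w. of_bool (bad n i d w) * (Y i d w)\<^sup>2))"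
      by (rule Bochner_Integration.integral_sum) (rule bad_Y_integrable)
    also have "\<dots> \<le> (\<Sum>d=depth L m i..n. B * \<sigma> ^ d)" by (rule sum_mono) (rule B)
    also have "\<dots> = B * (\<Sum>d=depth L m i..n. \<sigma> ^ d)" by (simp add: sum_distrib_left)
    also have "\<dots> \<le> B * (\<sigma> ^ depth L m i / (1 - \<sigma>))"
      using assms(1-3) by (intro mult_left_mono sum_power_le) auto
    finally show "Q.expectation (\<lambda>w. (D L m y w - D L m y (erase i w))\<^sup>2) \<le> B / (1 - \<sigma>) * \<sigma> ^ depth L m i" by simp
  qed
  also have "(\<Sum>i<Suc n. B / (1 - \<sigma>) * \<sigma> ^ depth L m i) = B / (1 - \<sigma>) * (\<Sum>i<Suc n. \<sigma> ^ depth L m i)"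
    by (rule sum_distrib_left[symmetric])
  finally have V: "Q.variance (D L m y) \<le> 2 * (B / (1 - \<sigma>) * (\<Sum>i<Suc n. \<sigma> ^ depth L m i))" by simp
  have "(\<Sum>i<Suc n. \<sigma> ^ depth L m i) = (\<Sum>i<m * L. \<sigma> ^ depth L m i) + (\<Sum>t<Suc n - m * L. \<sigma> ^ depth L m (m * L + t))"
    using sum_lessThan_add[of "\<lambda>i. \<sigma> ^ depth L m i" "m * L" "Suc n - m * L"] L(2) by simp
  also have "(\<Sum>t<Suc n - m * L. \<sigma> ^ depth L m (m * L + t)) = real (Suc n - m * L)" by (simp add: depth_def)
  \<comment> \<open>The \<open>Suc\<close> in \<open>depth\<close> is given up, and the power at the
    minimum is bounded by the sum of the powers at both distances.\<close>
  also have "(\<Sum>i<m * L. \<sigma> ^ depth L m i) \<le> (\<Sum>i<m * L. \<sigma> ^ (i mod L) + \<sigma> ^ (L - Suc (i mod L)))"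
  proof (rule sum_mono)
    fix i assume "i \<in> {..<m * L}"
    then have "\<sigma> ^ depth L m i \<le> \<sigma> ^ min (i mod L) (L - Suc (i mod L))"
      using assms(1,2) by (intro power_decreasing) (auto simp: depth_def)
    also have "\<dots> \<le> \<sigma> ^ (i mod L) + \<sigma> ^ (L - Suc (i mod L))"
      using assms(1) by (auto simp: min_def)
    finally show "\<sigma> ^ depth L m i \<le> \<sigma> ^ (i mod L) + \<sigma> ^ (L - Suc (i mod L))" .
  qed
  also have "\<dots> = real m * (\<Sum>t<L. \<sigma> ^ t + \<sigma> ^ (L - Suc t))"
    by (rule sum_periodic[of "\<lambda>t. \<sigma> ^ t + \<sigma> ^ (L - Suc t)"])
  also have "(\<Sum>t<L. \<sigma> ^ t + \<sigma> ^ (L - Suc t)) = 2 * (\<Sum>t<L. \<sigma> ^ t)"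
    by (simp add: sum.distrib sum.nat_diff_reindex[of "\<lambda>t. \<sigma> ^ t" L])
  also have "real m * (2 * (\<Sum>t<L. \<sigma> ^ t)) \<le> real m * (2 * (1 / (1 - \<sigma>)))"
    using assms(1,2) by (intro mult_left_mono sum_power_le) auto
  finally have "2 * (B / (1 - \<sigma>) * (\<Sum>i<Suc n. \<sigma> ^ depth L m i)) \<le>
      2 * (B / (1 - \<sigma>) * (real m * (2 * (1 / (1 - \<sigma>))) + real (Suc n - m * L)))"
    using assms(1-3) by (intro mult_left_mono) auto
  with V have "Q.variance (D L m y) \<le> 2 * (B / (1 - \<sigma>) * (real m * (2 * (1 / (1 - \<sigma>))) + real (Suc n - m * L)))"
    by (rule order_trans)
  also have "\<dots> = 4 * B / (1 - \<sigma>)\<^sup>2 * real m + 2 * B / (1 - \<sigma>) * real (Suc n - m * L)"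
  proof -
    have "2 * (B / x * (a * (2 * (1 / x)) + b)) = 4 * B / x\<^sup>2 * a + 2 * B / x * b" if "x \<noteq> 0" for x a b :: real
      using that by (simp add: field_simps power2_eq_square)
    then show ?thesis using assms(2) by simp
  qed
  finally show ?thesis .
qed

text \<open>A bound on the second moment is already available from the bad windows, and z \<le> 1 +
  z^2 turns it into one on the mean, uniform in \<open>i\<close>, \<open>n\<close> and
  \<open>y\<close>.\<close>

lemma junction_expectation_le:
  assumes "0 < \<sigma>" "\<sigma> < 1" "0 \<le> B"
    and B: "\<And>n i d. Q.expectation (\<lambda>w. of_bool (bad n i d w) * (Y i d w)\<^sup>2) \<le> B * \<sigma> ^ d"
    and i: "i < n" and y: "r n \<le> y" "y \<le> r (Suc n)"
  shows "Q.expectation (\<lambda>w. C 0 y w - C 0 (r i) w - C (r (Suc i)) y w) \<le> 1 + B / (1 - \<sigma>)"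
proof -
  let ?J = "\<lambda>w. C 0 y w - C 0 (r i) w - C (r (Suc i)) y w"
  have iy: "r (Suc i) \<le> y" "r i \<le> r (Suc i)" "0 \<le> y" "0 \<le> r i" "0 \<le> r (Suc i)"
    using r_le[of "Suc i" n] r_le[of i "Suc i"] i y r_nonneg[of "Suc i"] r_nonneg[of i] by auto
  have pt: "?J w \<le> 1 + (\<Sum>d=0..n. of_bool (bad n i d w) * (Y i d w)\<^sup>2)" for w
  proof -
    obtain d where d: "d \<le> n" "good n i d w" "bad n i d w" using exists_good[of i n w] i by auto
    have "C 0 (r i) w + C (r i) y w \<le> C 0 y w" using iy by (intro C_superadd) auto
    moreover have "C (r (Suc i)) y w \<le> C (r i) y w" using iy by (intro C_mono_columns) auto
    ultimately have "0 \<le> ?J w" by simp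
    moreover have "?J w \<le> Y i d w" using junction_le[OF d(2), of 0 y] iy y by (simp add: r_0)
    ultimately have "(?J w)\<^sup>2 \<le> (\<Sum>d=0..n. of_bool (bad n i d w) * (Y i d w)\<^sup>2)"
      by (intro bad_Y_member[OF _ d(1,3)]) auto
    moreover have "z \<le> 1 + z\<^sup>2" for z :: real
    proof -
      have "2 * z \<le> z\<^sup>2 + 1" using sum_squares_bound[of z 1] by simp
      then show ?thesis using zero_le_power2[of z] by linarith
    qed
    ultimately show ?thesis using order_trans[of "?J w" "1 + (?J w)\<^sup>2"] by simp
  qed
  have "Q.expectation ?J \<le> Q.expectation (\<lambda>w. 1 + (\<Sum>d=0..n. of_bool (bad n i d w) * (Y i d w)\<^sup>2))"
    using iy by (intro integral_mono pt Bochner_Integration.integrable_diff Bochner_Integration.integrable_add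
      Bochner_Integration.integrable_sum bad_Y_integrable C_integrable) auto
  also have "\<dots> = 1 + (\<Sum>d=0..n. Q.expectation (\<lambda>w. of_bool (bad n i d w) * (Y i d w)\<^sup>2))"
  proof -
    have si: "integrable Q (\<lambda>w. \<Sum>d=0..n. of_bool (bad n i d w) * (Y i d w)\<^sup>2)"
      by (intro Bochner_Integration.integrable_sum bad_Y_integrable)
    have "Q.expectation (\<lambda>w. 1 + (\<Sum>d=0..n. of_bool (bad n i d w) * (Y i d w)\<^sup>2)) =
        1 + Q.expectation (\<lambda>w. \<Sum>d=0..n. of_bool (bad n i d w) * (Y i d w)\<^sup>2)"
      by (subst Bochner_Integration.integral_add[OF _ si]) (simp_all add: Q.prob_space)
    also have "Q.expectation (\<lambda>w. \<Sum>d=0..n. of_bool (bad n i d w) * (Y i d w)\<^sup>2) =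
        (\<Sum>d=0..n. Q.expectation (\<lambda>w. of_bool (bad n i d w) * (Y i d w)\<^sup>2))"
      by (rule Bochner_Integration.integral_sum) (rule bad_Y_integrable)
    finally show ?thesis .
  qed
  also have "\<dots> \<le> 1 + (\<Sum>d=0..n. B * \<sigma> ^ d)" by (intro add_left_mono sum_mono) (rule B)
  also have "\<dots> = 1 + B * (\<Sum>d=0..n. \<sigma> ^ d)" by (simp add: sum_distrib_left)
  also have "\<dots> \<le> 1 + B * (\<sigma> ^ 0 / (1 - \<sigma>))"
    using assms(1-3) by (intro add_left_mono mult_left_mono sum_power_le) auto
  finally show ?thesis by simp
qed

text \<open>Making one block slow increases the passage time by more than the expected junction cost, and
  these events are independent for different blocks.\<close>

lemma variance_lower_bound:
  obtains \<epsilon> i1 where "0 < \<epsilon>"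
    "\<And>n y. r n \<le> y \<Longrightarrow> y \<le> r (Suc n) \<Longrightarrow> \<epsilon> * real (n - i1) \<le> Q.variance (C 0 y)"
proof -
  obtain \<sigma> B where sB: "0 < \<sigma>" "\<sigma> < 1" "0 \<le> B"
    "\<And>n i d. Q.expectation (\<lambda>w. of_bool (bad n i d w) * (Y i d w)\<^sup>2) \<le> B * \<sigma> ^ d"
    by (rule bad_Y_moment) (rule that)
  define b where "b = 1 + B / (1 - \<sigma>)"
  have b0: "0 \<le> b" using sB by (simp add: b_def)
  \<comment> \<open>The level makes the time across a slow region at least \<open>b + 1\<close>
    after multiplication by \<open>\<delta>\<close>, one more than the bound \<open>b\<close> for
    the mean junction cost.\<close>
  obtain \<epsilon> i1 where ei: "0 < \<epsilon>" "\<And>i. i1 \<le> i \<Longrightarrow> \<epsilon> \<le> Q.prob {w \<in> space Q. (b + 1) / \<delta> \<le> N (r i) (r (Suc i)) w}"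
    using block_time[of "(b + 1) / \<delta>"] b0 delta_pos by auto
  have "\<epsilon> * real (n - i1) \<le> Q.variance (C 0 y)" if y: "r n \<le> y" "y \<le> r (Suc n)" for n y
  proof -
    have y0: "0 \<le> y" using y r_nonneg[of n] by simp
    define G where "G i = {w \<in> space Q. b + 1 \<le> C (r i) (r (Suc i)) w}" for i
    have Gdep: "depends_on (slab f (r i) (r (Suc i))) (\<lambda>w. b + 1 \<le> C (r i) (r (Suc i)) w)" for i
      by (rule depends_on_compose[OF C_depends_on]) (auto simp: r_nonneg intro: r_le)
    have Gm[measurable]: "G i \<in> sets Q" for i unfolding G_def by measurable
    have "real (n - i1) * \<epsilon> = (\<Sum>i\<in>{i1..<n}. \<epsilon>)" by simp
    also have "\<dots> \<le> (\<Sum>i\<in>{i1..<n}. Q.prob (G i))"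
    proof (rule sum_mono)
      fix i assume "i \<in> {i1..<n}"
      then have "\<epsilon> \<le> Q.prob {w \<in> space Q. (b + 1) / \<delta> \<le> N (r i) (r (Suc i)) w}" using ei by simp
      also have "\<dots> \<le> Q.prob (G i)"
      proof (rule Q.finite_measure_mono[OF _ Gm])
        have "b + 1 \<le> C (r i) (r (Suc i)) w" if "(b + 1) / \<delta> \<le> N (r i) (r (Suc i)) w" for w
          using that C_ge_N[of "r i" "r (Suc i)" w] delta_pos r_nonneg[of i] r_le[of i "Suc i"]
          by (simp add: pos_divide_le_eq mult.commute)
        then show "{w \<in> space Q. (b + 1) / \<delta> \<le> N (r i) (r (Suc i)) w} \<subseteq> G i" unfolding G_def by auto
      qed
      finally show "\<epsilon> \<le> Q.prob (G i)" .
    qed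
    also have "\<dots> \<le> Q.variance (C 0 y)"
    proof (rule Q.variance_ge_sum_prob)
      fix i j :: nat assume "i \<noteq> j"
      then have "slab f (r i) (r (Suc i)) \<inter> slab f (r j) (r (Suc j)) = {}"
        using disjoint_family_onD[OF disjoint_blocks[of 1 UNIV], of i j] by simp
      then have "Q.prob {w \<in> space Q. b + 1 \<le> C (r i) (r (Suc i)) w \<and> b + 1 \<le> C (r j) (r (Suc j)) w} = Q.prob (G i) * Q.prob (G j)"
        unfolding G_def using slab_lattice by (intro prob_Int_depends_on[OF _ _ Gdep Gdep]) auto
      moreover have "G i \<inter> G j = {w \<in> space Q. b + 1 \<le> C (r i) (r (Suc i)) w \<and> b + 1 \<le> C (r j) (r (Suc j)) w}"
        unfolding G_def by auto
      ultimately show "Q.prob (G i \<inter> G j) = Q.prob (G i) * Q.prob (G j)" by simp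
    next
      fix i assume "i \<in> {i1..<n}"
      then have i: "i < n" by simp
      have iy: "r (Suc i) \<le> y" "r i \<le> r (Suc i)" "0 \<le> r i" "0 \<le> r (Suc i)"
        using r_le[of "Suc i" n] r_le[of i "Suc i"] i y r_nonneg[of "Suc i"] r_nonneg[of i] by auto
      let ?g = "\<lambda>w. of_bool (b + 1 \<le> C (r i) (r (Suc i)) w) :: real"
      define J where "J w = C 0 y w - C 0 (r i) w - C (r (Suc i)) y w" for w
      have int: "integrable Q (C 0 y)" "integrable Q (C 0 (r i))" "integrable Q (C (r (Suc i)) y)"
        using iy y0 by (auto intro!: C_integrable)
      have Ji: "integrable Q J" unfolding J_def using int by simp
      have gi: "integrable Q ?g" by (rule Q.integrable_const_bound[of _ 1]) auto
      have Eg: "Q.expectation ?g = Q.prob (G i)"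
      proof -
        have "Q.expectation ?g = Q.expectation (indicator (G i))"
          by (intro Bochner_Integration.integral_cong refl) (auto simp: indicator_def G_def)
        then show ?thesis by simp
      qed
      have gd: "depends_on (slab f (r i) (r (Suc i))) ?g" by (rule depends_on_compose[OF Gdep])
      have dis: "slab f 0 (r i) \<inter> slab f (r i) (r (Suc i)) = {}" "slab f (r (Suc i)) y \<inter> slab f (r i) (r (Suc i)) = {}"
        by (auto simp: slab_def)
      note E1 = expectation_mult_depends_on[OF int(2) gi C_depends_on[OF order_refl iy(3)] gd slab_lattice slab_lattice dis(1)]
      note E2 = expectation_mult_depends_on[OF int(3) gi C_depends_on[OF iy(4) iy(1)] gd slab_lattice slab_lattice dis(2)]
      have Jg: "integrable Q (\<lambda>w. J w * ?g w)"
        by (rule Bochner_Integration.integrable_bound[OF Ji]) (use Ji in auto)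
      have J_ge: "C (r i) (r (Suc i)) w \<le> J w" for w
      proof -
        have "C 0 (r i) w + C (r i) y w \<le> C 0 y w" using iy by (intro C_superadd) auto
        moreover have "C (r i) (r (Suc i)) w + C (r (Suc i)) y w \<le> C (r i) y w" using iy by (intro C_superadd) auto
        ultimately show ?thesis unfolding J_def by simp
      qed
      \<comment> \<open>The times on the two sides are independent of \<open>G i\<close>, so only
        \<open>J\<close> contributes to the covariance. On \<open>G i\<close> it is at least
        \<open>b + 1\<close>, while its mean is at most \<open>b\<close>.\<close>
      have "Q.expectation (\<lambda>w. C 0 y w * indicator (G i) w) = Q.expectation (\<lambda>w. J w * ?g w + (C 0 (r i) w * ?g w + C (r (Suc i)) y w * ?g w))"
        by (intro Bochner_Integration.integral_cong refl) (auto simp: J_def G_def indicator_def)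
      also have "\<dots> = Q.expectation (\<lambda>w. J w * ?g w) + (Q.expectation (C 0 (r i)) * Q.prob (G i) + Q.expectation (C (r (Suc i)) y) * Q.prob (G i))"
        using Jg E1 E2 Eg by simp
      finally have eq: "Q.expectation (\<lambda>w. C 0 y w * indicator (G i) w) - Q.expectation (C 0 y) * Q.prob (G i) =
          Q.expectation (\<lambda>w. J w * ?g w) - Q.expectation J * Q.prob (G i)"
        unfolding J_def using int by (simp add: algebra_simps)
      have "(b + 1) * Q.prob (G i) = Q.expectation (\<lambda>w. (b + 1) * ?g w)" using Eg by simp
      also have "\<dots> \<le> Q.expectation (\<lambda>w. J w * ?g w)"
      proof (rule integral_mono[OF _ Jg])
        show "(b + 1) * ?g w \<le> J w * ?g w" for w using J_ge[of w] by (cases "b + 1 \<le> C (r i) (r (Suc i)) w") auto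
      qed (use gi in simp)
      finally have 1: "(b + 1) * Q.prob (G i) \<le> Q.expectation (\<lambda>w. J w * ?g w)" .
      have "Q.expectation J * Q.prob (G i) \<le> b * Q.prob (G i)"
        unfolding J_def b_def using junction_expectation_le[OF sB i y] by (intro mult_right_mono) auto
      then show "Q.prob (G i) \<le> Q.expectation (\<lambda>w. C 0 y w * indicator (G i) w) - Q.expectation (C 0 y) * Q.prob (G i)"
        unfolding eq using 1 by (simp add: algebra_simps)
    qed (use y0 in \<open>auto intro: C_square_integrable\<close>)
    finally show ?thesis by (simp add: mult.commute)
  qed
  with ei(1) show thesis using that by blast
qed

section \<open>The limit theorem for the product environment\<close>

lemma block_index:
  assumes "0 \<le> y"
  obtains n where "r n \<le> y" "y < r (Suc n)"
proof -
  have "int k \<le> r k" for k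
  proof (induction k)
    case (Suc k)
    then show ?case using r_less[of k "Suc k"] by simp
  qed (simp add: r_0)
  from this[of "Suc (nat y)"] have ex: "\<exists>k. y < r (Suc k)" using assms by (intro exI[of _ "nat y"]) auto
  define n where "n = (LEAST k. y < r (Suc k))"
  have "y < r (Suc n)" unfolding n_def by (rule LeastI_ex[OF ex])
  moreover have "r n \<le> y"
  proof (cases n)
    case (Suc n')
    then have "\<not> y < r (Suc n')" using not_less_Least[of n' "\<lambda>k. y < r (Suc k)"] unfolding n_def by simp
    then show ?thesis using Suc by simp
  qed (use assms r_0 in simp)
  ultimately show thesis using that by blast
qed

theorem column_time_clt:
  "weak_conv_m (\<lambda>n. distr Q borel (\<lambda>w. (C 0 (int n) w - Q.expectation (C 0 (int n))) / sqrt (Q.variance (C 0 (int n)))))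
    std_normal_distribution"
proof (rule Q.clt_of_block_approximation[where T = "\<lambda>n. C 0 (int n)"])
  obtain \<epsilon> i1 where ei: "0 < \<epsilon>"
    "\<And>n y. r n \<le> y \<Longrightarrow> y \<le> r (Suc n) \<Longrightarrow> \<epsilon> * real (n - i1) \<le> Q.variance (C 0 y)"
    by (rule variance_lower_bound) (rule that)
  obtain \<sigma> B where sB: "0 < \<sigma>" "\<sigma> < 1" "0 \<le> B"
    "\<And>n i d. Q.expectation (\<lambda>w. of_bool (bad n i d w) * (Y i d w)\<^sup>2) \<le> B * \<sigma> ^ d"
    by (rule bad_Y_moment) (rule that)
  have large: "\<forall>\<^sub>F n in sequentially. \<exists>k\<ge>k0. r k \<le> int n \<and> int n \<le> r (Suc k)" for k0
    unfolding eventually_sequentially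
  proof (rule exI[of _ "nat (r k0)"], rule allI, rule impI)
    fix n assume "nat (r k0) \<le> n"
    then have n: "r k0 \<le> int n" by simp
    obtain k where k: "r k \<le> int n" "int n < r (Suc k)" using block_index[of "int n"] by auto
    have "k0 \<le> k"
    proof (rule ccontr)
      assume "\<not> k0 \<le> k"
      then have "r (Suc k) \<le> r k0" by (intro r_le) simp
      then show False using n k by simp
    qed
    then show "\<exists>k\<ge>k0. r k \<le> int n \<and> int n \<le> r (Suc k)" using k by auto
  qed
  show "C 0 (int n) \<in> borel_measurable Q" for n by (rule C_measurable)
  show "integrable Q (\<lambda>w. (C 0 (int n) w)\<^sup>2)" for n by (rule C_square_integrable) simp_all
  show "filterlim (\<lambda>n. Q.variance (C 0 (int n))) at_top sequentially"
    unfolding filterlim_at_top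
  proof
    fix Z :: real
    define k0 where "k0 = i1 + nat \<lceil>Z / \<epsilon>\<rceil>"
    show "\<forall>\<^sub>F n in sequentially. Z \<le> Q.variance (C 0 (int n))"
      using large[of k0]
    proof eventually_elim
      case (elim n)
      then obtain k where k: "k0 \<le> k" "r k \<le> int n" "int n \<le> r (Suc k)" by blast
      have "Z / \<epsilon> \<le> real (k - i1)" using k(1) unfolding k0_def by linarith
      then have "Z \<le> \<epsilon> * real (k - i1)" using ei(1) by (simp add: pos_divide_le_eq mult.commute)
      also have "\<dots> \<le> Q.variance (C 0 (int n))" by (rule ei(2)[OF k(2,3)])
      finally show ?case .
    qed
  qed
  fix \<epsilon>' :: real assume e': "0 < \<epsilon>'"
  define K1 where "K1 = 4 * B / (1 - \<sigma>)\<^sup>2"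
  define K2 where "K2 = 2 * B / (1 - \<sigma>)"
  have K0: "0 \<le> K1" "0 \<le> K2" using sB by (auto simp: K1_def K2_def)
  \<comment> \<open>Both error terms will be at most \<open>g\<close> times the number
    \<open>k\<close> of regions. Since the variance is at least \<open>\<epsilon> * k / 2\<close>,
    their sum 2 g k is then at most the allowed fraction \<open>\<epsilon>'\<^sup>2\<close> of
    it.\<close>
  define g where "g = \<epsilon>'\<^sup>2 * \<epsilon> / 4"
  have g: "0 < g" using e' ei(1) by (simp add: g_def)
  define L where "L = Suc (nat \<lceil>K1 / g\<rceil>)"
  have L: "0 < L" "K1 \<le> g * real L"
  proof -
    have "K1 / g \<le> real L" unfolding L_def by linarith
    then show "K1 \<le> g * real L" using g by (simp add: pos_divide_le_eq mult.commute)
  qed (simp add: L_def)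
  \<comment> \<open>Twice \<open>i1\<close> makes \<open>k - i1\<close> at least half of
    \<open>k\<close>; the other term makes the incomplete group of at most \<open>L\<close> regions
    negligible.\<close>
  define k0 where "k0 = 2 * i1 + nat \<lceil>K2 * real L / g\<rceil>"
  have nn: "0 \<le> M4 * real L ^ 4" "0 \<le> 2 / \<epsilon>" using M4_nonneg ei(1) by auto
  show "\<exists>B'\<ge>0. \<exists>C'\<ge>0. \<forall>\<^sub>F n in sequentially. \<exists>J (Z :: nat \<Rightarrow> (edge \<Rightarrow> real) \<Rightarrow> real).
      finite J \<and> Q.indep_vars (\<lambda>_. borel) Z J \<and>
      (\<forall>k\<in>J. integrable Q (\<lambda>x. Z k x ^ 4) \<and> Q.expectation (\<lambda>x. Z k x ^ 4) \<le> B') \<and>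
      real (card J) \<le> C' * Q.variance (C 0 (int n)) \<and>
      Q.variance (\<lambda>x. C 0 (int n) x - (\<Sum>k\<in>J. Z k x)) \<le> \<epsilon>'\<^sup>2 * Q.variance (C 0 (int n))"
  proof (rule exI[of _ "M4 * real L ^ 4"], rule conjI[OF nn(1)], rule exI[of _ "2 / \<epsilon>"], rule conjI[OF nn(2)])
    show "\<forall>\<^sub>F n in sequentially. \<exists>J (Z :: nat \<Rightarrow> (edge \<Rightarrow> real) \<Rightarrow> real).
      finite J \<and> Q.indep_vars (\<lambda>_. borel) Z J \<and>
      (\<forall>k\<in>J. integrable Q (\<lambda>x. Z k x ^ 4) \<and> Q.expectation (\<lambda>x. Z k x ^ 4) \<le> M4 * real L ^ 4) \<and>
      real (card J) \<le> 2 / \<epsilon> * Q.variance (C 0 (int n)) \<and>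
      Q.variance (\<lambda>x. C 0 (int n) x - (\<Sum>k\<in>J. Z k x)) \<le> \<epsilon>'\<^sup>2 * Q.variance (C 0 (int n))"
      using large[of k0]
    proof eventually_elim
      case (elim n)
      then obtain k where k: "k0 \<le> k" "r k \<le> int n" "int n \<le> r (Suc k)" by blast
      define m where "m = k div L"
      have mL: "m * L \<le> k" "Suc k - m * L \<le> L" unfolding m_def using L(1)
        by (simp_all add: minus_div_mult_eq_mod Suc_diff_le Suc_leI)
      have "2 * i1 \<le> k" using k(1) unfolding k0_def by simp
      then have half: "real k / 2 \<le> real (k - i1)" by (simp add: of_nat_diff)
      have "\<epsilon> * (real k / 2) \<le> \<epsilon> * real (k - i1)" using half ei(1) by (intro mult_left_mono) auto
      also have "\<dots> \<le> Q.variance (C 0 (int n))" by (rule ei(2)[OF k(2,3)])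
      finally have var: "\<epsilon> * real k / 2 \<le> Q.variance (C 0 (int n))" by simp
      let ?Z = "\<lambda>j. C (r (j * L)) (r (Suc j * L))"
      have jle: "r (j * L) \<le> r (Suc j * L)" for j by (intro r_le) simp
      have ind: "Q.indep_vars (\<lambda>_. borel) ?Z {..<m}"
        by (rule indep_vars_depends_on[where K = "\<lambda>j. slab f (r (j * L)) (r (Suc j * L))"])
           (use jle r_nonneg slab_lattice disjoint_blocks in \<open>auto intro!: C_depends_on\<close>)
      have mom: "integrable Q (\<lambda>x. ?Z j x ^ 4)" "Q.expectation (\<lambda>x. ?Z j x ^ 4) \<le> M4 * real L ^ 4" for j
        using C_moment4(1)[OF r_nonneg jle] C_block_moment4[of "j * L" "Suc j * L"] by auto
      have crd: "real m \<le> 2 / \<epsilon> * Q.variance (C 0 (int n))"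
      proof -
        have "real m \<le> real k" unfolding m_def by simp
        also have "\<dots> \<le> 2 / \<epsilon> * Q.variance (C 0 (int n))" using var ei(1) by (simp add: field_simps)
        finally show ?thesis .
      qed
      have vr: "Q.variance (\<lambda>x. C 0 (int n) x - (\<Sum>j<m. ?Z j x)) \<le> \<epsilon>'\<^sup>2 * Q.variance (C 0 (int n))"
      proof -
        have "Q.variance (\<lambda>x. C 0 (int n) x - (\<Sum>j<m. ?Z j x)) \<le> K1 * real m + K2 * real (Suc k - m * L)"
          using variance_D_le[OF sB L(1) mL(1) k(2,3)] unfolding D_def K1_def K2_def by simp
        also have "\<dots> \<le> g * real k + g * real k"
        proof (rule add_mono)
          have "K1 * real m \<le> g * real L * real m" using L(2) by (intro mult_right_mono) auto
          also have "\<dots> = g * real (m * L)" by (simp add: mult_ac)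
          also have "\<dots> \<le> g * real k" 
          proof (rule mult_left_mono)
            show "real (m * L) \<le> real k" using mL(1) by (simp only: of_nat_le_iff)
          qed (use g in simp)
          finally show "K1 * real m \<le> g * real k" .
          have "K2 * real (Suc k - m * L) \<le> K2 * real L" using mL(2) K0 by (intro mult_left_mono) auto
          also have "K2 * real L \<le> g * real k"
          proof -
            have "K2 * real L / g \<le> real k" using k(1) unfolding k0_def by linarith
            then show ?thesis using g by (simp add: pos_divide_le_eq mult.commute)
          qed
          finally show "K2 * real (Suc k - m * L) \<le> g * real k" .
        qed
        also have "\<dots> = \<epsilon>'\<^sup>2 * (\<epsilon> * real k / 2)" by (simp add: g_def)
        also have "\<dots> \<le> \<epsilon>'\<^sup>2 * Q.variance (C 0 (int n))" using var by (intro mult_left_mono) auto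
        finally show ?thesis .
      qed
      show ?case
      proof (rule exI[of _ "{..<m}"], rule exI[of _ ?Z], intro conjI)
        show "\<forall>j\<in>{..<m}. integrable Q (\<lambda>x. ?Z j x ^ 4) \<and> Q.expectation (\<lambda>x. ?Z j x ^ 4) \<le> M4 * real L ^ 4"
          using mom by blast
        show "real (card {..<m}) \<le> 2 / \<epsilon> * Q.variance (C 0 (int n))" using crd by simp
      qed (use ind vr in simp_all)
    qed
  qed
qed

end

section \<open>Transfer to the original probability space\<close>

lemma T_set_set_cong:
  assumes "\<And>e. e \<in> E f \<Longrightarrow> w e = w' e"
  shows "T_set_set f w S S' = T_set_set f w' S S'"
proof -
  have "passage_time w g = passage_time w' g" if "is_path f g" for g
    using that assms by (intro passage_time_cong) (auto simp: is_path_def)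
  then have "T_pt_pt f w x y = T_pt_pt f w' x y" for x y
    unfolding T_pt_pt_def by (intro INF_cong) auto
  then show ?thesis unfolding T_set_set_def T_pt_set_def by simp
qed

text \<open>Since \<open>f 0 = 0\<close>, column 0 consists of the origin alone.\<close>

lemma (in wedge) T_pt_set_origin:
  assumes "f 0 = 0"
  shows "T_pt_set f w (0, 0) (P n) = column_time f 0 n w"
proof -
  have "P 0 \<inter> V f = {(0, 0)}" using assms by (auto simp: P_def V_def)
  then show ?thesis unfolding column_time_def T_set_set_def by simp
qed

lemma two_point_distribution_unique:
  fixes \<mu> \<mu>' :: "real measure"
  assumes "prob_space \<mu>" "prob_space \<mu>'" "sets \<mu> = sets borel" "sets \<mu>' = sets borel"
    and "measure \<mu> {0} = p" "measure \<mu>' {0} = p" "measure \<mu> {1} = 1 - p" "measure \<mu>' {1} = 1 - p"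
  shows "\<mu> = \<mu>'"
proof -
  have *: "measure m A = of_bool (0 \<in> A) * p + of_bool (1 \<in> A) * (1 - p)"
    if m: "prob_space m" "sets m = sets borel" "measure m {0} = p" "measure m {1} = 1 - p" and A: "A \<in> sets borel"
    for m :: "real measure" and A
  proof -
    interpret prob_space m by fact
    have sp: "space m = UNIV" using sets_eq_imp_space_eq[OF m(2)] by simp
    have one: "measure m ({0} \<union> {1}) = 1"
      using m by (subst finite_measure_Union) auto
    then have z: "measure m (UNIV - ({0} \<union> {1})) = 0"
      using prob_compl[of "{0} \<union> {1}"] m(2) sp by simp
    have "measure m (A - ({0} \<union> {1})) \<le> measure m (UNIV - ({0} \<union> {1}))"
      using m(2) by (intro finite_measure_mono) auto
    then have z': "measure m (A - ({0} \<union> {1})) = 0" using z measure_nonneg[of m "A - ({0} \<union> {1})"] by linarith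
    have "measure m A = measure m ((A - ({0} \<union> {1})) \<union> ((A \<inter> {0}) \<union> (A \<inter> {1})))"
      by (rule arg_cong[where f = "measure m"]) auto
    also have "\<dots> = measure m (A - ({0} \<union> {1})) + measure m ((A \<inter> {0}) \<union> (A \<inter> {1}))"
      using m(2) A by (intro finite_measure_Union) auto
    also have "measure m ((A \<inter> {0}) \<union> (A \<inter> {1})) = measure m (A \<inter> {0}) + measure m (A \<inter> {1})"
      using m(2) A by (intro finite_measure_Union) auto
    also have "measure m (A \<inter> {0}) = of_bool (0 \<in> A) * p" using m(3) by (cases "0 \<in> A") auto
    also have "measure m (A \<inter> {1}) = of_bool (1 \<in> A) * (1 - p)" using m(4) by (cases "1 \<in> A") auto
    finally show ?thesis using z' by simp
  qed
  interpret m1: prob_space \<mu> by fact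
  interpret m2: prob_space \<mu>' by fact
  show ?thesis
    by (rule measure_eqI) (use assms * in \<open>auto simp: m1.emeasure_eq_measure m2.emeasure_eq_measure\<close>)
qed

lemma (in prob_space) distr_indep_family:
  assumes "indep_vars (\<lambda>_. borel) X I" "I \<noteq> {}" "\<And>i. i \<in> I \<Longrightarrow> distr M borel (X i) = \<mu>"
  shows "distr M (PiM I (\<lambda>_. borel)) (\<lambda>\<omega>. \<lambda>i\<in>I. X i \<omega>) = PiM I (\<lambda>_. \<mu>)"
proof -
  have "distr M (PiM I (\<lambda>_. borel)) (\<lambda>\<omega>. \<lambda>i\<in>I. X i \<omega>) = (\<Pi>\<^sub>M i\<in>I. distr M borel (X i))"
  proof -
    have "random_variable borel (X i)" if "i \<in> I" for i using assms(1) that by (auto simp: indep_vars_def)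
    then show ?thesis using indep_vars_iff_distr_eq_PiM'[OF assms(2), where M' = "\<lambda>_. borel" and X = X] assms(1) by blast
  qed
  also have "\<dots> = PiM I (\<lambda>_. \<mu>)" using assms(3) by (intro PiM_cong) auto
  finally show ?thesis .
qed

lemma countable_lattice_edges: "countable lattice_edges"
proof (rule countable_subset)
  show "lattice_edges \<subseteq> (\<lambda>(u, v). {u, v}) ` (UNIV :: (vertex \<times> vertex) set)"
    unfolding lattice_edges_def by auto
qed auto

lemma lattice_edges_nonempty: "lattice_edges \<noteq> {}"
proof -
  have "{(0, 0), (1, 0)} \<in> lattice_edges" by (simp add: lattice_edges_iff)
  then show ?thesis by blast
qed

lemma weight_eq_0_iff: "0 < \<delta> \<Longrightarrow> weight \<delta> x = 0 \<longleftrightarrow> bern x = 0"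
  by (auto simp: weight_def bern_def max_def)

lemma weight_power4_le:
  assumes "0 < \<delta>" "4 < \<eta>"
  shows "weight \<delta> x ^ 4 \<le> \<delta> ^ 4 + 1 + x powr \<eta>"
proof (cases "x \<le> \<delta>")
  case True
  then have "weight \<delta> x ^ 4 \<le> \<delta> ^ 4" using assms(1) by (auto simp: weight_def max_def intro: power_mono)
  then show ?thesis using powr_ge_zero[of x \<eta>] by linarith
next
  case False
  then have x: "0 < x" "weight \<delta> x = x" using assms(1) by (auto simp: weight_def)
  have "x ^ 4 \<le> 1 + x powr \<eta>"
  proof (cases "x \<le> 1")
    case True
    then have "x ^ 4 \<le> 1" using x by (intro power_le_one) auto
    then show ?thesis using powr_ge_zero[of x \<eta>] by linarith
  next
    case False
    have "x ^ 4 = x powr 4" using x by (simp add: powr_numeral)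
    also have "\<dots> \<le> x powr \<eta>" using False assms(2) by (intro powr_mono) auto
    finally show ?thesis by simp
  qed
  moreover have "0 \<le> \<delta> ^ 4" using assms(1) by simp
  ultimately show ?thesis unfolding x(2) by linarith
qed

text \<open>Turns the limsup in A2 into a bound for every index by absorbing finitely many
  exceptions.\<close>

lemma ex_nat_upper_bound:
  fixes u :: "nat \<Rightarrow> real"
  assumes "\<forall>\<^sub>F i in sequentially. u i < b"
  shows "\<exists>K::nat. 0 < K \<and> (\<forall>i. u i \<le> real K)"
proof -
  obtain n where n: "\<And>i. n \<le> i \<Longrightarrow> u i < b" using assms unfolding eventually_sequentially by blast
  have "u i \<le> max b (Max (u ` {..n}))" for i
  proof (cases "n \<le> i")
    case True
    then show ?thesis using n[of i] by simp
  next
    case False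
    then have "u i \<le> Max (u ` {..n})" by (intro Max_ge) auto
    then show ?thesis by simp
  qed
  then have "u i \<le> real (Suc (nat \<lceil>max b (Max (u ` {..n}))\<rceil>))" for i
    using of_nat_ceiling[of "max b (Max (u ` {..n}))"] by (rule order_trans[OF _ order_trans]) simp
  then show ?thesis by blast
qed

theorem theorem1p6:
  fixes M :: "'a measure"
    and F :: "real \<Rightarrow> real"
    and \<tau> t :: "edge \<Rightarrow> 'a \<Rightarrow> real"
    and f :: "real \<Rightarrow> real"
    and r :: "nat \<Rightarrow> int"
    and p \<delta> \<eta> k1 K2 :: real
    and k3 :: "real \<Rightarrow> real"
  assumes "prob_space M"
    and F_distribution_function: "right_continuous_mono F 0 1"
    and F_0_minus: "(F \<longlongrightarrow> 0) (at_left 0)"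
    and F_gap: "\<delta> > 0" "F 0 = p" "F \<delta> = p"
    and p_range: "1 / 2 \<le> p" "p < 1"
    and F_moment: "\<eta> > 4" "(\<integral>\<^sup>+ x. ennreal (x powr \<eta>) \<partial>interval_measure F) < \<infinity>"
    and tau_indep: "prob_space.indep_vars M (\<lambda>_. borel) \<tau> lattice_edges"
    and tau_distribution: "\<And>e. e \<in> lattice_edges \<Longrightarrow> cdf (distr M borel (\<tau> e)) = F"
    and t_indep: "prob_space.indep_vars M (\<lambda>_. borel) t lattice_edges"
    and t_distribution:
      "\<And>e. e \<in> lattice_edges \<Longrightarrow> measure M {\<omega> \<in> space M. t e \<omega> = 0} = p"
      "\<And>e. e \<in> lattice_edges \<Longrightarrow> measure M {\<omega> \<in> space M. t e \<omega> = 1} = 1 - p"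
    and f: "\<And>x. x \<ge> 0 \<Longrightarrow> f x \<ge> 0" "f 0 = 0"
    and r: "r 0 = 0" "strict_mono r"
    and k1: "k1 > 0" and K2: "K2 \<ge> 1" and k3: "\<And>m. m \<ge> 0 \<Longrightarrow> k3 m > 0"
    and "A1 M t f r k1" and "A2 M t f r K2" and "A3 M t f r k3"
  shows "weak_conv_m
    (\<lambda>n. let T = \<lambda>\<omega>. T_pt_set f (\<lambda>e. \<tau> e \<omega>) (0, 0) (P (int n))
         in distr M borel (\<lambda>\<omega>. (T \<omega> - prob_space.expectation M T) / sqrt (prob_space.variance M T)))
    std_normal_distribution"
proof -
  interpret M: prob_space M by fact
  interpret F: right_continuous_mono F 0 1 by fact
  let ?L = lattice_edges
  define \<nu> where "\<nu> = interval_measure F"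
  have Fm: "\<And>x y. x \<le> y \<Longrightarrow> F x \<le> F y" using F.mono by (auto simp: mono_def)
  interpret nu: real_distribution \<nu>
    unfolding \<nu>_def by (rule real_distribution_interval_measure[OF Fm F.cont F.bot F.top])
  have cdf_nu: "cdf \<nu> = F" unfolding \<nu>_def by (rule cdf_interval_measure[OF Fm F.cont F.bot])
  have sets_nu: "sets \<nu> = sets borel" by simp
  have taum: "\<tau> e \<in> borel_measurable M" if "e \<in> ?L" for e using tau_indep that by (auto simp: M.indep_vars_def)
  have tm: "t e \<in> borel_measurable M" if "e \<in> ?L" for e using t_indep that by (auto simp: M.indep_vars_def)
  have tau_law: "distr M borel (\<tau> e) = \<nu>" if e: "e \<in> ?L" for e
  proof (rule cdf_unique)
    show "real_distribution (distr M borel (\<tau> e))" by (rule M.real_distribution_distr) (rule taum[OF e])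
    show "cdf (distr M borel (\<tau> e)) = cdf \<nu>" using tau_distribution[OF e] cdf_nu by simp
  qed unfold_locales
  have nu_le0: "measure \<nu> {..0} = p" using cdf_nu F_gap(2) by (simp add: cdf_def2[symmetric])
  have nu_neg: "measure \<nu> {..<0} = 0"
    using tendsto_unique[OF _ nu.cdf_at_left[of 0]] F_0_minus unfolding cdf_nu by simp
  have nu_gap: "measure \<nu> {0<..\<delta>} = 0"
    using nu.cdf_diff_eq[of 0 \<delta>] F_gap unfolding cdf_nu by simp
  \<comment> \<open>The two null sets come from F(0-) = 0 and from the gap F(0) =
    F(\<open>\<delta>\<close>).\<close>
  have weight_AE: "AE x in \<nu>. weight \<delta> x = x"
  proof -
    have "AE x in \<nu>. x \<notin> {..<0} \<union> {0<..\<delta>}"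
    proof (rule AE_not_in)
      have "{..<0} \<in> null_sets \<nu>" "{0<..\<delta>} \<in> null_sets \<nu>"
        using nu_neg nu_gap by (auto simp: null_sets_def nu.emeasure_eq_measure)
      then show "{..<0} \<union> {0<..\<delta>} \<in> null_sets \<nu>" by auto
    qed
    then show ?thesis by eventually_elim (auto simp: weight_def not_less)
  qed
  have wd: "wedge f" by unfold_locales (rule f(1))
  have model: "fpp_model f \<nu> \<delta>"
  proof (intro fpp_model.intro wd iid_product.intro fpp_model_axioms.intro)
    show "prob_space \<nu>" by unfold_locales
    show "integrable \<nu> (\<lambda>x. weight \<delta> x ^ 4)"
    proof (rule integrableI_bounded)
      have "(\<integral>\<^sup>+ x. ennreal (norm (weight \<delta> x ^ 4)) \<partial>\<nu>) \<le> (\<integral>\<^sup>+ x. ennreal (\<delta> ^ 4 + 1) + ennreal (x powr \<eta>) \<partial>\<nu>)"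
        using weight_power4_le[OF F_gap(1) F_moment(1)] F_gap(1)
        by (intro nn_integral_mono) (simp add: ennreal_plus[symmetric] del: ennreal_plus)
      also have "\<dots> = ennreal (\<delta> ^ 4 + 1) + (\<integral>\<^sup>+ x. ennreal (x powr \<eta>) \<partial>\<nu>)"
      proof (subst nn_integral_add)
        have "emeasure \<nu> UNIV = 1" using nu.emeasure_space_1 by simp
        then show "(\<integral>\<^sup>+ x. ennreal (\<delta> ^ 4 + 1) \<partial>\<nu>) + (\<integral>\<^sup>+ x. ennreal (x powr \<eta>) \<partial>\<nu>) =
            ennreal (\<delta> ^ 4 + 1) + (\<integral>\<^sup>+ x. ennreal (x powr \<eta>) \<partial>\<nu>)" by simp
      qed auto
      also have "\<dots> < \<infinity>" using F_moment(2) unfolding \<nu>_def by (simp add: ennreal_add_less_top)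
      finally show "(\<integral>\<^sup>+ x. ennreal (norm (weight \<delta> x ^ 4)) \<partial>\<nu>) < \<infinity>" .
    qed simp
  qed (use F_gap nu_le0 p_range sets_nu in auto)
  interpret fpp_model f \<nu> \<delta> by (rule model)
  have setsQ: "sets (PiM ?L (\<lambda>_. \<nu>)) = sets (PiM ?L (\<lambda>_. borel))" by (intro sets_PiM_cong) auto

  \<comment> \<open>Nothing is assumed about the joint law of \<open>t\<close> and
    \<open>\<tau>\<close>, so \<open>t\<close> is replaced by a family with the same law that is
    coupled to the weights of law \<open>F\<close>.\<close>
  have bern_law: "distr M borel (t e) = distr \<nu> borel bern" if e: "e \<in> ?L" for e
  proof (rule two_point_distribution_unique)
    note [measurable] = tm[OF e]
    show "prob_space (distr M borel (t e))" by (rule M.prob_space_distr) simp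
    show "prob_space (distr \<nu> borel bern)" by (rule nu.prob_space_distr) simp
    have "t e -` {0} \<inter> space M = {\<omega> \<in> space M. t e \<omega> = 0}" "t e -` {1} \<inter> space M = {\<omega> \<in> space M. t e \<omega> = 1}" by auto
    then show "measure (distr M borel (t e)) {0} = p" "measure (distr M borel (t e)) {1} = 1 - p"
      using t_distribution[OF e] by (simp_all add: measure_distr)
    have "bern -` {0} = {..0}" "bern -` {1} = space \<nu> - {..0}" by (auto simp: bern_def split: if_splits)
    then show "measure (distr \<nu> borel bern) {0} = p" "measure (distr \<nu> borel bern) {1} = 1 - p"
      using nu_le0 nu.prob_compl[of "{..0}"] by (simp_all add: measure_distr)
  qed simp_all
  have Q_bern: "Q.indep_vars (\<lambda>_. borel) (\<lambda>e w. bern (w e)) ?L"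
    by (rule Q.indep_vars_compose2[OF indep_coordinates]) simp
  have Q_bern_law: "distr Q borel (\<lambda>w. bern (w e)) = distr \<nu> borel bern" if e: "e \<in> ?L" for e
  proof -
    have "(\<lambda>w. w e) \<in> measurable Q \<nu>"
      using coordinate_measurable[OF e] measurable_cong_sets[OF refl sets_nu] by blast
    then have "distr Q borel (\<lambda>w. bern (w e)) = distr (distr Q \<nu> (\<lambda>w. w e)) borel bern"
      by (subst distr_distr) (auto simp: comp_def)
    then show ?thesis using distr_coordinate[OF e] by simp
  qed
  let ?B = "PiM ?L (\<lambda>_. borel :: real measure)"
  have law_t: "distr M ?B (\<lambda>\<omega>. \<lambda>e\<in>?L. t e \<omega>) = distr Q ?B (\<lambda>w. \<lambda>e\<in>?L. bern (w e))"
    using M.distr_indep_family[OF t_indep lattice_edges_nonempty bern_law]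
      Q.distr_indep_family[OF Q_bern lattice_edges_nonempty Q_bern_law] by simp
  have law_tau: "distr M ?B (\<lambda>\<omega>. \<lambda>e\<in>?L. \<tau> e \<omega>) = Q"
    unfolding Q_def by (rule M.distr_indep_family[OF tau_indep lattice_edges_nonempty tau_law])
  have tM: "(\<lambda>\<omega>. \<lambda>e\<in>?L. t e \<omega>) \<in> measurable M ?B" by (intro measurable_restrict tm)
  have tauM: "(\<lambda>\<omega>. \<lambda>e\<in>?L. \<tau> e \<omega>) \<in> measurable M ?B" by (intro measurable_restrict taum)
  have bM: "(\<lambda>w. \<lambda>e\<in>?L. bern (w e)) \<in> measurable Q ?B"
    by (intro measurable_restrict measurable_compose[OF coordinate_measurable bern_measurable])
  have E_lattice: "e \<in> ?L" if "e \<in> E f" for e using that by (simp add: E_def)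
  have compm: "(\<lambda>v. v e) \<in> borel_measurable ?B" if "e \<in> E f" for e
    using E_lattice[OF that] by (rule measurable_component_singleton)
  have Tm: "(\<lambda>v. T_set_set f v S S') \<in> borel_measurable ?B" for S S'
    by (rule T_set_set_measurable[where W = "\<lambda>e v. v e"]) (rule compm)
  \<comment> \<open>Environments on the product space are restricted to lattice edges, whereas
    \<open>t\<close> and \<open>\<tau>\<close> are families over all vertex sets; passage times see
    only \<open>E f\<close>.\<close>
  have Tres: "T_set_set f (\<lambda>e\<in>?L. v e) S S' = T_set_set f v S S'" for v S S'
    by (rule T_set_set_cong) (use E_lattice in simp)
  have cres: "open_crossing f u u' (\<lambda>e\<in>?L. v e) \<longleftrightarrow> open_crossing f u u' v" for u u' v
    by (auto elim!: open_crossing_mono dest: E_lattice)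
  have cm: "Measurable.pred ?B (open_crossing f u u')" for u u'
    by (rule open_crossing_measurable[where W = "\<lambda>e v. v e"]) (rule compm)

  have exp_t: "M.expectation (\<lambda>\<omega>. T_pt_set f (\<lambda>e. t e \<omega>) (0, 0) (P n)) = Q.expectation (N 0 n)" for n
  proof -
    have "M.expectation (\<lambda>\<omega>. T_pt_set f (\<lambda>e. t e \<omega>) (0, 0) (P n)) =
        integral\<^sup>L (distr M ?B (\<lambda>\<omega>. \<lambda>e\<in>?L. t e \<omega>)) (\<lambda>v. T_set_set f v (P 0) (P n))"
      using integral_distr[OF tM Tm] by (simp add: Tres T_pt_set_origin[OF f(2)] column_time_def)
    also have "\<dots> = Q.expectation (N 0 n)"
      unfolding law_t using integral_distr[OF bM Tm] by (simp add: Tres N_def[abs_def] column_time_def)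
    finally show ?thesis .
  qed
  have prob_t: "measure M {\<omega> \<in> space M. pr (\<lambda>e. t e \<omega>)} = Q.prob {w \<in> space Q. pr (\<lambda>e. bern (w e))}"
    if pm: "Measurable.pred ?B pr" and pres: "\<And>v. pr (\<lambda>e\<in>?L. v e) \<longleftrightarrow> pr v" for pr
  proof -
    have s: "{v \<in> space ?B. pr v} \<in> sets ?B" using pm by simp
    have "(\<lambda>\<omega>. \<lambda>e\<in>?L. t e \<omega>) -` {v \<in> space ?B. pr v} \<inter> space M = {\<omega> \<in> space M. pr (\<lambda>e. t e \<omega>)}"
      using measurable_space[OF tM] by (auto simp: pres)
    moreover have "(\<lambda>w. \<lambda>e\<in>?L. bern (w e)) -` {v \<in> space ?B. pr v} \<inter> space Q = {w \<in> space Q. pr (\<lambda>e. bern (w e))}"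
      using measurable_space[OF bM] by (auto simp: pres)
    ultimately show ?thesis
      using measure_distr[OF tM s] measure_distr[OF bM s] law_t by simp
  qed
  have cross_prob: "measure M {\<omega> \<in> space M. \<exists>\<gamma>. top_down_crossing f r i \<gamma> \<and> open_path (\<lambda>e. t e \<omega>) \<gamma>} =
    Q.prob {w \<in> space Q. open_crossing f (r i) (r (Suc i)) (\<lambda>e. weight \<delta> (w e))}" for i
  proof -
    have "open_crossing f (r i) (r (Suc i)) (\<lambda>e. weight \<delta> (w e)) \<longleftrightarrow> open_crossing f (r i) (r (Suc i)) (\<lambda>e. bern (w e))" for w
      using weight_eq_0_iff[OF F_gap(1)] by (auto elim!: open_crossing_mono)
    then show ?thesis unfolding open_crossing_iff using prob_t[OF cm cres] by simp
  qed
  have time_prob: "measure M {\<omega> \<in> space M. T_set_set f (\<lambda>e. t e \<omega>) (P (r i)) (P (r (Suc i))) \<ge> m} =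
    Q.prob {w \<in> space Q. m \<le> N (r i) (r (Suc i)) w}" for i m
    using prob_t[of "\<lambda>v. m \<le> T_set_set f v (P (r i)) (P (r (Suc i)))"] Tm
    by (simp add: Tres N_def column_time_def)

  have "ereal (k1 / 2) < ereal k1" using k1 by simp
  also have "ereal k1 \<le> liminf (\<lambda>i. ereal (Q.prob {w \<in> space Q. open_crossing f (r i) (r (Suc i)) (\<lambda>e. weight \<delta> (w e))}))"
    using \<open>A1 M t f r k1\<close> unfolding A1_def cross_prob .
  finally have "\<forall>\<^sub>F i in sequentially. k1 / 2 < Q.prob {w \<in> space Q. open_crossing f (r i) (r (Suc i)) (\<lambda>e. weight \<delta> (w e))}"
    by (auto dest: less_LiminfD)
  then obtain i0 where i0: "\<And>i. i0 \<le> i \<Longrightarrow> k1 / 2 < Q.prob {w \<in> space Q. open_crossing f (r i) (r (Suc i)) (\<lambda>e. weight \<delta> (w e))}"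
    unfolding eventually_sequentially by blast

  have "limsup (\<lambda>i. ereal (Q.expectation (N 0 (r (Suc i))) - Q.expectation (N 0 (r i)))) \<le> ereal K2"
    using \<open>A2 M t f r K2\<close> unfolding A2_def exp_t .
  also have "ereal K2 < ereal (K2 + 1)" by simp
  finally have "\<forall>\<^sub>F i in sequentially. Q.expectation (N 0 (r (Suc i))) - Q.expectation (N 0 (r i)) < K2 + 1"
    by (auto dest: Limsup_lessD)
  from ex_nat_upper_bound[OF this] obtain K :: nat where
    K: "0 < K" "\<And>i. Q.expectation (N 0 (r (Suc i))) - Q.expectation (N 0 (r i)) \<le> real K" by blast

  have blocks: "\<exists>\<epsilon>>0. \<exists>i1. \<forall>i\<ge>i1. \<epsilon> \<le> Q.prob {w \<in> space Q. m \<le> N (r i) (r (Suc i)) w}" if m: "0 \<le> m" for m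
  proof -
    have "ereal (k3 m / 2) < ereal (k3 m)" using k3[OF m] by simp
    also have "ereal (k3 m) \<le> liminf (\<lambda>i. ereal (Q.prob {w \<in> space Q. m \<le> N (r i) (r (Suc i)) w}))"
      using \<open>A3 M t f r k3\<close> m unfolding A3_def time_prob by blast
    finally have "\<forall>\<^sub>F i in sequentially. k3 m / 2 < Q.prob {w \<in> space Q. m \<le> N (r i) (r (Suc i)) w}"
      by (auto dest: less_LiminfD)
    then show ?thesis using k3[OF m] unfolding eventually_sequentially
      by (intro exI[of _ "k3 m / 2"]) (auto intro: less_imp_le)
  qed
  \<comment> \<open>The minimum with 1/2 keeps the crossing probability \<open>c\<close> below
    1.\<close>
  interpret fpp_blocks f \<nu> \<delta> r "min (k1 / 2) (1 / 2)" i0 K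
  proof unfold_locales
    show "min (k1 / 2) (1 / 2) \<le> Q.prob {w \<in> space Q. open_crossing f (r i) (r (Suc i)) (\<lambda>e. weight \<delta> (w e))}"
      if "i0 \<le> i" for i using i0[OF that] by simp
  qed (use r k1 K blocks in auto)

  \<comment> \<open>There are countably many edges, so the exceptional null sets can be
    joined.\<close>
  have AE_w: "AE w in Q. \<forall>e\<in>?L. weight \<delta> (w e) = w e"
  proof (rule AE_ball_countable'[OF _ countable_lattice_edges])
    fix e assume e: "e \<in> ?L"
    have m: "(\<lambda>w. w e) \<in> measurable Q \<nu>"
      using coordinate_measurable[OF e] measurable_cong_sets[OF refl sets_nu] by blast
    have "AE x in distr Q \<nu> (\<lambda>w. w e). weight \<delta> x = x" unfolding distr_coordinate[OF e] by (rule weight_AE)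
    then show "AE w in Q. weight \<delta> (w e) = w e" by (rule AE_distrD[OF m])
  qed
  have TC: "AE w in Q. T_set_set f w (P 0) (P n) = C 0 n w" for n
    using AE_w
  proof eventually_elim
    case (elim w)
    then show ?case unfolding C_def column_time_def by (intro T_set_set_cong) (auto dest: E_lattice)
  qed
  have TmQ: "(\<lambda>w. T_set_set f w S S') \<in> borel_measurable Q" for S S'
    using Tm measurable_cong_sets[OF setsQ refl] unfolding Q_def by blast
  have transfer: "M.expectation (\<lambda>\<omega>. h (T_pt_set f (\<lambda>e. \<tau> e \<omega>) (0, 0) (P n))) = Q.expectation (\<lambda>w. h (C 0 n w))"
    if [measurable]: "h \<in> borel_measurable borel" for h :: "real \<Rightarrow> real" and n
  proof -
    have "M.expectation (\<lambda>\<omega>. h (T_pt_set f (\<lambda>e. \<tau> e \<omega>) (0, 0) (P n))) =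
        integral\<^sup>L (distr M ?B (\<lambda>\<omega>. \<lambda>e\<in>?L. \<tau> e \<omega>)) (\<lambda>v. h (T_set_set f v (P 0) (P n)))"
      using integral_distr[OF tauM measurable_compose[OF Tm that]] by (simp add: Tres T_pt_set_origin[OF f(2)] column_time_def)
    also have "\<dots> = Q.expectation (\<lambda>w. h (C 0 n w))"
      unfolding law_tau
    proof (rule integral_cong_AE)
      show "AE w in Q. h (T_set_set f w (P 0) (P n)) = h (C 0 n w)" using TC[of n] by eventually_elim simp
    qed (use TmQ in auto)
    finally show ?thesis .
  qed
  have law_T: "distr M borel (\<lambda>\<omega>. h (T_pt_set f (\<lambda>e. \<tau> e \<omega>) (0, 0) (P n))) = distr Q borel (\<lambda>w. h (C 0 n w))"
    if h[measurable]: "h \<in> borel_measurable borel" for h :: "real \<Rightarrow> real" and n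
  proof -
    have "distr M borel (\<lambda>\<omega>. h (T_pt_set f (\<lambda>e. \<tau> e \<omega>) (0, 0) (P n))) =
        distr M borel ((\<lambda>v. h (T_set_set f v (P 0) (P n))) \<circ> (\<lambda>\<omega>. \<lambda>e\<in>?L. \<tau> e \<omega>))"
      by (simp add: comp_def Tres T_pt_set_origin[OF f(2)] column_time_def)
    also have "\<dots> = distr Q borel (\<lambda>w. h (T_set_set f w (P 0) (P n)))"
      unfolding law_tau[symmetric] using measurable_compose[OF Tm h] tauM by (subst distr_distr) auto
    also have "\<dots> = distr Q borel (\<lambda>w. h (C 0 n w))"
    proof (rule distr_cong_AE)
      show "AE w in Q. h (T_set_set f w (P 0) (P n)) = h (C 0 n w)" using TC[of n] by eventually_elim simp
    qed (use TmQ in auto)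
    finally show ?thesis .
  qed
  have mean: "M.expectation (\<lambda>\<omega>. T_pt_set f (\<lambda>e. \<tau> e \<omega>) (0, 0) (P n)) = Q.expectation (C 0 n)" for n
    using transfer[of "\<lambda>x. x" n] by simp
  have var: "M.expectation (\<lambda>\<omega>. (T_pt_set f (\<lambda>e. \<tau> e \<omega>) (0, 0) (P n) - Q.expectation (C 0 n))\<^sup>2) =
      Q.variance (C 0 n)" for n
    by (rule transfer[of "\<lambda>x. (x - Q.expectation (C 0 n))\<^sup>2"]) simp
  have "distr M borel (\<lambda>\<omega>. (T_pt_set f (\<lambda>e. \<tau> e \<omega>) (0, 0) (P n) - Q.expectation (C 0 n)) / sqrt (Q.variance (C 0 n))) =
      distr Q borel (\<lambda>w. (C 0 n w - Q.expectation (C 0 n)) / sqrt (Q.variance (C 0 n)))" for n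
    by (rule law_T[of "\<lambda>x. (x - Q.expectation (C 0 n)) / sqrt (Q.variance (C 0 n))"]) simp
  then show ?thesis using column_time_clt unfolding Let_def mean var by simp
qed

end
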